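(* For $\lambda$ a partition and $\mu=(\mu_1,\dots,\mu_L)\in\mathcal{R}^L$ an array of rectangular partitions, $$K_{\lambda\mu}(q)=q^{\|\mu\|}K_{\lambda^\top\mu^\star}(1/q).$$
   Context: **Conventions.** A partition is a weakly decreasing sequence of non-negative integers with finitely many nonzero entries, up to trailing zeros; $|\lambda|$ is the sum of its parts, $\operatorname{height}(\lambda)$ the number of nonzero parts, $\operatorname{width}(\lambda)=\lambda_1$, $\lambda^\top$ the transposed (conjugate) partition; $\lambda+\nu$ and $\lambda\cap\nu$ are the componentwise sum and minimum. $\mathcal{R}$ is the set of rectangular partitions $(i^a)$ ($a\ge1$ parts equal to $i\ge1$). For $\mu\in\mathcal{R}^L$, $|\mu|=\sum_i|\mu_i|$, $\mu^\star=(\mu_1^\top,\dots,\mu_L^\top)$ and $\|\mu\|=\sum_{i<j}|\mu_i\cap\mu_j|$. A Young tableau over a totally ordered alphabet is a filling of a Young diagram (French convention: row 1 is the bottom row) with rows weakly increasing from left to right and columns strictly increasing from bottom to top. The row-word $w_T$ reads each row from left to right, rows taken from top to bottom. Knuth equivalence $\equiv$ is generated by $zxy\equiv xzy$ ($x\le y<z$) and $yxz\equiv yzx$ ($x<y\le z$); $[w]$ is the unique tableau with $w_{[w]}\equiv w$; $\operatorname{shape}(w):=\operatorname{shape}([w])$. The product of tableaux is $S\cdot T=[w_Sw_T]$. **Paths.** Fix $n\ge2$. $\mathcal{B}_\nu$ is the set of Young tableaux of shape $\nu$ over $\{1<\dots<n\}$; the content of a tableau is (number of 1's, ..., number of $n$'s).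 For $\lambda\in\mathbb{Z}_{\ge0}^n$, $\mu\in\mathcal{R}^L$, $\mathcal{P}_{\lambda\mu}$ is the set of ordered sequences (paths) $P=p_L\otimes\cdots\otimes p_1$ with $p_i\in\mathcal{B}_{\mu_i}$ and $\sum_i\operatorname{content}(p_i)=\lambda$. For $p\in\mathcal{B}_\nu$, $p'\in\mathcal{B}_{\nu'}$ put $h(p\otimes p')=|\nu+\nu'|-|\operatorname{shape}(p\cdot p')\cap(\nu+\nu')|$, and $h(P)=\sum_{i=1}^{L-1}i\,h(p_{i+1}\otimes p_i)$. For rectangular $\nu,\nu'$ define $\sigma(p\otimes p')=\tilde p'\otimes\tilde p$, where $\tilde p'\in\mathcal{B}_{\nu'}$, $\tilde p\in\mathcal{B}_\nu$ are the unique tableaux with $p\cdot p'=\tilde p'\cdot\tilde p$. $\sigma_i(P)$ is obtained by replacing $p_{i+1}\otimes p_i$ by $\sigma(p_{i+1}\otimes p_i)$. $\mathcal{O}_P$ is the orbit (a set) of $P$ under the group generated by the $\sigma_i$, and $H(P)=\frac{1}{|\mathcal{O}_P|}\sum_{P'\in\mathcal{O}_P}h(P')$. **The map $\omega$.** With $a_i=\operatorname{height}(\mu_i)$ let $X^a=\{x_i^{(j)}:1\le i\le L,1\le j\le a_i\}$, ordered by $x_i^{(j)}<x_{i'}^{(j')}$ iff $i<i'$, or $i=i'$ and $j<j'$. For a path $P$, $\omega(P)$ is the word over $X^a$ obtained thus: start with $P$ and the empty word and repeat $|\mu|$ times: among the maximal entries still present choose the rightmost one (in the step $p_j$ with smallest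 $j$, and there in the rightmost column); if it lies in row $k$ of $p_j$, append $x_j^{(k)}$ at the right end of the word and delete the entry from $P$. **Generalized Kostka polynomials.** For a partition $\lambda$ with $\operatorname{height}(\lambda)\le n$, let $\overline{\mathcal{P}}_{\lambda\mu}=\{P\in\mathcal{P}_{\lambda\mu}:\operatorname{shape}(\omega(P))=\lambda\}$, $\tilde K_{\lambda\mu}(q)=\sum_{P\in\overline{\mathcal{P}}_{\lambda\mu}}q^{H(P)}$ and $K_{\lambda\mu}(q)=q^{\|\mu\|}\tilde K_{\lambda\mu}(1/q)$. Here $n\ge2$ is any integer with $n\ge\operatorname{height}(\lambda)$ (the definition does not depend on this choice; on the right-hand side of the claim one takes $n\ge\operatorname{height}(\lambda^\top)$). *)

theory Defs
  imports Complex_Main "HOL-Library.Poly_Mapping" "HOL-Library.Product_Lexorder"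
begin

section \<open>Partitions\<close>

text \<open>A partition is the list of its nonzero parts, so that trailing zeros never occur;
  the parts beyond the height are recovered by \<open>part\<close>, which is indexed from 0.\<close>

definition is_partition :: "nat list \<Rightarrow> bool" where
  "is_partition \<nu> \<longleftrightarrow> sorted_wrt (\<ge>) \<nu> \<and> (\<forall>x \<in> set \<nu>. x > 0)"

definition part :: "nat list \<Rightarrow> nat \<Rightarrow> nat" where
  "part \<nu> i = (if i < length \<nu> then \<nu> ! i else 0)"

definition psize :: "nat list \<Rightarrow> nat" where
  "psize \<nu> = sum_list \<nu>"

definition height :: "nat list \<Rightarrow> nat" where
  "height \<nu> = length \<nu>"

definition width :: "nat list \<Rightarrow> nat" where
  "width \<nu> = part \<nu> 0"

definition conjugate :: "nat list \<Rightarrow> nat list" where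
  "conjugate \<nu> = map (\<lambda>j. card {i. j < part \<nu> i}) [0..<width \<nu>]"

definition part_add :: "nat list \<Rightarrow> nat list \<Rightarrow> nat list" where
  "part_add \<nu> \<nu>' = map (\<lambda>i. part \<nu> i + part \<nu>' i) [0..<max (height \<nu>) (height \<nu>')]"

definition part_inter :: "nat list \<Rightarrow> nat list \<Rightarrow> nat list" where
  "part_inter \<nu> \<nu>' = map (\<lambda>i. min (part \<nu> i) (part \<nu>' i)) [0..<min (height \<nu>) (height \<nu>')]"

definition rectangles :: "nat list set" where
  "rectangles = {replicate a i | a i. a \<ge> 1 \<and> i \<ge> 1}"

text \<open>The weight \<open>\<parallel>\<mu>\<parallel>\<close> and the array \<open>\<mu>\<^sup>\<star>\<close>; the list position \<open>i\<close> holds \<open>\<mu>\<^sub>i\<^sub>+\<^sub>1\<close>.\<close>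

definition rect_norm :: "nat list list \<Rightarrow> nat" where
  "rect_norm \<mu> = (\<Sum>j<length \<mu>. \<Sum>i<j. psize (part_inter (\<mu> ! i) (\<mu> ! j)))"

definition rect_star :: "nat list list \<Rightarrow> nat list list" where
  "rect_star \<mu> = map conjugate \<mu>"

section \<open>Tableaux and Knuth equivalence\<close>

text \<open>A tableau is the list of its (nonempty) rows. French convention: \<open>T ! 0\<close> is the bottom row.\<close>

definition shape :: "'a list list \<Rightarrow> nat list" where
  "shape T = map length T"

definition tableau :: "'a::linorder list list \<Rightarrow> bool" where
  "tableau T \<longleftrightarrow> is_partition (shape T) \<and> (\<forall>r \<in> set T. sorted r) \<and>
     (\<forall>k c. Suc k < length T \<longrightarrow> c < length (T ! Suc k) \<longrightarrow> T ! k ! c < T ! Suc k ! c)"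

definition row_word :: "'a list list \<Rightarrow> 'a list" where
  "row_word T = concat (rev T)"

inductive knuth_equiv :: "'a::linorder list \<Rightarrow> 'a list \<Rightarrow> bool" where
  refl: "knuth_equiv w w"
| sym: "knuth_equiv v w \<Longrightarrow> knuth_equiv w v"
| trans: "knuth_equiv u v \<Longrightarrow> knuth_equiv v w \<Longrightarrow> knuth_equiv u w"
| zxy: "x \<le> y \<Longrightarrow> y < z \<Longrightarrow> knuth_equiv (u @ [z, x, y] @ v) (u @ [x, z, y] @ v)"
| yxz: "x < y \<Longrightarrow> y \<le> z \<Longrightarrow> knuth_equiv (u @ [y, x, z] @ v) (u @ [y, z, x] @ v)"

definition tableau_of_word :: "'a::linorder list \<Rightarrow> 'a list list" where
  "tableau_of_word w = (THE T. tableau T \<and> knuth_equiv (row_word T) w)"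

definition word_shape :: "'a::linorder list \<Rightarrow> nat list" where
  "word_shape w = shape (tableau_of_word w)"

definition tableau_prod :: "'a::linorder list list \<Rightarrow> 'a list list \<Rightarrow> 'a list list" where
  "tableau_prod S T = tableau_of_word (row_word S @ row_word T)"

section \<open>Paths\<close>

definition tableaux :: "nat \<Rightarrow> nat list \<Rightarrow> nat list list set" where
  "tableaux n \<nu> = {T. tableau T \<and> shape T = \<nu> \<and> set (row_word T) \<subseteq> {1..n}}"

text \<open>The path \<open>p\<^sub>L \<otimes> \<dots> \<otimes> p\<^sub>1\<close> is the list \<open>[p\<^sub>1, \<dots>, p\<^sub>L]\<close>, i.e. it is written
  in the reverse order and \<open>P ! i\<close> is \<open>p\<^sub>i\<^sub>+\<^sub>1\<close>. The vector \<open>\<lambda> \<in> \<int>\<^sup>n\<close> with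
  nonnegative entries is given by a list that is padded with zeros to length \<open>n\<close>.\<close>

type_synonym path = "nat list list list"

definition paths :: "nat \<Rightarrow> nat list \<Rightarrow> nat list list \<Rightarrow> path set" where
  "paths n lam \<mu> = {P. length P = length \<mu> \<and> (\<forall>i < length \<mu>. P ! i \<in> tableaux n (\<mu> ! i)) \<and>
     (\<forall>k \<in> {1..n}. (\<Sum>p\<leftarrow>P. count_list (row_word p) k) = part lam (k - 1))}"

text \<open>In \<open>energy p p'\<close>, which is \<open>h(p \<otimes> p')\<close>, the subtrahend is at most the minuend, so the
  subtraction does not truncate.\<close>

definition energy :: "nat list list \<Rightarrow> nat list list \<Rightarrow> nat" where
  "energy p p' = (let \<kappa> = part_add (shape p) (shape p') in
     psize \<kappa> - psize (part_inter (shape (tableau_prod p p')) \<kappa>))"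

definition path_energy :: "path \<Rightarrow> nat" where
  "path_energy P = (\<Sum>i = 1..<length P. i * energy (P ! i) (P ! (i - 1)))"

text \<open>\<open>\<sigma>(p \<otimes> p') = q' \<otimes> q\<close> is represented by the pair \<open>(q', q)\<close>.\<close>

definition sigma :: "nat \<Rightarrow> nat list list \<Rightarrow> nat list list \<Rightarrow> nat list list \<times> nat list list" where
  "sigma n p p' = (THE (q', q). q' \<in> tableaux n (shape p') \<and> q \<in> tableaux n (shape p) \<and>
     tableau_prod p p' = tableau_prod q' q)"

definition sigma_at :: "nat \<Rightarrow> nat \<Rightarrow> path \<Rightarrow> path" where
  "sigma_at n i P = (let (q', q) = sigma n (P ! Suc i) (P ! i) in P[Suc i := q', i := q])"

text \<open>Orbits of the group generated by the \<open>\<sigma>\<^sub>i\<close>: the generators and their inverses are applied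
  to paths with steps of rectangular shape.\<close>

definition sigma_step :: "nat \<Rightarrow> (path \<times> path) set" where
  "sigma_step n = {(P, sigma_at n i P) | P i.
     (\<forall>p \<in> set P. \<exists>\<nu> \<in> rectangles. p \<in> tableaux n \<nu>) \<and> Suc i < length P}"

definition orbit :: "nat \<Rightarrow> path \<Rightarrow> path set" where
  "orbit n P = {Q. (P, Q) \<in> (sigma_step n \<union> (sigma_step n)\<inverse>)\<^sup>*}"

definition path_weight :: "nat \<Rightarrow> path \<Rightarrow> rat" where
  "path_weight n P = of_nat (\<Sum>Q \<in> orbit n P. path_energy Q) / of_nat (card (orbit n P))"

section \<open>The map omega\<close>

text \<open>The cell \<open>(j, k, c)\<close> is in row \<open>k\<close> and column \<open>c\<close> of \<open>P ! j\<close>, all indexed from 0.\<close>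

definition cells :: "path \<Rightarrow> (nat \<times> nat \<times> nat) set" where
  "cells P = {(j, k, c). j < length P \<and> k < length (P ! j) \<and> c < length (P ! j ! k)}"

text \<open>\<open>next_cell P S\<close> is the rightmost maximal entry of \<open>P\<close> among the cells \<open>S\<close> still present.
  Being further right means a smaller \<open>j\<close>, since \<open>p\<^sub>1\<close> is the rightmost step, and for equal
  \<open>j\<close> a larger column.\<close>

definition next_cell :: "path \<Rightarrow> (nat \<times> nat \<times> nat) set \<Rightarrow> nat \<times> nat \<times> nat" where
  "next_cell P S = (THE (j, k, c). (j, k, c) \<in> S \<and>
     (\<forall>(j', k', c') \<in> S. P ! j' ! k' ! c' \<le> P ! j ! k ! c) \<and>
     (\<forall>(j', k', c') \<in> S. P ! j' ! k' ! c' = P ! j ! k ! c \<longrightarrow> j < j' \<or> j = j' \<and> c' \<le> c))"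

text \<open>The letter \<open>x\<^sub>i\<^sup>(\<^sup>j\<^sup>)\<close> is the pair \<open>(i, j)\<close> (indices from 1); the order of the
  alphabet is the lexicographic order on pairs.\<close>

primrec omega_word :: "path \<Rightarrow> nat \<Rightarrow> (nat \<times> nat \<times> nat) set \<Rightarrow> (nat \<times> nat) list" where
  "omega_word P 0 S = []"
| "omega_word P (Suc m) S =
     (let (j, k, c) = next_cell P S in (Suc j, Suc k) # omega_word P m (S - {(j, k, c)}))"

definition omega :: "path \<Rightarrow> (nat \<times> nat) list" where
  "omega P = omega_word P (card (cells P)) (cells P)"

section \<open>Generalized Kostka polynomials\<close>

text \<open>A path weight is an average over an orbit and hence a priori only rational. Polynomials in
  \<open>q\<close> therefore live in the ring of finitely supported maps from exponents to integer coefficients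
  with rational (possibly negative) exponents; its multiplication is convolution.\<close>

type_synonym qpoly = "rat \<Rightarrow>\<^sub>0 int"

definition q_pow :: "rat \<Rightarrow> qpoly" where
  "q_pow r = Poly_Mapping.single r 1"

text \<open>The substitution of \<open>1/q\<close> for \<open>q\<close>.\<close>

definition q_inv :: "qpoly \<Rightarrow> qpoly" where
  "q_inv f = Poly_Mapping.map_key uminus f"

lemma q_inv_q_pow: "q_inv (q_pow r) = q_pow (- r)"
proof -
  have inj: "inj (uminus :: rat \<Rightarrow> rat)" by (simp add: inj_def)
  show ?thesis
    by (rule poly_mapping_eqI)
      (auto simp: q_inv_def q_pow_def map_key.rep_eq inj lookup_single when_def)
qed

definition classical_paths :: "nat \<Rightarrow> nat list \<Rightarrow> nat list list \<Rightarrow> path set" where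
  "classical_paths n lam \<mu> = {P \<in> paths n lam \<mu>. word_shape (omega P) = lam}"

definition cokostka :: "nat \<Rightarrow> nat list \<Rightarrow> nat list list \<Rightarrow> qpoly" where
  "cokostka n lam \<mu> = (\<Sum>P \<in> classical_paths n lam \<mu>. q_pow (path_weight n P))"

definition kostka :: "nat \<Rightarrow> nat list \<Rightarrow> nat list list \<Rightarrow> qpoly" where
  "kostka n lam \<mu> = q_pow (of_nat (rect_norm \<mu>)) * q_inv (cokostka n lam \<mu>)"

end

theory Submission
  imports Defs "HOL-Library.Sublist"
begin

text \<open>A path is classical iff the concatenation \<open>w\<close> of the row words of its steps is a Yamanouchi word
  (read from the right). Such a word is a standard tableau in disguise: reading it adds one box at a
  time, a letter naming the row of the new box. Recording the column instead of the row gives a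
  Yamanouchi word for the transposed partition. This transposition maps Knuth moves to Knuth moves, and
  by Greene's theorem it transposes the shape of every factor of \<open>w\<close>; hence it induces a bijection of the
  classical paths for \<open>\<lambda>, \<mu>\<close> with those for \<open>\<lambda>\<^sup>T, \<mu>\<^sup>\<star>\<close>, and since \<open>\<sigma>\<close> is determined by Knuth
  equivalence, the bijection commutes with \<open>\<sigma>\<close>. For rectangles \<open>\<nu>, \<nu>'\<close> the energies of a pair and of its
  transpose add up to \<open>|\<nu> \<inter> \<nu>'|\<close>; averaging over an orbit turns this into \<open>\<parallel>\<mu>\<parallel>\<close>.\<close>

section \<open>The plactic congruence\<close>

text \<open>Both \<open>tableau_of_word\<close> and \<open>sigma\<close> are defined by unique
  existence, so the plactic monoid has to be built up, and one device carries this: counting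
  disjoint weakly increasing subwords. It gives uniqueness of the tableau of a word, and it shows
  that an operation keeping the rows of a tableau weakly increasing can only raise the shape in
  dominance order; if its inverse does the same, the shape is unchanged. Reversal with
  complementation and the crystal operators are treated this way. That \<open>sigma\<close> is well
  defined on rectangles is the multiplicity-freeness of the product of two rectangular shapes.
  Crystal operators act on factorizations, which reduces the question to Yamanouchi words, where a
  factorization is rigid. Transposition is not a map on single tableaux: the columns recorded for a
  step depend on the boxes added by the steps to its right. Therefore the word functions carry a
  starting partition \<beta>. For a single path the two energies add up to a weighted sum over
  adjacent steps, which depends on the order of the shapes; it is its average over an orbit that
  equals \<open>rect_norm\<close>.\<close>

notation knuth_equiv (infix "\<approx>" 50)

declare knuth_equiv.trans [trans]

lemma knuth_append: "u \<approx> v \<Longrightarrow> a @ u @ b \<approx> a @ v @ b"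
proof (induction rule: knuth_equiv.induct)
  case (zxy x y z u v)
  then show ?case using knuth_equiv.zxy[of x y z "a @ u" "v @ b"] by simp
next
  case (yxz x y z u v)
  then show ?case using knuth_equiv.yxz[of x y z "a @ u" "v @ b"] by simp
qed (auto intro: knuth_equiv.refl knuth_equiv.sym knuth_equiv.trans)

lemma knuth_cong:
  assumes "u \<approx> u'" "v \<approx> v'"
  shows "u @ v \<approx> u' @ v'"
proof -
  have "u @ v \<approx> u' @ v" using knuth_append[OF assms(1), of "[]" v] by simp
  moreover have "u' @ v \<approx> u' @ v'" using knuth_append[OF assms(2), of u' "[]"] by simp
  ultimately show ?thesis by (rule knuth_equiv.trans)
qed

lemma knuth_zxy: "x \<le> y \<Longrightarrow> y < z \<Longrightarrow> [z, x, y] \<approx> [x, z, y]"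
  using knuth_equiv.zxy[of x y z "[]" "[]"] by simp

lemma knuth_yxz: "x < y \<Longrightarrow> y \<le> z \<Longrightarrow> [y, x, z] \<approx> [y, z, x]"
  using knuth_equiv.yxz[of x y z "[]" "[]"] by simp

lemma knuth_count: "u \<approx> v \<Longrightarrow> count_list u = count_list v"
  by (induction rule: knuth_equiv.induct) (auto simp: fun_eq_iff)

lemma knuth_set: "u \<approx> v \<Longrightarrow> set u = set v"
  by (induction rule: knuth_equiv.induct) auto

lemma knuth_length: "u \<approx> v \<Longrightarrow> length u = length v"
  by (induction rule: knuth_equiv.induct) auto

text \<open>A Knuth relation exchanges the letters x and z. If both survive the restriction,
  convexity keeps the witness y as well and the relation survives; otherwise the two sides
  coincide.\<close>

lemma knuth_filter:
  assumes "u \<approx> v" and convex: "\<And>x y z. P x \<Longrightarrow> P z \<Longrightarrow> x \<le> y \<Longrightarrow> y \<le> z \<Longrightarrow> P y"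
  shows "filter P u \<approx> filter P v"
  using assms(1)
proof (induction rule: knuth_equiv.induct)
  case (zxy x y z u v)
  have "filter P [z, x, y] \<approx> filter P [x, z, y]"
    using zxy convex[of x z y] by (auto intro: knuth_zxy knuth_equiv.refl)
  then show ?case using knuth_append[of "filter P [z, x, y]"] by (metis filter_append)
next
  case (yxz x y z u v)
  have "filter P [y, x, z] \<approx> filter P [y, z, x]"
    using yxz convex[of x z y] by (auto intro: knuth_yxz knuth_equiv.refl)
  then show ?case using knuth_append[of "filter P [y, x, z]"] by (metis filter_append)
qed (auto intro: knuth_equiv.refl knuth_equiv.sym knuth_equiv.trans)

lemma knuth_map:
  assumes "u \<approx> v" "strict_mono f" shows "map f u \<approx> map f v"
  using assms(1)
proof (induction rule: knuth_equiv.induct)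
  case (zxy x y z u v)
  then show ?case using assms(2) knuth_equiv.zxy[of "f x" "f y" "f z" "map f u" "map f v"]
    by (simp add: strict_mono_less strict_mono_less_eq)
next
  case (yxz x y z u v)
  then show ?case using assms(2) knuth_equiv.yxz[of "f x" "f y" "f z" "map f u" "map f v"]
    by (simp add: strict_mono_less strict_mono_less_eq)
qed (auto intro: knuth_equiv.refl knuth_equiv.sym knuth_equiv.trans)

text \<open>Reversing the word and the order of the alphabet interchanges the two Knuth relations.
  Monotonicity is required on the letters of u alone, because the intended map, truncated
  subtraction from a constant, is strictly decreasing only on a bounded range.\<close>

lemma knuth_rev_map:
  assumes "u \<approx> v" and anti: "\<And>x y. x \<in> set u \<Longrightarrow> y \<in> set u \<Longrightarrow> x < y \<Longrightarrow> f y < f x"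
  shows "rev (map f u) \<approx> rev (map f v)"
proof -
  have "u \<approx> v \<Longrightarrow> (\<forall>x \<in> set u. \<forall>y \<in> set u. x < y \<longrightarrow> f y < f x) \<longrightarrow> rev (map f u) \<approx> rev (map f v)"
  proof (induction rule: knuth_equiv.induct)
    case (sym v w)
    then show ?case using knuth_set knuth_equiv.sym by metis
  next
    case (trans u v w)
    then show ?case using knuth_set knuth_equiv.trans by metis
  next
    case (zxy x y z u v)
    show ?case
    proof
      assume m: "\<forall>a \<in> set (u @ [z, x, y] @ v). \<forall>b \<in> set (u @ [z, x, y] @ v). a < b \<longrightarrow> f b < f a"
      have "f y \<le> f x" "f z < f y" using zxy m by (auto simp: le_less)
      then show "rev (map f (u @ [z, x, y] @ v)) \<approx> rev (map f (u @ [x, z, y] @ v))"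
        using knuth_equiv.sym[OF knuth_equiv.yxz[of "f z" "f y" "f x" "rev (map f v)" "rev (map f u)"]] by simp
    qed
  next
    case (yxz x y z u v)
    show ?case
    proof
      assume m: "\<forall>a \<in> set (u @ [y, x, z] @ v). \<forall>b \<in> set (u @ [y, x, z] @ v). a < b \<longrightarrow> f b < f a"
      have "f y < f x" "f z \<le> f y" using yxz m by (auto simp: le_less)
      then show "rev (map f (u @ [y, x, z] @ v)) \<approx> rev (map f (u @ [y, z, x] @ v))"
        using knuth_equiv.sym[OF knuth_equiv.zxy[of "f z" "f y" "f x" "rev (map f v)" "rev (map f u)"]] by simp
    qed
  qed (auto intro: knuth_equiv.refl)
  then show ?thesis using assms by blast
qed

text \<open>One half of a row insertion: the inserted letter x travels left through the letters
  behind the bumped letter y. At each exchange the left neighbour serves as the witness of the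
  relation.\<close>

lemma knuth_pull_small:
  assumes "sorted (y # z)" "x < y"
  shows "y # z @ [x] \<approx> y # x # z"
  using assms
proof (induction z rule: rev_induct)
  case Nil
  then show ?case by (simp add: knuth_equiv.refl)
next
  case (snoc c z)
  have "y # z @ [c, x] \<approx> y # z @ [x, c]"
  proof (cases z rule: rev_exhaust)
    case Nil
    then show ?thesis using snoc knuth_equiv.sym[OF knuth_yxz[of x y c]] by simp
  next
    case (snoc z' d)
    have "x < d" "d \<le> c" using snoc.prems snoc by (auto simp: sorted_append)
    then show ?thesis
      using knuth_equiv.sym[OF knuth_equiv.yxz[of x d c "y # z'" "[]"]] snoc by simp
  qed
  moreover have "y # z @ [x] \<approx> y # x # z" using snoc by (auto simp: sorted_append)
  then have "y # z @ [x, c] \<approx> y # x # z @ [c]"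
    using knuth_append[of "y # z @ [x]" "y # x # z" "[]" "[c]"] by simp
  ultimately show ?case by (simp add: knuth_equiv.trans)
qed

text \<open>The other half of a row insertion: the bumped letter b leaves the row to the left, past
  the letters that are at most a. Here the right neighbour is the witness.\<close>

lemma knuth_push_large:
  assumes "sorted u" "\<forall>x \<in> set u. x \<le> a" "a < b"
  shows "u @ [b, a] \<approx> b # u @ [a]"
  using assms
proof (induction u arbitrary: a rule: rev_induct)
  case Nil
  then show ?case by (simp add: knuth_equiv.refl)
next
  case (snoc x u)
  have "u @ [x, b, a] \<approx> u @ [b, x, a]"
    using snoc.prems knuth_equiv.sym[OF knuth_equiv.zxy[of x a b u "[]"]] by simp
  moreover have "u @ [b, x] \<approx> b # u @ [x]"
    using snoc.prems by (intro snoc.IH) (auto simp: sorted_append)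
  then have "u @ [b, x, a] \<approx> b # u @ [x, a]"
    using knuth_append[of "u @ [b, x]" "b # u @ [x]" "[]" "[a]"] by simp
  ultimately show ?case by (simp add: knuth_equiv.trans)
qed

text \<open>The basic step from row reading to column reading: the tail t of a row passes the part H
  of the first column below its head h. Once x has passed t, it takes over the role of h.\<close>

lemma knuth_move_column:
  assumes "sorted (h # t)" "sorted_wrt (>) (h # H)"
  shows "h # t @ H \<approx> h # H @ t"
  using assms
proof (induction H arbitrary: h)
  case Nil
  then show ?case by (simp add: knuth_equiv.refl)
next
  case (Cons x H)
  have "h # t @ [x] \<approx> h # x # t" using Cons.prems by (intro knuth_pull_small) auto
  then have "h # t @ x # H \<approx> h # x # t @ H"
    using knuth_append[of "h # t @ [x]" "h # x # t" "[]" H] by simp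
  moreover have "x # t @ H \<approx> x # H @ t"
    using Cons.prems by (intro Cons.IH) (auto intro: less_imp_le order.trans)
  then have "h # x # t @ H \<approx> h # x # H @ t"
    using knuth_append[of "x # t @ H" "x # H @ t" "[h]" "[]"] by simp
  ultimately show ?case by (simp add: knuth_equiv.trans)
qed

section \<open>Greene's theorem\<close>

text \<open>The optional letter is the state of a chain: \<open>None\<close> while the chain is
  empty, afterwards its last letter.\<close>

definition fits :: "'a::linorder option \<Rightarrow> 'a \<Rightarrow> bool" where
  "fits t a \<longleftrightarrow> (case t of None \<Rightarrow> True | Some b \<Rightarrow> b \<le> a)"

lemma fits_simps [simp]: "fits None a" "fits (Some b) a \<longleftrightarrow> b \<le> a"
  by (auto simp: fits_def)

lemma fits_mono: "fits t a \<Longrightarrow> a \<le> b \<Longrightarrow> fits t b"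
  by (cases t) auto

text \<open>\<open>chains k s w m\<close>: the word \<open>w\<close> contains \<open>k\<close> disjoint weakly increasing subwords with \<open>m\<close>
  letters altogether, where the \<open>c\<close>-th of them continues a chain whose last letter is \<open>s c\<close>.\<close>

primrec chains :: "nat \<Rightarrow> (nat \<Rightarrow> 'a::linorder option) \<Rightarrow> 'a list \<Rightarrow> nat \<Rightarrow> bool" where
  "chains k s [] m \<longleftrightarrow> m = 0"
| "chains k s (a # w) m \<longleftrightarrow> chains k s w m \<or>
     (\<exists>c<k. \<exists>m'. m = Suc m' \<and> fits (s c) a \<and> chains k (s(c := Some a)) w m')"

lemma chains_skip: "chains k s w m \<Longrightarrow> chains k s (a # w) m"
  by simp

lemma chains_take:
  "c < k \<Longrightarrow> fits (s c) a \<Longrightarrow> chains k (s(c := Some a)) w m \<Longrightarrow> chains k s (a # w) (Suc m)"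
  by auto

lemma chains_Cons_cases:
  assumes "chains k s (a # w) m"
  obtains (skip) "chains k s w m"
  | (takes) c m' where "c < k" "m = Suc m'" "fits (s c) a" "chains k (s(c := Some a)) w m'"
  using assms by auto

declare chains.simps(2) [simp del]

lemma chains_mono:
  assumes "chains k s w m" "\<And>c a. c < k \<Longrightarrow> fits (s c) a \<Longrightarrow> fits (s' c) a"
  shows "chains k s' w m"
  using assms
proof (induction w arbitrary: s s' m)
  case (Cons a w)
  from Cons.prems(1) show ?case
  proof (cases rule: chains_Cons_cases)
    case skip
    then show ?thesis using Cons by (blast intro: chains_skip)
  next
    case (takes c m')
    have "chains k (s'(c := Some a)) w m'"
      by (rule Cons.IH[OF takes(4)]) (use Cons.prems in \<open>auto split: if_splits\<close>)
    then show ?thesis using takes Cons.prems by (auto intro: chains_take)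
  qed
qed simp

text \<open>Chains are interchangeable, so two of them may exchange their continuations. This
  exchange of tails is what repairs a family of chains after a Knuth move.\<close>

lemma chains_swap:
  assumes "chains k s w m" "c < k" "d < k"
  shows "chains k (s(c := s d, d := s c)) w m"
  using assms
proof (induction w arbitrary: s m)
  case (Cons a w)
  from Cons.prems(1) show ?case
  proof (cases rule: chains_Cons_cases)
    case skip
    then show ?thesis using Cons by (blast intro: chains_skip)
  next
    case (takes e m')
    let ?s = "s(c := s d, d := s c)" and ?e = "if e = c then d else if e = d then c else e"
    have "chains k ((s(e := Some a))(c := (s(e := Some a)) d, d := (s(e := Some a)) c)) w m'"
      using Cons takes by blast
    also have "(s(e := Some a))(c := (s(e := Some a)) d, d := (s(e := Some a)) c) = ?s(?e := Some a)"
      by (auto simp: fun_eq_iff)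
    finally have "chains k (?s(?e := Some a)) w m'" .
    moreover have "fits (?s ?e) a" "?e < k" using takes Cons.prems by auto
    ultimately show ?thesis using takes chains_take by blast
  qed
qed simp

lemma chains_take_swapped:
  assumes "c \<noteq> d" "c < k" "d < k" "fits (s c) z" "fits (s d) x"
    and "chains k (s(c := Some z, d := Some x)) v m"
  shows "chains k s (x # z # v) (Suc (Suc m))"
proof (rule chains_take[of d])
  have "chains k (s(d := Some x, c := Some z)) v m"
    using assms by (simp add: fun_upd_twist)
  then show "chains k (s(d := Some x)) (z # v) (Suc m)"
    using assms by (intro chains_take[of c]) auto
qed (use assms in auto)

lemma chains_zxy_1:
  assumes "x \<le> y" "y < z" "chains k s (z # x # y # v) m"
  shows "chains k s (x # z # y # v) m"
  using assms(3)
proof (cases rule: chains_Cons_cases)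
  case skip
  then show ?thesis by (cases rule: chains_Cons_cases) (auto intro: chains_skip chains_take)
next
  case (takes c m')
  from takes(4) show ?thesis
  proof (cases rule: chains_Cons_cases)
    case skip
    then show ?thesis using takes by (auto intro: chains_skip chains_take)
  next
    case (takes d m'')
    have "d \<noteq> c" using takes assms by auto
    then show ?thesis
      using takes \<open>c < k\<close> \<open>m = Suc m'\<close> \<open>fits (s c) z\<close> chains_take_swapped[of c d k s z x] by auto
  qed
qed

lemma chains_zxy_2:
  assumes "x \<le> y" "y < z" "chains k s (x # z # y # v) m"
  shows "chains k s (z # x # y # v) m"
  using assms(3)
proof (cases rule: chains_Cons_cases)
  case skip
  then show ?thesis by (cases rule: chains_Cons_cases) (auto intro: chains_skip chains_take)
next
  case c: (takes c m')
  from c(4) show ?thesis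
  proof (cases rule: chains_Cons_cases)
    case skip
    then show ?thesis using c by (auto intro: chains_skip chains_take)
  next
    case d: (takes d m'')
    show ?thesis
    proof (cases "d = c")
      case False
      then show ?thesis using c d chains_take_swapped[of c d k s x z] by auto
    next
      case True
      then have "chains k (s(c := Some z)) (y # v) m''" using d by simp
      then show ?thesis
      proof (cases rule: chains_Cons_cases)
        case skip
        have "chains k (s(c := Some y)) v m''"
          by (rule chains_mono[OF skip]) (use assms in \<open>auto split: if_splits\<close>)
        then have "chains k (s(c := Some x)) (y # v) (Suc m'')"
          by (intro chains_take[of c]) (use assms c in auto)
        then have "chains k s (z # x # y # v) (Suc (Suc m''))"
          by - (rule chains_skip, rule chains_take[of c], use c in auto)
        then show ?thesis using c d by simp
      next
        case e: (takes e m3)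
        have ne: "e \<noteq> c" using e assms by auto
        have "chains k (s(c := Some y, e := Some z)) v m3"
          using chains_swap[OF e(4) \<open>e < k\<close> \<open>c < k\<close>] ne
          by (simp add: fun_upd_twist)
        then have "chains k (s(e := Some z, c := Some x, c := Some y)) v m3"
          using ne by (simp add: fun_upd_twist)
        then have "chains k (s(e := Some z, c := Some x)) (y # v) (Suc m3)"
          by - (rule chains_take[of c], use assms c in auto)
        then have "chains k (s(e := Some z)) (x # y # v) (Suc (Suc m3))"
          by - (rule chains_take[of c], use ne c in auto)
        moreover have "fits (s e) z" using e ne assms fits_mono[of "s e" y z] by auto
        ultimately have "chains k s (z # x # y # v) (Suc (Suc (Suc m3)))"
          by - (rule chains_take[of e], use e in auto)
        then show ?thesis using c d e by simp
      qed
    qed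
  qed
qed

lemma chains_yxz_2:
  assumes "x < y" "y \<le> z" "chains k s (y # z # x # v) m"
  shows "chains k s (y # x # z # v) m"
proof -
  have *: "chains k s (x # z # v) m" if "chains k s (z # x # v) m" for s m
    using that
  proof (cases rule: chains_Cons_cases)
    case skip
    then show ?thesis by (cases rule: chains_Cons_cases) (auto intro: chains_skip chains_take)
  next
    case c: (takes c m')
    from c(4) show ?thesis
    proof (cases rule: chains_Cons_cases)
      case skip
      then show ?thesis using c by (auto intro: chains_skip chains_take)
    next
      case d: (takes d m'')
      have "d \<noteq> c" using d assms by auto
      then show ?thesis using d c chains_take_swapped[of c d k s z x] by auto
    qed
  qed
  from assms(3) show ?thesis
    by (cases rule: chains_Cons_cases) (auto intro: * chains_skip chains_take)
qed

lemma chains_yxz_1: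
  assumes "x < y" "y \<le> z" "chains k s (y # x # z # v) m"
  shows "chains k s (y # z # x # v) m"
proof -
  have *: "chains k s (z # x # v) m \<or> (\<exists>c m'. c < k \<and> fits (s c) x \<and> m = Suc (Suc m') \<and>
      chains k (s(c := Some z)) v m')"
    if "chains k s (x # z # v) m" for s m
    using that
  proof (cases rule: chains_Cons_cases)
    case skip
    then show ?thesis by (cases rule: chains_Cons_cases) (auto intro: chains_skip chains_take)
  next
    case c: (takes c m')
    from c(4) show ?thesis
    proof (cases rule: chains_Cons_cases)
      case skip
      then show ?thesis using c by (auto intro: chains_skip chains_take)
    next
      case d: (takes d m'')
      show ?thesis
      proof (cases "d = c")
        case True
        then show ?thesis using c d by auto
      next
        case False
        then have "chains k s (z # x # v) (Suc (Suc m''))"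
          using c d by (intro chains_take_swapped[of c d]) auto
        then show ?thesis using c d by simp
      qed
    qed
  qed
  from assms(3) show ?thesis
  proof (cases rule: chains_Cons_cases)
    case skip
    from *[OF skip] show ?thesis
    proof (elim disjE exE conjE)
      assume "chains k s (z # x # v) m"
      then show ?thesis by (rule chains_skip)
    next
      fix c m' assume c: "c < k" "fits (s c) x" "m = Suc (Suc m')" "chains k (s(c := Some z)) v m'"
      have "fits (s c) y" using fits_mono[OF c(2), of y] assms by simp
      moreover have "chains k (s(c := Some y)) (z # x # v) (Suc m')"
        using c assms by (intro chains_take[of c] chains_skip) auto
      ultimately show ?thesis using c by (auto intro: chains_take)
    qed
  next
    case d: (takes d m')
    from *[OF d(4)] show ?thesis
    proof (elim disjE exE conjE)
      assume "chains k (s(d := Some y)) (z # x # v) m'"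
      then show ?thesis using d by (auto intro: chains_take)
    next
      fix c m'' assume c: "c < k" "fits ((s(d := Some y)) c) x" "m' = Suc (Suc m'')"
        "chains k (s(d := Some y, c := Some z)) v m''"
      have ne: "c \<noteq> d" using c assms by auto
      have "chains k (s(d := Some z, c := Some y)) v m''"
        using chains_swap[OF c(4) c(1) d(1)] ne by (simp add: fun_upd_twist)
      then have "chains k (s(d := Some z, c := Some x)) v m''"
        by (rule chains_mono) (use assms in \<open>auto split: if_splits\<close>)
      then have "chains k (s(d := Some z)) (x # v) (Suc m'')"
        using c ne by (intro chains_take[of c]) auto
      then have "chains k (s(d := Some y)) (z # x # v) (Suc (Suc m''))"
        by - (rule chains_take[of d], use assms d in auto)
      then show ?thesis using c d by (auto intro: chains_take)
    qed
  qed
qed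

lemma chains_append_cong:
  assumes "\<And>s m. chains k s v m \<longleftrightarrow> chains k s v' m"
  shows "chains k s (u @ v) m \<longleftrightarrow> chains k s (u @ v') m"
  by (induction u arbitrary: s m) (auto simp: assms chains.simps(2))

lemma chains_knuth:
  assumes "u \<approx> v" shows "chains k s u m \<longleftrightarrow> chains k s v m"
  using assms
proof (induction arbitrary: s m rule: knuth_equiv.induct)
  case (zxy x y z u v)
  have "chains k s ([z, x, y] @ v) m \<longleftrightarrow> chains k s ([x, z, y] @ v) m" for s m
    using chains_zxy_1[OF zxy, of k s v m] chains_zxy_2[OF zxy, of k s v m] by auto
  then show ?case by (rule chains_append_cong)
next
  case (yxz x y z u v)
  have "chains k s ([y, x, z] @ v) m \<longleftrightarrow> chains k s ([y, z, x] @ v) m" for s m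
    using chains_yxz_1[OF yxz, of k s v m] chains_yxz_2[OF yxz, of k s v m] by auto
  then show ?case by (rule chains_append_cong)
qed auto

lemma chains_subseq:
  assumes "subseq w' w" "chains k s w' m"
  shows "chains k s w m"
  using assms
proof (induction arbitrary: s m rule: list_emb.induct)
  case (list_emb_Cons xs ys y)
  then show ?case by (auto intro: chains_skip)
next
  case (list_emb_Cons2 x y xs ys)
  from list_emb_Cons2.prems show ?case
    by (cases rule: chains_Cons_cases)
      (use list_emb_Cons2 in \<open>auto intro: chains_skip chains_take\<close>)
next
  case (list_emb_Nil ys)
  then show ?case by (induction ys) (auto intro: chains_skip)
qed

text \<open>The chain c is spent on R and not continued in w. Assuming the claim for w in every
  state t of c avoids tracking the last letter of R.\<close>

lemma chains_sorted_run:
  assumes "sorted R" "\<forall>a \<in> set R. fits (s c) a" "c < k" "\<And>t. chains k (s(c := t)) w m"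
  shows "chains k s (R @ w) (length R + m)"
  using assms
proof (induction R arbitrary: s)
  case Nil
  have "s(c := s c) = s" by simp
  then show ?case using Nil by (metis append_Nil list.size(3) add_0)
next
  case (Cons a R)
  have "chains k (s(c := Some a)) (R @ w) (length R + m)"
  proof (rule Cons.IH)
    fix t show "chains k ((s(c := Some a))(c := t)) w m"
      unfolding fun_upd_upd by (rule Cons.prems(4))
  qed (use Cons.prems in auto)
  then show ?case using Cons.prems by (auto intro: chains_take)
qed

lemma chains_sorted_runs:
  assumes "\<forall>R \<in> set Rs. sorted R" "length Rs \<le> k" "\<forall>c < length Rs. s c = None"
  shows "chains k s (concat Rs) (sum_list (map length Rs))"
  using assms
proof (induction Rs arbitrary: s)
  case (Cons R Rs)
  \<comment> \<open>The first run uses the chain with the highest index, so the chains with smaller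
    indices are still empty for the remaining runs.\<close>
  have "chains k s (R @ concat Rs) (length R + sum_list (map length Rs))"
  proof (rule chains_sorted_run[where c = "length Rs"])
    fix t show "chains k (s(length Rs := t)) (concat Rs) (sum_list (map length Rs))"
      using Cons.prems by (intro Cons.IH) auto
  qed (use Cons.prems in auto)
  then show ?case by simp
qed simp

text \<open>A chain takes at most one letter of a strictly decreasing run: afterwards it is blocked.\<close>

lemma chains_decreasing_run:
  assumes "sorted_wrt (>) C" "chains k s (C @ w) m"
  shows "\<exists>s' m'. chains k s' w m' \<and> m \<le> m' + min (length C) (k - card {c. c < k \<and> (\<forall>a \<in> set C. \<not> fits (s c) a)})"
  using assms
proof (induction C arbitrary: s m)
  case (Cons a C s m)
  let ?B = "\<lambda>s C. {c. c < k \<and> (\<forall>a \<in> set C. \<not> fits (s c) a)}"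
  have fin: "finite (?B s C)" for s C by simp
  have le_k: "card (?B s C) \<le> k" for s C
    using card_mono[of "{..<k}" "?B s C"] by auto
  from Cons.prems(2) have "chains k s (a # C @ w) m" by simp
  then show ?case
  proof (cases rule: chains_Cons_cases)
    case skip
    then obtain s' m' where 1: "chains k s' w m'" "m \<le> m' + min (length C) (k - card (?B s C))"
      using Cons.IH[OF _ skip] Cons.prems by auto
    have "card (?B s (a # C)) \<le> card (?B s C)" by (rule card_mono) auto
    then show ?thesis using 1 by (intro exI[of _ s'] exI[of _ m']) auto
  next
    case (takes c m0)
    let ?s = "s(c := Some a)"
    obtain s' m' where 1: "chains k s' w m'" "m0 \<le> m' + min (length C) (k - card (?B ?s C))"
      using Cons.IH[OF _ takes(4)] Cons.prems by auto
    \<comment> \<open>After taking a, the chain c joins the chains blocked for the rest of the run,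
      all of whose letters are smaller than a. This growth of the blocked set offsets the letter
      just taken.\<close>
    have "insert c (?B s (a # C)) \<subseteq> ?B ?s C" using takes Cons.prems by auto
    then have "card (insert c (?B s (a # C))) \<le> card (?B ?s C)" by (intro card_mono) auto
    moreover have "c \<notin> ?B s (a # C)" using takes by auto
    ultimately have "Suc (card (?B s (a # C))) \<le> card (?B ?s C)" using fin by simp
    then show ?thesis using 1 takes le_k[of C ?s] by (intro exI[of _ s'] exI[of _ m']) auto
  qed
qed auto

lemma chains_decreasing_runs:
  assumes "\<forall>C \<in> set Cs. sorted_wrt (>) C" "chains k s (concat Cs) m"
  shows "m \<le> (\<Sum>C\<leftarrow>Cs. min k (length C))"
  using assms
proof (induction Cs arbitrary: s m)
  case (Cons C Cs)
  let ?b = "card {c. c < k \<and> (\<forall>a \<in> set C. \<not> fits (s c) a)}"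
  obtain s' m' where 1: "chains k s' (concat Cs) m'" "m \<le> m' + min (length C) (k - ?b)"
    using chains_decreasing_run[of C k s "concat Cs" m] Cons.prems by auto
  have "m' \<le> (\<Sum>C\<leftarrow>Cs. min k (length C))"
    using Cons.IH[OF _ 1(1)] Cons.prems by simp
  moreover have "min (length C) (k - ?b) \<le> min k (length C)" by auto
  ultimately show ?case using 1 by simp
qed simp

section \<open>Tableaux as words\<close>

text \<open>The second argument is the upper row: r' can be placed on top of r.\<close>

definition above :: "'a::linorder list \<Rightarrow> 'a list \<Rightarrow> bool" where
  "above r r' \<longleftrightarrow> length r' \<le> length r \<and> (\<forall>c < length r'. r ! c < r' ! c)"

text \<open>Unlike \<open>tableau\<close>, this allows empty rows at the top, which restrictions to small letters
  produce.\<close>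

definition wtab :: "'a::linorder list list \<Rightarrow> bool" where
  "wtab T \<longleftrightarrow> (\<forall>r \<in> set T. sorted r) \<and> sorted_wrt above T"

lemma transp_above: "transp above"
  unfolding transp_def above_def by (meson less_le_trans order.strict_trans order.trans)

lemma wtab_simps [simp]:
  "wtab []"
  "wtab (r # T) \<longleftrightarrow> sorted r \<and> (\<forall>r' \<in> set T. above r r') \<and> wtab T"
  by (auto simp: wtab_def)

lemma wtab_append: "wtab (T @ U) \<longleftrightarrow> wtab T \<and> wtab U \<and> (\<forall>r \<in> set T. \<forall>r' \<in> set U. above r r')"
  by (auto simp: wtab_def sorted_wrt_append)

lemma wtab_Cons_hd:
  "wtab (r # T) \<longleftrightarrow> sorted r \<and> wtab T \<and> (T \<noteq> [] \<longrightarrow> above r (hd T))"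
proof (cases T)
  case (Cons r' T')
  then show ?thesis using transpD[OF transp_above, of r r'] by auto
qed auto

lemma tableau_iff: "tableau T \<longleftrightarrow> wtab T \<and> [] \<notin> set T"
proof -
  have "sorted_wrt above T \<longleftrightarrow> (\<forall>k. Suc k < length T \<longrightarrow> above (T ! k) (T ! Suc k))"
    using sorted_wrt_iff_nth_Suc_transp[OF transp_above] by blast
  moreover have "sorted_wrt (\<ge>) (map length T) \<longleftrightarrow>
      (\<forall>k. Suc k < length T \<longrightarrow> length (T ! Suc k) \<le> length (T ! k))"
    by (subst sorted_wrt_iff_nth_Suc_transp) (auto simp: transp_def)
  ultimately show ?thesis
    unfolding tableau_def wtab_def is_partition_def shape_def above_def by auto
qed

lemma row_word_simps [simp]:
  "row_word [] = []"
  "row_word (r # T) = row_word T @ r"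
  "row_word (T @ U) = row_word U @ row_word T"
  by (simp_all add: row_word_def)

lemma row_word_map_filter: "row_word (map (filter P) T) = filter P (row_word T)"
  by (induction T) auto

lemma shape_simps [simp]:
  "shape [] = []" "shape (r # T) = length r # shape T" "shape (T @ U) = shape T @ shape U"
  by (simp_all add: shape_def)

lemma part_shape: "part (shape T) i = (if i < length T then length (T ! i) else 0)"
  by (simp add: part_def shape_def)

lemma part_simps [simp]: "part [] i = 0" "part (a # \<nu>) 0 = a" "part (a # \<nu>) (Suc i) = part \<nu> i"
  by (auto simp: part_def)

lemma part_antimono:
  assumes "sorted_wrt (\<ge>) \<nu>" "i \<le> j" shows "part \<nu> j \<le> part \<nu> i"
proof (cases "i < j \<and> j < length \<nu>")
  case True
  then show ?thesis using assms sorted_wrt_nth_less[OF assms(1), of i j] by (auto simp: part_def)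
qed (use assms in \<open>auto simp: part_def\<close>)

lemma wtab_shape: "wtab T \<Longrightarrow> sorted_wrt (\<ge>) (shape T)"
  by (induction T) (auto simp: shape_def above_def)

lemma part_shape_antimono: "wtab T \<Longrightarrow> i \<le> j \<Longrightarrow> part (shape T) j \<le> part (shape T) i"
  using part_antimono wtab_shape by blast

lemma sum_part: "(\<Sum>i<k. part \<nu> i) = sum_list (take k \<nu>)"
proof (induction k)
  case (Suc k)
  then show ?case by (cases "k < length \<nu>") (auto simp: take_Suc_conv_app_nth part_def)
qed simp

lemma partition_eqI:
  assumes "0 \<notin> set \<nu>" "0 \<notin> set \<nu>'" "part \<nu> = part \<nu>'" shows "\<nu> = \<nu>'"
proof -
  have *: "i < length \<nu> \<longleftrightarrow> part \<nu> i > 0" if "0 \<notin> set \<nu>" for \<nu> :: "nat list" and i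
    using that by (auto simp: part_def) (metis gr_zeroI nth_mem)
  have "i < length \<nu> \<longleftrightarrow> i < length \<nu>'" for i using *[of \<nu> i] *[of \<nu>' i] assms by simp
  then have "length \<nu> = length \<nu>'" by (metis nat_neq_iff)
  moreover have "\<nu> ! i = \<nu>' ! i" if "i < length \<nu>" for i
    using fun_cong[OF assms(3), of i] that calculation by (simp add: part_def)
  ultimately show ?thesis by (simp add: nth_equalityI)
qed

lemma finite_down_closed:
  fixes A :: "nat set"
  assumes "finite A" "\<forall>i \<in> A. \<forall>i' \<le> i. i' \<in> A"
  shows "A = {..<card A}"
proof (cases "A = {}")
  case False
  then have "A = {..Max A}" using assms by (auto intro: Max_in)
  then show ?thesis by (metis card_atMost lessThan_Suc_atMost)
qed simp

section \<open>Column words\<close>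

text \<open>The first column, read from top to bottom, is collected at the front of the word: adding
  a new top row, its head stays in front while its tail passes the column entries below by
  \<open>knuth_move_column\<close>.\<close>

lemma row_word_peel_column:
  assumes "wtab T" "[] \<notin> set T"
  shows "row_word T \<approx> rev (map hd T) @ row_word (map tl T) \<and> sorted_wrt (>) (rev (map hd T))"
  using assms
proof (induction T rule: rev_induct)
  case (snoc r T)
  then have IH: "row_word T \<approx> rev (map hd T) @ row_word (map tl T)" "sorted_wrt (>) (rev (map hd T))"
    by (auto simp: wtab_append)
  obtain h t where r: "r = h # t" using snoc.prems by (cases r) auto
  have less: "hd r' < h" if "r' \<in> set T" for r'
  proof -
    have "above r' r" using that snoc.prems by (auto simp: wtab_append)
    then show ?thesis using r by (cases r') (auto simp: above_def)
  qed
  then have dec: "sorted_wrt (>) (h # rev (map hd T))" using IH(2) by auto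
  have "r @ row_word T \<approx> r @ rev (map hd T) @ row_word (map tl T)"
    using knuth_append[OF IH(1), of r "[]"] by simp
  also have "\<dots> \<approx> (h # rev (map hd T) @ t) @ row_word (map tl T)"
    using knuth_append[OF knuth_move_column[OF _ dec, of t], of "[]" "row_word (map tl T)"]
      snoc.prems r by (simp add: wtab_append)
  finally show ?case using r dec by simp
qed (auto intro: knuth_equiv.refl)

lemma wtab_map_tl:
  assumes "wtab T" shows "wtab (map tl T)"
proof -
  have "above (tl r) (tl r')" if "above r r'" for r r' :: "'a list"
    using that by (auto simp: above_def nth_tl)
  then show ?thesis using assms by (induction T) (auto simp: sorted_tl)
qed

lemma wtab_filter_Nil: "wtab T \<Longrightarrow> wtab (filter (\<lambda>r. r \<noteq> []) T)"
  by (induction T) auto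

lemma row_word_filter_Nil: "row_word (filter (\<lambda>r. r \<noteq> []) T) = row_word T"
  by (induction T) auto

lemma part_shape_filter_Nil:
  assumes "wtab T" shows "part (shape (filter (\<lambda>r. r \<noteq> []) T)) = part (shape T)"
  using assms
proof (induction T)
  case (Cons r T)
  show ?case
  proof (cases "r = []")
    case True
    then have "\<forall>r' \<in> set T. r' = []" using Cons.prems by (auto simp: above_def)
    then have "filter (\<lambda>r. r \<noteq> []) (r # T) = []" "set (shape (r # T)) \<subseteq> {0}"
      using True by (auto simp: shape_def filter_empty_conv)
    then show ?thesis using nth_mem[of _ "shape (r # T)"] by (fastforce simp: part_def)
  next
    case False
    show ?thesis
    proof
      fix i show "part (shape (filter (\<lambda>r. r \<noteq> []) (r # T))) i = part (shape (r # T)) i"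
        using False Cons by (cases i) auto
    qed
  qed
qed simp

text \<open>Peeling off one column after another, by induction on the width, shows that the column
  reading is Knuth equivalent to the row reading. The runs are the columns, so their lengths form
  the conjugate shape.\<close>

lemma column_word_exists:
  assumes "wtab T"
  shows "\<exists>Cs. concat Cs \<approx> row_word T \<and> (\<forall>C \<in> set Cs. sorted_wrt (>) C) \<and>
    map length Cs = conjugate (shape T)"
  using assms
proof (induction "part (shape T) 0" arbitrary: T)
  case 0
  then have "part (shape T) i = 0" for i using part_shape_antimono[of T 0 i] by simp
  then have "\<forall>r \<in> set T. r = []" by (metis in_set_conv_nth length_0_conv part_shape)
  then have "row_word T = []" by (induction T) auto
  then show ?case using 0 by (intro exI[of _ "[]"]) (auto simp: conjugate_def width_def knuth_equiv.refl)
next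
  case (Suc p)
  \<comment> \<open>Empty rows have no head to peel off; discarding them changes neither the word
    nor the parts of the shape.\<close>
  let ?U = "filter (\<lambda>r. r \<noteq> []) T"
  have U: "wtab ?U" "[] \<notin> set ?U" "part (shape ?U) = part (shape T)"
    using Suc.prems by (auto simp: wtab_filter_Nil part_shape_filter_Nil)
  have part_tl: "part (shape (map tl ?U)) i = part (shape T) i - 1" for i
    unfolding U(3)[symmetric] by (simp add: part_shape)
  obtain Cs where Cs: "concat Cs \<approx> row_word (map tl ?U)" "\<forall>C \<in> set Cs. sorted_wrt (>) C"
    "map length Cs = conjugate (shape (map tl ?U))"
  proof -
    have "p = part (shape (map tl ?U)) 0" using part_tl[of 0] Suc.hyps(2) by simp
    then show thesis using Suc.hyps(1)[of "map tl ?U"] wtab_map_tl[OF U(1)] that by blast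
  qed
  have peel: "row_word ?U \<approx> rev (map hd ?U) @ row_word (map tl ?U)"
    "sorted_wrt (>) (rev (map hd ?U))"
    using row_word_peel_column[OF U(1,2)] by auto
  have "rev (map hd ?U) @ concat Cs \<approx> rev (map hd ?U) @ row_word (map tl ?U)"
    using knuth_append[OF Cs(1), of _ "[]"] by simp
  also have "\<dots> \<approx> row_word T"
    using knuth_equiv.sym[OF peel(1)] by (simp add: row_word_filter_Nil)
  finally have "concat (rev (map hd ?U) # Cs) \<approx> row_word T" by simp
  moreover have "conjugate (shape T) = length ?U # conjugate (shape (map tl ?U))"
  proof -
    have "{i. 0 < part (shape T) i} = {..<length ?U}"
      using U(2) nth_mem[of _ ?U] by (auto simp: U(3)[symmetric] part_shape)
    then have c: "card {i. 0 < part (shape T) i} = length ?U" by simp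
    have "[0..<Suc p] = 0 # map Suc [0..<p]"
      by (simp add: map_Suc_upt upt_conv_Cons del: upt_Suc)
    then show ?thesis
      using c by (simp add: conjugate_def width_def part_tl less_diff_conv o_def Suc.hyps(2)[symmetric]
        del: upt_Suc)
  qed
  ultimately show ?case using Cs peel(2)
    by (intro exI[of _ "rev (map hd ?U) # Cs"]) auto
qed

text \<open>Both sides count the cells in the k lowest rows, once by columns and once by
  rows.\<close>

lemma sum_min_conjugate:
  assumes "sorted_wrt (\<ge>) \<nu>"
  shows "(\<Sum>c\<leftarrow>conjugate \<nu>. min k c) = (\<Sum>i<k. part \<nu> i)"
proof -
  let ?w = "width \<nu>"
  have le: "part \<nu> i \<le> ?w" for i unfolding width_def using part_antimono[OF assms, of 0 i] by simp
  have eq: "min k (card {i. j < part \<nu> i}) = (\<Sum>i<k. if j < part \<nu> i then 1 else 0)" for j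
  proof -
    let ?A = "{i. j < part \<nu> i}"
    have "finite ?A"
      by (rule finite_subset[of _ "{..<length \<nu>}"]) (auto simp: part_def split: if_splits)
    moreover have "\<forall>i \<in> ?A. \<forall>i' \<le> i. i' \<in> ?A"
      using part_antimono[OF assms] by (auto intro: less_le_trans)
    ultimately have A: "?A = {..<card ?A}" by (rule finite_down_closed)
    have "{..<k} \<inter> ?A = {..<min k (card ?A)}" by (subst A) auto
    then show ?thesis by (simp add: sum.If_cases)
  qed
  have "(\<Sum>c\<leftarrow>conjugate \<nu>. min k c) = (\<Sum>j<?w. min k (card {i. j < part \<nu> i}))"
    by (simp add: conjugate_def o_def sum_list_sum_nth atLeast0LessThan)
  also have "\<dots> = (\<Sum>j<?w. \<Sum>i<k. if j < part \<nu> i then 1 else 0)"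
    by (simp only: eq)
  also have "\<dots> = (\<Sum>i<k. \<Sum>j<?w. if j < part \<nu> i then 1 else 0)"
    by (rule sum.swap)
  also have "\<dots> = (\<Sum>i<k. part \<nu> i)"
  proof (rule sum.cong)
    fix i
    have "{..<?w} \<inter> {j. j < part \<nu> i} = {..<part \<nu> i}" using le[of i] by auto
    then show "(\<Sum>j<?w. if j < part \<nu> i then 1 else 0) = part \<nu> i" by (simp add: sum.If_cases)
  qed simp
  finally show ?thesis .
qed

section \<open>Uniqueness of the tableau of a word\<close>

text \<open>One half of Greene's theorem. In the column word each of the k chains meets each
  strictly decreasing column at most once, so a column of length c contributes at most
  \<open>min k c\<close>.\<close>

lemma chains_upper:
  assumes "wtab T" "row_word T \<approx> w" "chains k s w m"
  shows "m \<le> (\<Sum>i<k. part (shape T) i)"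
proof -
  obtain Cs where Cs: "concat Cs \<approx> row_word T" "\<forall>C \<in> set Cs. sorted_wrt (>) C"
    "map length Cs = conjugate (shape T)"
    using column_word_exists[OF assms(1)] by blast
  have "chains k s (concat Cs) m"
    using chains_knuth[OF knuth_equiv.trans[OF Cs(1) assms(2)]] assms(3) by blast
  then have "m \<le> (\<Sum>C\<leftarrow>Cs. min k (length C))" by (rule chains_decreasing_runs[OF Cs(2)])
  also have "\<dots> = (\<Sum>c\<leftarrow>map length Cs. min k c)" by (simp add: o_def)
  also have "\<dots> = (\<Sum>i<k. part (shape T) i)"
    using sum_min_conjugate[OF wtab_shape[OF assms(1)]] Cs(3) by simp
  finally show ?thesis .
qed

lemma sorted_runs_upper:
  assumes "wtab T" "row_word T \<approx> w" "\<forall>R \<in> set Rs. sorted R" "subseq (concat Rs) w" "length Rs \<le> k"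
  shows "sum_list (map length Rs) \<le> (\<Sum>i<k. part (shape T) i)"
  using chains_upper[OF assms(1,2) chains_subseq[OF assms(4) chains_sorted_runs[OF assms(3,5), of "\<lambda>_. None"]]]
  by simp

text \<open>The other half of Greene's theorem: the k lowest rows form a suffix of the row word and
  serve as k chains.\<close>

lemma chains_lower:
  assumes "wtab T" "row_word T \<approx> w"
  shows "chains k (\<lambda>_. None) w (\<Sum>i<k. part (shape T) i)"
proof -
  let ?Rs = "rev (take k T)"
  have "row_word T = row_word (drop k T) @ concat ?Rs"
    by (metis append_take_drop_id row_word_def row_word_simps(3))
  then have "subseq (concat ?Rs) (row_word T)" by (metis list_emb_append2 subseq_order.refl)
  moreover have "chains k (\<lambda>_. None) (concat ?Rs) (sum_list (map length ?Rs))"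
    using assms(1) by (intro chains_sorted_runs) (auto simp: wtab_def dest: in_set_takeD)
  moreover have "sum_list (map length ?Rs) = (\<Sum>i<k. part (shape T) i)"
    by (simp add: sum_part shape_def take_map flip: rev_map)
  ultimately have "chains k (\<lambda>_. None) (row_word T) (\<Sum>i<k. part (shape T) i)"
    using chains_subseq by metis
  then show ?thesis using chains_knuth[OF assms(2)] by blast
qed

lemma sums_eqD:
  fixes f g :: "nat \<Rightarrow> nat"
  assumes "\<And>k. (\<Sum>i<k. f i) = (\<Sum>i<k. g i)" shows "f = g"
proof
  fix i show "f i = g i" using assms[of "Suc i"] assms[of i] by simp
qed

lemma wtab_shape_unique:
  assumes "wtab T" "wtab T'" "row_word T \<approx> row_word T'"
  shows "part (shape T) = part (shape T')"
proof (rule sums_eqD)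
  fix k
  show "(\<Sum>i<k. part (shape T) i) = (\<Sum>i<k. part (shape T') i)"
    using chains_upper[OF assms(1,3) chains_lower[OF assms(2) knuth_equiv.refl]]
      chains_upper[OF assms(2) knuth_equiv.sym[OF assms(3)] chains_lower[OF assms(1) knuth_equiv.refl]]
    by (rule le_antisym[rotated])
qed

lemma sorted_filter_le: "sorted r \<Longrightarrow> filter (\<lambda>x. x \<le> a) r = takeWhile (\<lambda>x. x \<le> a) r"
proof (induction r)
  case (Cons x r)
  show ?case
  proof (cases "x \<le> a")
    case False
    then have "\<forall>y \<in> set (x # r). \<not> y \<le> a" using Cons.prems by auto
    then have "filter (\<lambda>x. x \<le> a) (x # r) = []" by (simp only: filter_empty_conv)
    then show ?thesis using False by simp
  next
    case True
    then show ?thesis using Cons by simp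
  qed
qed simp

lemma wtab_filter_le:
  fixes T :: "'a::linorder list list"
  assumes "wtab T" shows "wtab (map (filter (\<lambda>x. x \<le> a)) T)"
proof -
  have *: "above (takeWhile (\<lambda>x. x \<le> a) r) (takeWhile (\<lambda>x. x \<le> a) r')" if "above r r'" for r r' :: "'a list"
  proof -
    let ?l = "length (takeWhile (\<lambda>x. x \<le> a) r)" and ?l' = "length (takeWhile (\<lambda>x. x \<le> a) r')"
    have l': "?l' \<le> length r" using that length_takeWhile_le le_trans unfolding above_def by blast
    have lt: "r ! c < r' ! c \<and> r' ! c \<le> a" if "c < ?l'" for c
    proof
      have "c < length r'" using that length_takeWhile_le less_le_trans by blast
      then show "r ! c < r' ! c" using \<open>above r r'\<close> by (simp add: above_def)
      show "r' ! c \<le> a" using that by (metis nth_mem set_takeWhileD takeWhile_nth)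
    qed
    have le: "?l' \<le> ?l"
    proof (rule ccontr)
      assume "\<not> ?l' \<le> ?l"
      then have "?l < ?l'" by simp
      moreover have "\<not> r ! ?l \<le> a" using calculation l' by (intro nth_length_takeWhile) simp
      moreover have "r ! ?l < r' ! ?l" "r' ! ?l \<le> a" using lt calculation by blast+
      ultimately show False by order
    qed
    then show ?thesis using lt by (simp add: above_def takeWhile_nth)
  qed
  have "above (filter (\<lambda>x. x \<le> a) r) (filter (\<lambda>x. x \<le> a) r')"
    if "above r r'" "sorted r" "sorted r'" for r r' :: "'a list"
    using *[OF that(1)] that sorted_filter_le by metis
  then show ?thesis using assms by (induction T) (auto simp: sorted_wrt_filter wtab_def)
qed

lemma sorted_eqI_filter_le:
  assumes "sorted r" "sorted r'"
    and "\<And>a. length (filter (\<lambda>x. x \<le> a) r) = length (filter (\<lambda>x. x \<le> a) r')"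
  shows "r = r'"
  using assms
proof (induction r arbitrary: r')
  case Nil
  then show ?case
  proof (cases r')
    case (Cons y t)
    then show ?thesis using Nil(3)[of y] by simp
  qed simp
next
  case (Cons x r)
  obtain y t where r': "r' = y # t" using Cons.prems(3)[of x] by (cases r') auto
  have "x = y"
  proof (rule ccontr)
    assume "x \<noteq> y"
    then consider "x < y" | "y < x" by fastforce
    then show False
    proof cases
      case 1
      then have "filter (\<lambda>z. z \<le> x) r' = []"
        using Cons.prems(2) r' by (auto simp: filter_empty_conv)
      then show False using Cons.prems(3)[of x] by simp
    next
      case 2
      then have "filter (\<lambda>z. z \<le> y) (x # r) = []"
        using Cons.prems(1) by (auto simp: filter_empty_conv)
      then show False using Cons.prems(3)[of y] r' by simp
    qed
  qed
  moreover have "r = t"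
  proof (rule Cons.IH)
    fix a show "length (filter (\<lambda>x. x \<le> a) r) = length (filter (\<lambda>x. x \<le> a) t)"
      using Cons.prems(3)[of a] r' \<open>x = y\<close> by (cases "y \<le> a") auto
  qed (use Cons.prems r' in auto)
  ultimately show ?case using r' by simp
qed

text \<open>Restricting to the letters at most a respects Knuth equivalence, and Greene's theorem
  determines the shape of the restriction. Hence the number of entries at most a in each row is
  determined for every a, and these numbers determine a sorted row.\<close>

lemma wtab_rows_unique:
  assumes "wtab T" "wtab T'" "row_word T \<approx> row_word T'" "i < length T" "i < length T'"
  shows "T ! i = T' ! i"
proof (rule sorted_eqI_filter_le)
  fix a
  have "row_word (map (filter (\<lambda>x. x \<le> a)) T) \<approx> row_word (map (filter (\<lambda>x. x \<le> a)) T')"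
    unfolding row_word_map_filter by (rule knuth_filter[OF assms(3)]) auto
  then have "part (shape (map (filter (\<lambda>x. x \<le> a)) T)) = part (shape (map (filter (\<lambda>x. x \<le> a)) T'))"
    using assms(1,2) by (intro wtab_shape_unique wtab_filter_le)
  from fun_cong[OF this, of i]
  show "length (filter (\<lambda>x. x \<le> a) (T ! i)) = length (filter (\<lambda>x. x \<le> a) (T' ! i))"
    using assms by (simp add: part_shape)
qed (use assms in \<open>auto simp: wtab_def\<close>)

lemma tableau_unique:
  assumes "tableau T" "tableau T'" "row_word T \<approx> row_word T'"
  shows "T = T'"
proof -
  have "part (shape T) = part (shape T')" using assms by (auto simp: tableau_iff intro: wtab_shape_unique)
  then have "shape T = shape T'"
    using assms by (intro partition_eqI) (auto simp: tableau_iff shape_def)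
  then have "length T = length T'" unfolding shape_def by (metis length_map)
  then show ?thesis using assms by (intro nth_equalityI) (simp_all add: tableau_iff wtab_rows_unique[of T T'])
qed

section \<open>Row insertion\<close>

fun row_insert :: "'a::linorder \<Rightarrow> 'a list list \<Rightarrow> 'a list list" where
  "row_insert a [] = [[a]]"
| "row_insert a (r # T) = (let p = length (takeWhile (\<lambda>b. b \<le> a) r) in
     if p = length r then (r @ [a]) # T else r[p := a] # row_insert (r ! p) T)"

text \<open>With r = u b v and b the bumped letter, a moves left through v until it stands behind b,
  and then b moves left through u.\<close>

lemma row_bump:
  assumes "sorted r" "p = length (takeWhile (\<lambda>b. b \<le> a) r)" "p < length r"
  shows "sorted (r[p := a])" "r @ [a] \<approx> r ! p # r[p := a]" "a < r ! p" "\<forall>c<p. r ! c \<le> a"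
proof -
  show small: "\<forall>c<p. r ! c \<le> a"
    using assms(2) by (metis nth_mem set_takeWhileD takeWhile_nth)
  show large: "a < r ! p" using nth_length_takeWhile[of "\<lambda>b. b \<le> a" r] assms by auto
  let ?u = "take p r" and ?v = "drop (Suc p) r"
  have r: "r = ?u @ r ! p # ?v" using assms(3) by (simp add: id_take_nth_drop[symmetric])
  have upd: "r[p := a] = ?u @ a # ?v" using assms(3) by (rule upd_conv_take_nth_drop)
  have u: "\<forall>x \<in> set ?u. x \<le> a" using small assms(3) by (auto simp: in_set_conv_nth)
  have s: "sorted (?u @ r ! p # ?v)" using assms(1) r by metis
  show "sorted (r[p := a])"
    unfolding upd using s u large by (auto simp: sorted_append)
  have "r ! p # ?v @ [a] \<approx> r ! p # a # ?v"
    using s large by (intro knuth_pull_small) (auto simp: sorted_append)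
  then have "?u @ r ! p # ?v @ [a] \<approx> ?u @ r ! p # a # ?v"
    using knuth_append[of "r ! p # ?v @ [a]" "r ! p # a # ?v" ?u "[]"] by simp
  also have "\<dots> \<approx> r ! p # ?u @ a # ?v"
    using knuth_append[OF knuth_push_large[of ?u a "r ! p"], of "[]" ?v] s u large
    by (auto simp: sorted_append)
  finally show "r @ [a] \<approx> r ! p # r[p := a]" using r upd by (metis append.assoc append_Cons)
qed

lemma row_word_row_insert:
  "wtab T \<Longrightarrow> row_word (row_insert a T) \<approx> row_word T @ [a]"
proof (induction a T rule: row_insert.induct)
  case (2 a r T)
  define p where "p = length (takeWhile (\<lambda>b. b \<le> a) r)"
  show ?case
  proof (cases "p = length r")
    case True
    then show ?thesis by (simp add: p_def knuth_equiv.refl)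
  next
    case False
    then have lt: "p < length r" unfolding p_def using length_takeWhile_le le_neq_implies_less by blast
    have "row_word (row_insert (r ! p) T) \<approx> row_word T @ [r ! p]"
      using 2 False unfolding p_def by simp
    then have "row_word (row_insert a (r # T)) \<approx> row_word T @ (r ! p # r[p := a])"
      using False knuth_append[of _ _ "[]" "r[p := a]"] unfolding p_def
      by (fastforce simp: Let_def)
    also have "\<dots> \<approx> row_word T @ r @ [a]"
      using knuth_append[OF knuth_equiv.sym[OF row_bump(2)[of r p a]], of "row_word T" "[]"] 2 lt p_def
      by simp
    finally show ?thesis by simp
  qed
qed (auto intro: knuth_equiv.refl)

text \<open>Since \<open>above\<close> is transitive, column strictness after a bump need only be
  checked against the next row, so it is enough to know the bottom row after insertion; q is the
  column that b enters.\<close>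

lemma hd_row_insert:
  assumes "T \<noteq> [] \<Longrightarrow> sorted (hd T)"
  shows "\<exists>q. hd (row_insert b T) =
      (if T = [] then [b] else if q = length (hd T) then hd T @ [b] else (hd T)[q := b]) \<and>
    (T \<noteq> [] \<longrightarrow> q \<le> length (hd T) \<and> (\<forall>c<q. hd T ! c \<le> b) \<and> (q < length (hd T) \<longrightarrow> b < hd T ! q))"
proof (cases T)
  case (Cons r U)
  define q where "q = length (takeWhile (\<lambda>x. x \<le> b) r)"
  have "q \<le> length r" unfolding q_def by (rule length_takeWhile_le)
  moreover have "\<forall>c<q. r ! c \<le> b"
    unfolding q_def by (metis nth_mem set_takeWhileD takeWhile_nth)
  moreover have "q < length r \<longrightarrow> b < r ! q"
    unfolding q_def using nth_length_takeWhile[of "\<lambda>x. x \<le> b" r] by auto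
  ultimately show ?thesis using Cons by (intro exI[of _ q]) (auto simp: q_def Let_def)
qed simp

lemma wtab_row_insert: "wtab T \<Longrightarrow> [] \<notin> set T \<Longrightarrow> wtab (row_insert a T) \<and> [] \<notin> set (row_insert a T)"
proof (induction a T rule: row_insert.induct)
  case (2 a r T)
  define p where "p = length (takeWhile (\<lambda>b. b \<le> a) r)"
  show ?case
  proof (cases "p = length r")
    case True
    then have "\<forall>x \<in> set r. x \<le> a" unfolding p_def
      by (metis take_all_iff takeWhile_eq_all_conv takeWhile_eq_take order_refl)
    then have "sorted (r @ [a])" using 2 by (auto simp: sorted_append)
    moreover have "above (r @ [a]) r'" if "above r r'" for r'
      using that by (auto simp: above_def nth_append)
    ultimately show ?thesis using True 2 by (auto simp: p_def Let_def)
  next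
    case False
    then have lt: "p < length r" unfolding p_def using length_takeWhile_le le_neq_implies_less by blast
    let ?b = "r ! p" and ?r = "r[p := a]"
    have bump: "sorted ?r" "a < ?b" "\<forall>c<p. r ! c \<le> a" using row_bump[of r p a] 2 lt p_def by auto
    have IH: "wtab (row_insert ?b T)" "[] \<notin> set (row_insert ?b T)"
      using 2 False unfolding p_def by auto
    have abv: "above r (hd T)" if "T \<noteq> []" using 2 that by (simp add: wtab_Cons_hd del: wtab_simps)
    have "T \<noteq> [] \<Longrightarrow> sorted (hd T)" using 2 by (auto simp: wtab_def)
    from hd_row_insert[OF this, of ?b] obtain q where
      hd: "hd (row_insert ?b T) = (if T = [] then [?b] else if q = length (hd T) then hd T @ [?b]
        else (hd T)[q := ?b])"
      and q: "T \<noteq> [] \<Longrightarrow> q \<le> length (hd T)" "T \<noteq> [] \<Longrightarrow> \<forall>c<q. hd T ! c \<le> ?b"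
      by auto
    \<comment> \<open>A bumped letter never moves to the right: the entry over \<open>r ! p\<close>
      already exceeds it.\<close>
    have qp: "q \<le> p" if "T \<noteq> []"
    proof (rule ccontr)
      assume "\<not> q \<le> p"
      then have "p < q" by simp
      then have "hd T ! p \<le> ?b" "p < length (hd T)" using q that by auto
      then show False using abv[OF that] unfolding above_def by auto
    qed
    have ra: "?r ! c \<le> a" if "c \<le> p" for c
      using that bump(3) lt by (cases "c = p") auto
    have rr: "?r ! c \<le> r ! c" if "c < length r" for c
      using that bump(2) lt by (cases "c = p") auto
    have "above ?r (hd (row_insert ?b T))"
    proof (cases "T = []")
      case True
      then show ?thesis using lt hd ra[of 0] bump(2) by (auto simp: above_def)
    next
      case nonempty: False
      have len: "length (hd T) \<le> length r" and col: "\<forall>c < length (hd T). r ! c < hd T ! c"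
        using abv[OF nonempty] by (auto simp: above_def)
      have a1: "?r ! c < hd T ! c" if "c < length (hd T)" for c
        using that len col rr[of c] by (meson le_less_trans less_le_trans)
      have a2: "?r ! q < ?b" using ra[OF qp[OF nonempty]] bump(2) by simp
      show ?thesis
      proof (cases "q = length (hd T)")
        case True
        then have "hd (row_insert ?b T) = hd T @ [?b]" using hd nonempty by simp
        moreover have "length (hd T) < length r" using True qp[OF nonempty] lt by simp
        ultimately show ?thesis using a1 a2 True by (auto simp: above_def nth_append less_Suc_eq)
      next
        case False
        then have "hd (row_insert ?b T) = (hd T)[q := ?b]" using hd nonempty by simp
        moreover have "?r ! c < (hd T)[q := ?b] ! c" if "c < length (hd T)" for c
          using a1[OF that] a2 that by (cases "c = q") auto
        ultimately show ?thesis using len by (simp add: above_def)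
      qed
    qed
    then have "wtab (?r # row_insert ?b T)"
      using IH bump(1) by (simp add: wtab_Cons_hd del: wtab_simps)
    moreover have "?r \<noteq> []" using lt by auto
    moreover have "row_insert a (r # T) = ?r # row_insert ?b T"
      using False by (simp add: p_def Let_def)
    ultimately show ?thesis using IH(2) by (metis set_ConsD)
  qed
qed auto

lemma tableau_exists: "\<exists>T. tableau T \<and> row_word T \<approx> w"
proof (induction w rule: rev_induct)
  case Nil
  have "tableau []" by (simp add: tableau_iff)
  then show ?case using knuth_equiv.refl by (metis row_word_simps(1))
next
  case (snoc a w)
  then obtain T where T: "wtab T" "[] \<notin> set T" "row_word T \<approx> w" by (auto simp: tableau_iff)
  have "row_word (row_insert a T) \<approx> w @ [a]"
    using row_word_row_insert[OF T(1), of a] knuth_append[OF T(3), of "[]" "[a]"]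
    by (simp add: knuth_equiv.trans)
  then show ?case using wtab_row_insert[OF T(1,2)] tableau_iff by blast
qed

lemma tableau_of_word:
  shows tableau_tableau_of_word: "tableau (tableau_of_word w)"
    and row_word_tableau_of_word: "row_word (tableau_of_word w) \<approx> w"
proof -
  have "\<exists>!T. tableau T \<and> row_word T \<approx> w"
    using tableau_exists tableau_unique knuth_equiv.sym knuth_equiv.trans by metis
  from theI'[OF this] show "tableau (tableau_of_word w)" "row_word (tableau_of_word w) \<approx> w"
    unfolding tableau_of_word_def by auto
qed

lemma tableau_of_word_eqI: "tableau T \<Longrightarrow> row_word T \<approx> w \<Longrightarrow> tableau_of_word w = T"
  using tableau_of_word[of w] tableau_unique knuth_equiv.sym knuth_equiv.trans by metis

lemma tableau_of_row_word: "tableau T \<Longrightarrow> tableau_of_word (row_word T) = T"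
  by (simp add: tableau_of_word_eqI knuth_equiv.refl)

lemma tableau_of_word_cong: "u \<approx> v \<Longrightarrow> tableau_of_word u = tableau_of_word v"
  using tableau_of_word[of u] tableau_of_word_eqI knuth_equiv.trans knuth_equiv.sym by metis

lemma tableau_of_word_eq_iff: "tableau_of_word u = tableau_of_word v \<longleftrightarrow> u \<approx> v"
  using tableau_of_word tableau_of_word_cong knuth_equiv.sym knuth_equiv.trans by metis

lemma word_shape_cong: "u \<approx> v \<Longrightarrow> word_shape u = word_shape v"
  by (simp add: word_shape_def tableau_of_word_cong)

lemma word_shape_row_word: "tableau T \<Longrightarrow> word_shape (row_word T) = shape T"
  by (simp add: word_shape_def tableau_of_row_word)

lemma part_word_shape: "wtab T \<Longrightarrow> row_word T \<approx> w \<Longrightarrow> part (word_shape w) = part (shape T)"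
  unfolding word_shape_def
  using wtab_shape_unique tableau_of_word[of w] tableau_iff knuth_equiv.sym knuth_equiv.trans by metis

lemma is_partition_word_shape: "is_partition (word_shape w)"
  using tableau_tableau_of_word[of w] by (simp add: word_shape_def tableau_def)

text \<open>Together with the next lemma this is the form in which Greene's theorem is applied to
  words: weakly increasing runs bound the partial sums of the shape from below, strictly decreasing
  runs from above.\<close>

lemma word_shape_upper:
  assumes "\<forall>R \<in> set Rs. sorted R" "subseq (concat Rs) w" "length Rs \<le> k"
  shows "sum_list (map length Rs) \<le> (\<Sum>i<k. part (word_shape w) i)"
  unfolding word_shape_def
  using sorted_runs_upper[OF _ row_word_tableau_of_word assms] tableau_tableau_of_word tableau_iff
  by blast

lemma word_shape_lower:
  assumes "concat Cs \<approx> w" "\<forall>C \<in> set Cs. sorted_wrt (>) C"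
  shows "(\<Sum>i<k. part (word_shape w) i) \<le> (\<Sum>C\<leftarrow>Cs. min k (length C))"
proof -
  have "chains k (\<lambda>_. None) (concat Cs) (\<Sum>i<k. part (word_shape w) i)"
    unfolding word_shape_def
    using chains_lower[OF _ knuth_equiv.trans[OF row_word_tableau_of_word knuth_equiv.sym[OF assms(1)]]]
      tableau_tableau_of_word tableau_iff by blast
  then show ?thesis by (rule chains_decreasing_runs[OF assms(2)])
qed

section \<open>Yamanouchi words\<close>

abbreviation add_count :: "(nat \<Rightarrow> nat) \<Rightarrow> nat list \<Rightarrow> nat \<Rightarrow> nat" (infixl "\<oplus>" 65) where
  "\<beta> \<oplus> w \<equiv> (\<lambda>i. \<beta> i + count_list w i)"

definition dominant :: "(nat \<Rightarrow> nat) \<Rightarrow> bool" where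
  "dominant g \<longleftrightarrow> (\<forall>i\<ge>1. g (Suc i) \<le> g i)"

lemma dominant_mono: "dominant g \<Longrightarrow> 1 \<le> i \<Longrightarrow> i \<le> j \<Longrightarrow> g j \<le> g i"
proof (induction j)
  case (Suc j)
  show ?case
  proof (cases "i = Suc j")
    case False
    then have "g j \<le> g i" "1 \<le> j" using Suc by auto
    then show ?thesis using Suc.prems(1) unfolding dominant_def by (meson le_trans)
  qed simp
qed simp

text \<open>Words are read from the right, starting with a partition whose \<open>i\<close>-th part is \<open>\<beta> i\<close>; the letter
  \<open>i\<close> adds a box to row \<open>i\<close>. Letters and parts are indexed from 1.\<close>

primrec yam :: "(nat \<Rightarrow> nat) \<Rightarrow> nat list \<Rightarrow> bool" where
  "yam \<beta> [] \<longleftrightarrow> dominant \<beta>"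
| "yam \<beta> (a # w) \<longleftrightarrow> 1 \<le> a \<and> yam \<beta> w \<and> dominant (\<beta> \<oplus> (a # w))"

abbreviation "yam0 \<equiv> yam (\<lambda>_. 0)"

text \<open>Each letter is replaced by the column of the box it adds.\<close>

primrec trw :: "(nat \<Rightarrow> nat) \<Rightarrow> nat list \<Rightarrow> nat list" where
  "trw \<beta> [] = []"
| "trw \<beta> (a # w) = (\<beta> a + Suc (count_list w a)) # trw \<beta> w"

abbreviation "trw0 \<equiv> trw (\<lambda>_. 0)"

lemma yam_dominant: "yam \<beta> w \<Longrightarrow> dominant \<beta>" "yam \<beta> w \<Longrightarrow> dominant (\<beta> \<oplus> w)"
  by (induction w) auto

lemma yam_letters: "yam \<beta> w \<Longrightarrow> a \<in> set w \<Longrightarrow> 1 \<le> a"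
  by (induction w) auto

lemma yam_append: "yam \<beta> (u @ v) \<longleftrightarrow> yam (\<beta> \<oplus> v) u \<and> yam \<beta> v"
proof (induction u)
  case (Cons a u)
  have "\<beta> \<oplus> v \<oplus> (a # u) = \<beta> \<oplus> (a # u @ v)" by auto
  then show ?case using Cons by (auto simp del: count_list.simps)
qed (use yam_dominant(2)[of \<beta> v] in auto)

lemma trw_append: "trw \<beta> (u @ v) = trw (\<beta> \<oplus> v) u @ trw \<beta> v"
  by (induction u) auto

lemma length_trw [simp]: "length (trw \<beta> w) = length w"
  by (induction w) auto

text \<open>Read from the right, the two words pass through the same functions except after two
  letters. Given dominance at all other stages, the two conditions at that stage agree at every
  single index.\<close>

lemma yam_zxy:
  assumes "x \<le> y" "y < z" shows "yam \<beta> [z, x, y] \<longleftrightarrow> yam \<beta> [x, z, y]"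
proof -
  have "(\<beta> \<oplus> [x, y]) (Suc i) \<le> (\<beta> \<oplus> [x, y]) i \<longleftrightarrow> (\<beta> \<oplus> [z, y]) (Suc i) \<le> (\<beta> \<oplus> [z, y]) i"
    if "\<beta> (Suc i) \<le> \<beta> i" "(\<beta> \<oplus> [y]) (Suc i) \<le> (\<beta> \<oplus> [y]) i"
      "(\<beta> \<oplus> [z, x, y]) (Suc i) \<le> (\<beta> \<oplus> [z, x, y]) i" for i
    using that assms by (auto split: if_splits)
  then have "dominant (\<beta> \<oplus> [x, y]) \<longleftrightarrow> dominant (\<beta> \<oplus> [z, y])"
    if "dominant \<beta>" "dominant (\<beta> \<oplus> [y])" "dominant (\<beta> \<oplus> [z, x, y])"
    using that unfolding dominant_def by blast
  moreover have "\<beta> \<oplus> [x, z, y] = \<beta> \<oplus> [z, x, y]" by auto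
  ultimately show ?thesis by (auto simp del: count_list.simps)
qed

lemma yam_yxz:
  assumes "x < y" "y \<le> z" shows "yam \<beta> [y, x, z] \<longleftrightarrow> yam \<beta> [y, z, x]"
proof -
  have "(\<beta> \<oplus> [x]) (Suc i) \<le> (\<beta> \<oplus> [x]) i \<longleftrightarrow> (\<beta> \<oplus> [z]) (Suc i) \<le> (\<beta> \<oplus> [z]) i"
    if "\<beta> (Suc i) \<le> \<beta> i" "(\<beta> \<oplus> [x, z]) (Suc i) \<le> (\<beta> \<oplus> [x, z]) i"
      "(\<beta> \<oplus> [y, x, z]) (Suc i) \<le> (\<beta> \<oplus> [y, x, z]) i" for i
    using that assms by (auto split: if_splits)
  then have "dominant (\<beta> \<oplus> [x]) \<longleftrightarrow> dominant (\<beta> \<oplus> [z])"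
    if "dominant \<beta>" "dominant (\<beta> \<oplus> [x, z])" "dominant (\<beta> \<oplus> [y, x, z])"
    using that unfolding dominant_def by blast
  moreover have "\<beta> \<oplus> [y, z, x] = \<beta> \<oplus> [y, x, z]" "\<beta> \<oplus> [z, x] = \<beta> \<oplus> [x, z]" by auto
  ultimately show ?thesis by (auto simp del: count_list.simps)
qed

lemma yam_knuth:
  assumes "u \<approx> v" shows "yam \<beta> u \<longleftrightarrow> yam \<beta> v"
  using assms
proof (induction arbitrary: \<beta> rule: knuth_equiv.induct)
  case (zxy x y z u v)
  have "\<gamma> \<oplus> ([z, x, y] @ v) = \<gamma> \<oplus> ([x, z, y] @ v)" for \<gamma> by auto
  then show ?case using yam_zxy[OF zxy] by (simp only: yam_append)
next
  case (yxz x y z u v)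
  have "\<gamma> \<oplus> ([y, x, z] @ v) = \<gamma> \<oplus> ([y, z, x] @ v)" for \<gamma> by auto
  then show ?case using yam_yxz[OF yxz] by (simp only: yam_append)
qed auto

text \<open>If c denotes the column of the added box, dominance gives c z \<le> c y < c x; for x = y
  the second box of the row lies one column further right. So the image is again a relation of type
  \<open>zxy\<close>, with the roles of x and z exchanged.\<close>

lemma trw_zxy:
  assumes "x \<le> y" "y < z" "yam \<beta> [z, x, y]"
  shows "trw \<beta> [z, x, y] \<approx> trw \<beta> [x, z, y]"
proof -
  have d: "dominant \<beta>" "dominant (\<beta> \<oplus> [y])" "1 \<le> x" "1 \<le> y" using assms(3) by auto
  have "\<beta> z \<le> \<beta> y" using dominant_mono[OF d(1)] d assms by simp
  moreover have "\<beta> y + 1 \<le> \<beta> x + (if x = y then 1 else 0)"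
    using dominant_mono[OF d(2), of x y] d assms by auto
  ultimately have "[\<beta> z + 1, \<beta> x + 1 + (if x = y then 1 else 0), \<beta> y + 1]
      \<approx> [\<beta> x + 1 + (if x = y then 1 else 0), \<beta> z + 1, \<beta> y + 1]"
    by (intro knuth_equiv.sym[OF knuth_zxy]) auto
  then show ?thesis using assms by (simp split: if_splits)
qed

lemma trw_yxz:
  assumes "x < y" "y \<le> z" "yam \<beta> [y, x, z]"
  shows "trw \<beta> [y, x, z] \<approx> trw \<beta> [y, z, x]"
proof -
  have d: "dominant (\<beta> \<oplus> [z])" "1 \<le> x" "1 \<le> y" using assms(3) by auto
  have "\<beta> z + 1 \<le> \<beta> y + (if y = z then 1 else 0)"
    using dominant_mono[OF d(1), of y z] d assms by auto
  moreover have "\<beta> y + (if y = z then 1 else 0) \<le> \<beta> x"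
    using dominant_mono[OF d(1), of x y] d assms by auto
  ultimately show ?thesis using assms
    by (auto intro!: knuth_equiv.sym[OF knuth_yxz])
qed

lemma trw_knuth:
  assumes "u \<approx> v" "yam \<beta> u" shows "trw \<beta> u \<approx> trw \<beta> v"
  using assms
proof (induction arbitrary: \<beta> rule: knuth_equiv.induct)
  case (sym v w)
  then show ?case using yam_knuth knuth_equiv.sym by blast
next
  case (trans u v w)
  then show ?case using yam_knuth knuth_equiv.trans by blast
next
  case (zxy x y z u v)
  have "\<gamma> \<oplus> ([z, x, y] @ v) = \<gamma> \<oplus> ([x, z, y] @ v)" for \<gamma> by auto
  moreover have "trw (\<beta> \<oplus> v) [z, x, y] \<approx> trw (\<beta> \<oplus> v) [x, z, y]"
    using zxy by (intro trw_zxy) (simp_all only: yam_append)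
  ultimately show ?case unfolding trw_append by (simp only:) (rule knuth_append)
next
  case (yxz x y z u v)
  have "\<gamma> \<oplus> ([y, x, z] @ v) = \<gamma> \<oplus> ([y, z, x] @ v)" for \<gamma> by auto
  moreover have "trw (\<beta> \<oplus> v) [y, x, z] \<approx> trw (\<beta> \<oplus> v) [y, z, x]"
    using yxz by (intro trw_yxz) (simp_all only: yam_append)
  ultimately show ?case unfolding trw_append by (simp only:) (rule knuth_append)
qed (auto intro: knuth_equiv.refl)

section \<open>Transposition of Yamanouchi words\<close>

lemma trw_letters:
  "c \<in> set (trw \<beta> w) \<Longrightarrow> \<exists>x \<in> set w. \<beta> x < c \<and> c \<le> \<beta> x + count_list w x"
proof (induction w)
  case (Cons a w)
  then consider "c = \<beta> a + Suc (count_list w a)" | "c \<in> set (trw \<beta> w)" by auto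
  then show ?case
  proof cases
    case 2
    then obtain x where "x \<in> set w" "\<beta> x < c" "c \<le> \<beta> x + count_list w x" using Cons.IH by blast
    then show ?thesis by (intro bexI[of _ x]) auto
  qed auto
qed simp

text \<open>Read from the right, a weakly increasing run adds boxes in weakly descending rows and
  hence in strictly increasing columns. A strictly decreasing run behaves dually and becomes weakly
  increasing.\<close>

lemma trw_sorted:
  assumes "sorted R" "yam \<beta> R" shows "sorted_wrt (>) (trw \<beta> R)"
  using assms
proof (induction R)
  case (Cons a R)
  have "c < \<beta> a + Suc (count_list R a)" if c: "c \<in> set (trw \<beta> R)" for c
  proof -
    obtain x where x: "x \<in> set R" "c \<le> \<beta> x + count_list R x" using trw_letters[OF c] by blast
    have "(\<beta> \<oplus> R) x \<le> (\<beta> \<oplus> R) a"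
      using Cons.prems x yam_dominant(2)[of \<beta> R] dominant_mono[of "\<beta> \<oplus> R" a x] by auto
    then show ?thesis using x by simp
  qed
  then show ?case using Cons by simp
qed simp

lemma trw_decreasing:
  assumes "sorted_wrt (>) C" "yam \<beta> C" shows "sorted (trw \<beta> C)"
  using assms
proof (induction C)
  case (Cons a C)
  have "\<beta> a + Suc (count_list C a) \<le> c" if c: "c \<in> set (trw \<beta> C)" for c
  proof -
    obtain x where x: "x \<in> set C" "\<beta> x < c" using trw_letters[OF c] by blast
    have "\<beta> a \<le> \<beta> x"
      using Cons.prems x yam_dominant(1)[of \<beta> C] yam_letters[of \<beta> C x] dominant_mono[of \<beta> x a] by auto
    moreover have "count_list C a = 0" using Cons.prems by (auto simp: count_list_0_iff)
    ultimately show ?thesis using x by simp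
  qed
  then show ?case using Cons by simp
qed simp

lemma trw_concat:
  assumes "yam \<beta> (concat Rs)"
  shows "\<exists>Rs'. trw \<beta> (concat Rs) = concat Rs' \<and> map length Rs' = map length Rs \<and>
    (\<forall>R' \<in> set Rs'. \<exists>R \<in> set Rs. \<exists>\<gamma>. yam \<gamma> R \<and> R' = trw \<gamma> R)"
  using assms
proof (induction Rs)
  case (Cons R Rs)
  then obtain Rs' where Rs': "trw \<beta> (concat Rs) = concat Rs'" "map length Rs' = map length Rs"
    "\<forall>R' \<in> set Rs'. \<exists>R \<in> set Rs. \<exists>\<gamma>. yam \<gamma> R \<and> R' = trw \<gamma> R"
    by (auto simp: yam_append)
  show ?case
    using Cons.prems Rs'
    by (intro exI[of _ "trw (\<beta> \<oplus> concat Rs) R # Rs'"]) (auto simp: yam_append trw_append)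
qed simp

section \<open>Conjugate partitions and partial sums of their parts\<close>

lemma part_conjugate:
  assumes "sorted_wrt (\<ge>) \<nu>" shows "part (conjugate \<nu>) j = card {i. j < part \<nu> i}"
proof (cases "j < width \<nu>")
  case True
  then show ?thesis by (simp add: conjugate_def part_def)
next
  case False
  then have "\<not> j < part \<nu> i" for i
    using part_antimono[OF assms, of 0 i] by (simp add: width_def)
  then show ?thesis using False by (simp add: conjugate_def part_def)
qed

lemma finite_part: "finite {i. j < part \<nu> i}"
  by (rule finite_subset[of _ "{..<length \<nu>}"]) (auto simp: part_def split: if_splits)

lemma conjugate_pos: "0 \<notin> set (conjugate \<nu>)"
proof
  assume "0 \<in> set (conjugate \<nu>)"
  then obtain j where "j < part \<nu> 0" "card {i. j < part \<nu> i} = 0"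
    by (auto simp: conjugate_def width_def simp del: card_0_eq)
  then show False using finite_part[of j \<nu>] by auto
qed

lemma is_partition_conjugate:
  assumes "sorted_wrt (\<ge>) \<nu>" shows "is_partition (conjugate \<nu>)"
proof -
  have "card {i. k < part \<nu> i} \<le> card {i. j < part \<nu> i}" if "j \<le> k" for j k
    using that by (intro card_mono finite_part) auto
  then have "sorted_wrt (\<ge>) (conjugate \<nu>)"
    by (auto simp: conjugate_def sorted_wrt_map intro!: sorted_wrt_mono_rel[OF _ sorted_wrt_upt])
  then show ?thesis using conjugate_pos[of \<nu>] unfolding is_partition_def by (metis gr0I)
qed

lemma sum_part_conjugate:
  assumes "sorted_wrt (\<ge>) \<nu>"
  shows "(\<Sum>j<k. part (conjugate \<nu>) j) = (\<Sum>x\<leftarrow>\<nu>. min k x)"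
proof -
  have "part (conjugate \<nu>) j = (\<Sum>i<length \<nu>. if j < part \<nu> i then 1 else 0)" for j
  proof -
    have "{..<length \<nu>} \<inter> {i. j < part \<nu> i} = {i. j < part \<nu> i}"
      by (auto simp: part_def split: if_splits)
    then show ?thesis by (simp add: part_conjugate[OF assms] sum.If_cases)
  qed
  then have "(\<Sum>j<k. part (conjugate \<nu>) j) = (\<Sum>j<k. \<Sum>i<length \<nu>. if j < part \<nu> i then 1 else 0)"
    by simp
  also have "\<dots> = (\<Sum>i<length \<nu>. \<Sum>j<k. if j < part \<nu> i then 1 else 0)" by (rule sum.swap)
  also have "\<dots> = (\<Sum>i<length \<nu>. min k (\<nu> ! i))"
  proof (rule sum.cong)
    fix i assume "i \<in> {..<length \<nu>}"
    moreover have "{..<k} \<inter> {j. j < part \<nu> i} = {..<min k (part \<nu> i)}" by auto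
    ultimately show "(\<Sum>j<k. if j < part \<nu> i then 1 else 0) = min k (\<nu> ! i)"
      by (simp add: sum.If_cases part_def)
  qed simp
  also have "\<dots> = (\<Sum>x\<leftarrow>\<nu>. min k x)" by (simp add: sum_list_sum_nth atLeast0LessThan)
  finally show ?thesis .
qed

text \<open>In a row word the weakly increasing runs become strictly decreasing ones, which bounds the
  shape from above; the column word gives the matching lower bound.\<close>

lemma word_shape_trw:
  assumes "yam \<beta> x"
  shows "word_shape (trw \<beta> x) = conjugate (word_shape x)"
proof -
  define T where "T = tableau_of_word x"
  have T: "wtab T" "row_word T \<approx> x" "word_shape x = shape T"
    using tableau_of_word[of x] by (auto simp: T_def word_shape_def tableau_iff)
  have sorted: "sorted_wrt (\<ge>) (shape T)" using wtab_shape T by blast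
  have "part (word_shape (trw \<beta> x)) = part (conjugate (shape T))"
  proof (rule sums_eqD, rule antisym)
    fix k
    have y: "yam \<beta> (concat (rev T))" using assms yam_knuth[OF T(2)] by (simp add: row_word_def)
    obtain Rs where Rs: "trw \<beta> (concat (rev T)) = concat Rs" "map length Rs = map length (rev T)"
      "\<forall>R' \<in> set Rs. \<exists>R \<in> set (rev T). \<exists>\<gamma>. yam \<gamma> R \<and> R' = trw \<gamma> R"
      using trw_concat[OF y] by blast
    have "\<forall>R \<in> set Rs. sorted_wrt (>) R"
      using Rs(3) T(1) trw_sorted unfolding wtab_def by fastforce
    moreover have "concat Rs \<approx> trw \<beta> x"
      using trw_knuth[OF T(2), of \<beta>] y Rs(1) by (simp add: row_word_def)
    ultimately have "(\<Sum>i<k. part (word_shape (trw \<beta> x)) i) \<le> (\<Sum>R\<leftarrow>Rs. min k (length R))"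
      by (intro word_shape_lower)
    also have "\<dots> = (\<Sum>c\<leftarrow>map length Rs. min k c)" by (simp add: o_def)
    also have "\<dots> = (\<Sum>c\<leftarrow>rev (shape T). min k c)" unfolding Rs(2) by (simp add: rev_map shape_def)
    also have "\<dots> = (\<Sum>c\<leftarrow>shape T. min k c)" by (metis rev_map sum_list_rev)
    also have "\<dots> = (\<Sum>i<k. part (conjugate (shape T)) i)"
      using sum_part_conjugate[OF sorted] by simp
    finally show "(\<Sum>i<k. part (word_shape (trw \<beta> x)) i) \<le> (\<Sum>i<k. part (conjugate (shape T)) i)" .
  next
    fix k
    obtain Cs where Cs: "concat Cs \<approx> row_word T" "\<forall>C \<in> set Cs. sorted_wrt (>) C"
      "map length Cs = conjugate (shape T)"
      using column_word_exists[OF T(1)] by blast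
    have Cx: "concat Cs \<approx> x" using knuth_equiv.trans[OF Cs(1) T(2)] .
    then have y: "yam \<beta> (concat Cs)" using assms yam_knuth by blast
    obtain Rs where Rs: "trw \<beta> (concat Cs) = concat Rs" "map length Rs = map length Cs"
      "\<forall>R' \<in> set Rs. \<exists>R \<in> set Cs. \<exists>\<gamma>. yam \<gamma> R \<and> R' = trw \<gamma> R"
      using trw_concat[OF y] by blast
    have "\<forall>R \<in> set Rs. sorted R"
      using Rs(3) Cs(2) trw_decreasing by fastforce
    then have "\<forall>R \<in> set (take k Rs). sorted R" by (meson in_set_takeD)
    moreover have "subseq (concat (take k Rs)) (concat Rs)"
      by (metis append_take_drop_id concat_append prefixI prefix_imp_subseq)
    ultimately have "sum_list (map length (take k Rs)) \<le> (\<Sum>i<k. part (word_shape (concat Rs)) i)"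
      by (intro word_shape_upper) auto
    also have "word_shape (concat Rs) = word_shape (trw \<beta> x)"
      using trw_knuth[OF Cx y] Rs(1) word_shape_cong by metis
    also have "sum_list (map length (take k Rs)) = (\<Sum>i<k. part (conjugate (shape T)) i)"
      using Rs(2) Cs(3) by (simp add: sum_part flip: take_map)
    finally show "(\<Sum>i<k. part (conjugate (shape T)) i) \<le> (\<Sum>i<k. part (word_shape (trw \<beta> x)) i)" .
  qed
  then show ?thesis
    using T(3) is_partition_word_shape[of "trw \<beta> x"] conjugate_pos
    by (intro partition_eqI) (auto simp: is_partition_def)
qed

text \<open>The conjugate of a partition given as a function with parts numbered from 1. At 0 the
  counted set is infinite, so \<open>card\<close> yields the harmless value 0.\<close>

definition conjf :: "(nat \<Rightarrow> nat) \<Rightarrow> nat \<Rightarrow> nat" where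
  "conjf \<beta> j = card {i. 1 \<le> i \<and> j \<le> \<beta> i}"

definition fin_supp :: "(nat \<Rightarrow> nat) \<Rightarrow> bool" where
  "fin_supp \<beta> \<longleftrightarrow> finite {i. 0 < \<beta> i}"

lemma fin_supp_add: "fin_supp \<beta> \<Longrightarrow> fin_supp (\<beta> \<oplus> w)"
proof -
  assume "fin_supp \<beta>"
  moreover have "{i. 0 < (\<beta> \<oplus> w) i} \<subseteq> {i. 0 < \<beta> i} \<union> set w"
    using count_list_0_iff by fastforce
  ultimately show ?thesis unfolding fin_supp_def by (meson finite_Un finite_set finite_subset)
qed

lemma finite_conjf: "fin_supp \<beta> \<Longrightarrow> 1 \<le> j \<Longrightarrow> finite {i. 1 \<le> i \<and> j \<le> \<beta> i}"
  unfolding fin_supp_def by (rule finite_subset[of _ "{i. 0 < \<beta> i}"]) auto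

lemma conjf_0: "conjf \<beta> 0 = 0"
proof -
  have "{i::nat. 1 \<le> i \<and> 0 \<le> \<beta> i} = {1..}" by auto
  then show ?thesis by (simp add: conjf_def infinite_Ici)
qed

lemma conjf_Cons:
  assumes "fin_supp \<beta>" "1 \<le> a"
  shows "conjf (\<beta> \<oplus> [a]) = conjf \<beta> \<oplus> [\<beta> a + 1]"
proof
  fix j show "conjf (\<beta> \<oplus> [a]) j = (conjf \<beta> \<oplus> [\<beta> a + 1]) j"
  proof (cases "j = 0")
    case True
    then show ?thesis using conjf_0[of "\<beta> \<oplus> [a]"] conjf_0[of \<beta>] by simp
  next
    case False
    have "{i. 1 \<le> i \<and> j \<le> (\<beta> \<oplus> [a]) i} =
        (if j = \<beta> a + 1 then insert a {i. 1 \<le> i \<and> j \<le> \<beta> i} else {i. 1 \<le> i \<and> j \<le> \<beta> i})"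
      using assms(2) by auto
    then show ?thesis using finite_conjf[OF assms(1), of j] False by (auto simp: conjf_def)
  qed
qed

lemma conjf_add:
  assumes "fin_supp \<beta>" "\<forall>a \<in> set w. 1 \<le> a"
  shows "conjf (\<beta> \<oplus> w) = conjf \<beta> \<oplus> trw \<beta> w"
  using assms
proof (induction w)
  case (Cons a w)
  have "conjf (\<beta> \<oplus> (a # w)) = conjf ((\<beta> \<oplus> w) \<oplus> [a])" by (rule arg_cong[of _ _ conjf]) auto
  also have "\<dots> = conjf (\<beta> \<oplus> w) \<oplus> [(\<beta> \<oplus> w) a + 1]"
    by (rule conjf_Cons) (use Cons.prems fin_supp_add in auto)
  also have "\<dots> = conjf \<beta> \<oplus> trw \<beta> (a # w)"
    using Cons by (auto simp: fun_eq_iff)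
  finally show ?case .
qed simp

lemma dominant_conjf:
  assumes "fin_supp \<beta>" shows "dominant (conjf \<beta>)"
  unfolding dominant_def conjf_def
proof (intro allI impI card_mono)
  fix i :: nat assume "1 \<le> i"
  then show "finite {ia. 1 \<le> ia \<and> i \<le> \<beta> ia}" using assms by (rule finite_conjf[rotated])
qed auto

lemma yam_trw:
  assumes "fin_supp \<beta>" "\<forall>a \<in> set w. 1 \<le> a"
  shows "yam (conjf \<beta>) (trw \<beta> w)"
  using assms
proof (induction w)
  case Nil
  then show ?case by (simp add: dominant_conjf)
next
  case (Cons a w)
  have "dominant (conjf \<beta> \<oplus> trw \<beta> (a # w))"
    unfolding conjf_add[OF Cons.prems, symmetric] by (intro dominant_conjf fin_supp_add Cons.prems)
  then show ?case using Cons by simp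
qed

lemma trw_trw:
  assumes "fin_supp \<beta>" "yam \<beta> w" shows "trw (conjf \<beta>) (trw \<beta> w) = w"
  using assms
proof (induction w)
  case (Cons a w)
  let ?g = "\<beta> \<oplus> w"
  have "?g \<oplus> [a] = \<beta> \<oplus> (a # w)" by auto
  then have g: "dominant ?g" "dominant (?g \<oplus> [a])" "1 \<le> a"
    using Cons.prems yam_dominant(2)[of \<beta> w] by (simp_all del: count_list.simps)
  let ?c = "\<beta> a + Suc (count_list w a)"
  \<comment> \<open>The new box in row a and column \<open>?c\<close> is a corner, so exactly the
    rows below a reach this column already. In the conjugate partition the box therefore lies in
    column (a - 1) + 1 = a.\<close>
  have "{i. 1 \<le> i \<and> ?c \<le> ?g i} = {1..<a}"
  proof (intro set_eqI iffI)
    fix i assume i: "i \<in> {i. 1 \<le> i \<and> ?c \<le> ?g i}"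
    have "i < a"
    proof (rule ccontr)
      assume "\<not> i < a"
      then have "?g i \<le> ?g a" using dominant_mono[OF g(1), of a i] g(3) by simp
      then show False using i by simp
    qed
    then show "i \<in> {1..<a}" using i by simp
  next
    fix i assume i: "i \<in> {1..<a}"
    then have "(?g \<oplus> [a]) a \<le> (?g \<oplus> [a]) i" using dominant_mono[OF g(2), of i a] by simp
    then show "i \<in> {i. 1 \<le> i \<and> ?c \<le> ?g i}" using i by simp
  qed
  then have "conjf ?g ?c = a - 1" by (simp add: conjf_def)
  moreover have "conjf ?g = conjf \<beta> \<oplus> trw \<beta> w"
    using Cons.prems yam_letters by (intro conjf_add) auto
  ultimately have "conjf \<beta> ?c + count_list (trw \<beta> w) ?c = a - 1" by metis
  then show ?case using Cons g(3) by simp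
qed simp

section \<open>Yamanouchi tableaux\<close>

text \<open>Column strictness bounds the entries of the row with index k from below by
  \<open>Suc k\<close>. Conversely, the last entry b of the row is read directly after the lower
  rows, so b > 1 requires a letter b - 1 among them, which bounds b from above.\<close>

lemma yam_tableau_rows:
  assumes "wtab T" "yam0 (row_word T)" "k < length T" "a \<in> set (T ! k)"
  shows "a = Suc k"
  using assms
proof (induction T arbitrary: k a rule: rev_induct)
  case (snoc r T)
  have yT: "yam0 (row_word T)" and yr: "yam ((\<lambda>_. 0) \<oplus> row_word T) r"
    using snoc.prems(2) by (simp_all add: yam_append)
  have rows: "b = Suc l" if "l < length T" "b \<in> set (T ! l)" for l b
    using snoc.IH[OF _ yT] snoc.prems that by (auto simp: wtab_append)
  show ?case
  proof (cases "k < length T")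
    case True
    then show ?thesis using rows snoc.prems by (simp add: nth_append)
  next
    case False
    then have k: "k = length T" using snoc.prems by simp
    then have a: "a \<in> set r" using snoc.prems by simp
    then obtain s b where r: "r = s @ [b]" by (cases r rule: rev_exhaust) auto
    have le: "a \<le> b" using snoc.prems(1) a r by (auto simp: wtab_append sorted_append)
    have "b \<le> Suc k"
    proof (rule ccontr)
      assume b: "\<not> b \<le> Suc k"
      have "yam0 (s @ b # row_word T)" using snoc.prems(2) r by simp
      then have "yam0 (b # row_word T)" by (simp only: yam_append)
      then have "dominant ((\<lambda>_. 0) \<oplus> (b # row_word T))"
        using yam_dominant(2)[of "\<lambda>_. 0" "b # row_word T"] by blast
      then have "((\<lambda>_. 0) \<oplus> (b # row_word T)) b \<le> ((\<lambda>_. 0) \<oplus> (b # row_word T)) (b - 1)"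
        using b dominant_mono[of "(\<lambda>_. 0) \<oplus> (b # row_word T)" "b - 1" b] by simp
      then have "b - 1 \<in> set (row_word T)" using b by (cases "b = b - 1") (auto intro: ccontr)
      then obtain l where "l < length T" "b - 1 \<in> set (T ! l)"
        by (auto simp: row_word_def) (metis in_set_conv_nth)
      then show False using rows[of l "b - 1"] b k by simp
    qed
    moreover have "Suc k \<le> a"
    proof (cases T rule: rev_exhaust)
      case Nil
      then show ?thesis using yam_letters[OF yr a] k by simp
    next
      case (snoc T' r')
      obtain c where c: "c < length r" "a = r ! c" using a by (auto simp: in_set_conv_nth)
      have "above r' r" using snoc.prems(1) snoc by (auto simp: wtab_append)
      then have "r' ! c < a" "r' ! c \<in> set r'" using c by (auto simp: above_def)
      moreover have "T ! length T' = r'" "k = Suc (length T')" using snoc k by simp_all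
      ultimately show ?thesis using rows[of "length T'" "r' ! c"] snoc by simp
    qed
    ultimately show ?thesis using le by simp
  qed
qed simp

lemma count_list_const: "\<forall>a \<in> set r. a = b \<Longrightarrow> count_list r c = (if c = b then length r else 0)"
  by (induction r) auto

lemma yam_tableau_count:
  assumes "wtab T" "yam0 (row_word T)"
  shows "count_list (row_word T) (Suc k) = part (shape T) k"
proof -
  have "count_list (row_word T) (Suc k) = part (shape T) k"
    if "\<forall>k < length T. \<forall>a \<in> set (T ! k). a = Suc k" for k
    using that
  proof (induction T rule: rev_induct)
    case (snoc r T)
    have "\<forall>k < length T. \<forall>a \<in> set (T ! k). a = Suc k"
    proof (intro allI impI)
      fix k assume "k < length T"
      then show "\<forall>a \<in> set (T ! k). a = Suc k" using snoc.prems[rule_format, of k] by (auto simp: nth_append)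
    qed
    moreover have "\<forall>a \<in> set r. a = Suc (length T)" using snoc.prems[rule_format, of "length T"] by auto
    ultimately show ?case using snoc.IH
      by (auto simp: count_list_const part_def shape_def nth_append less_Suc_eq)
  qed simp
  then show ?thesis using yam_tableau_rows[OF assms] by blast
qed

lemma yam_word_shape:
  assumes "yam0 w" shows "part (word_shape w) k = count_list w (Suc k)"
proof -
  define T where "T = tableau_of_word w"
  have T: "wtab T" "row_word T \<approx> w" using tableau_of_word[of w] by (auto simp: T_def tableau_iff)
  then have "count_list (row_word T) (Suc k) = part (shape T) k"
    using yam_tableau_count[OF T(1)] yam_knuth[OF T(2)] assms by blast
  then show ?thesis using knuth_count[OF T(2)] by (simp add: word_shape_def T_def)
qed

text \<open>The tableau of a Yamanouchi word has constant rows, each filled with its own number, and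
  so depends only on the content.\<close>

lemma yam_knuth_unique:
  assumes "yam0 w" "yam0 w'" "\<And>k. count_list w (Suc k) = count_list w' (Suc k)"
  shows "w \<approx> w'"
proof -
  define T T' where "T = tableau_of_word w" and "T' = tableau_of_word w'"
  have T: "tableau T" "row_word T \<approx> w" "wtab T" "word_shape w = shape T"
    and T': "tableau T'" "row_word T' \<approx> w'" "wtab T'" "word_shape w' = shape T'"
    using tableau_of_word[of w] tableau_of_word[of w']
    by (auto simp: T_def T'_def tableau_iff word_shape_def)
  have y: "yam0 (row_word T)" "yam0 (row_word T')"
    using assms yam_knuth T T' by blast+
  have "part (word_shape w) = part (word_shape w')"
    using yam_word_shape assms by (simp add: fun_eq_iff)
  then have sh: "shape T = shape T'"
    using T T' partition_eqI is_partition_word_shape unfolding is_partition_def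
    by (metis less_numeral_extra(3))
  then have len: "length T = length T'" unfolding shape_def by (metis length_map)
  have "T = T'"
  proof (rule nth_equalityI[OF len])
    fix k assume k: "k < length T"
    have "T ! k = replicate (length (T ! k)) (Suc k)"
      using yam_tableau_rows[OF T(3) y(1) k] by (metis replicate_length_same)
    moreover have "T' ! k = replicate (length (T' ! k)) (Suc k)"
      using yam_tableau_rows[OF T'(3) y(2)] k len by (metis replicate_length_same)
    moreover have "length (T ! k) = length (T' ! k)"
      using sh k len unfolding shape_def by (metis nth_map)
    ultimately show "T ! k = T' ! k" by metis
  qed
  then show ?thesis using T(2) T'(2) knuth_equiv.sym knuth_equiv.trans by metis
qed

section \<open>Dominance by weakly increasing runs\<close>

lemma word_shape_eqI:
  assumes "\<And>k. (\<Sum>i<k. part (word_shape u) i) = (\<Sum>i<k. part (word_shape v) i)"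
  shows "word_shape u = word_shape v"
  using sums_eqD[OF assms] is_partition_word_shape[of u] is_partition_word_shape[of v]
  by (intro partition_eqI) (auto simp: is_partition_def)

text \<open>The tool for comparing shapes: an operation that turns the rows of a tableau T into
  weakly increasing runs produces a word whose shape dominates that of T. Both orders of the rows
  occur, as an operation may or may not reverse the word; the k longest runs are then a prefix or a
  suffix.\<close>

lemma word_shape_dominates:
  assumes "\<forall>R \<in> set Rs. sorted R"
    and "map length Rs = shape T \<or> map length Rs = rev (shape T)" "concat Rs \<approx> w"
  shows "(\<Sum>i<k. part (shape T) i) \<le> (\<Sum>i<k. part (word_shape w) i)"
proof -
  obtain Qs where Qs: "set Qs \<subseteq> set Rs" "subseq (concat Qs) (concat Rs)" "length Qs \<le> k"
    "sum_list (map length Qs) = (\<Sum>i<k. part (shape T) i)"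
    using assms(2)
  proof
    assume len: "map length Rs = shape T"
    show thesis
    proof (rule that[of "take k Rs"])
      show "subseq (concat (take k Rs)) (concat Rs)"
        by (metis append_take_drop_id concat_append prefixI prefix_imp_subseq)
      show "sum_list (map length (take k Rs)) = (\<Sum>i<k. part (shape T) i)"
        using len by (simp add: sum_part flip: take_map)
    qed (auto dest: in_set_takeD)
  next
    assume len: "map length Rs = rev (shape T)"
    show thesis
    proof (rule that[of "rev (take k (rev Rs))"])
      have "Rs = rev (drop k (rev Rs)) @ rev (take k (rev Rs))"
        by (metis append_take_drop_id rev_append rev_rev_ident)
      then show "subseq (concat (rev (take k (rev Rs)))) (concat Rs)"
        by (metis concat_append suffixI suffix_imp_subseq)
      have "map length (rev Rs) = shape T" using len by (simp flip: rev_map)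
      then show "sum_list (map length (rev (take k (rev Rs)))) = (\<Sum>i<k. part (shape T) i)"
        by (simp add: sum_part flip: take_map rev_map)
    qed (auto dest: in_set_takeD)
  qed
  have "sum_list (map length Qs) \<le> (\<Sum>i<k. part (word_shape (concat Rs)) i)"
    using Qs assms(1) by (intro word_shape_upper) auto
  then show ?thesis using Qs(4) word_shape_cong[OF assms(3)] by simp
qed

section \<open>Reversal with complementation\<close>

text \<open>The operation on words behind Schuetzenberger's evacuation. The subtraction truncates,
  so it is applied to words with letters at most N.\<close>

definition rc :: "nat \<Rightarrow> nat list \<Rightarrow> nat list" where
  "rc N w = rev (map (\<lambda>a. N - a) w)"

lemma rc_simps: "rc N [] = []" "rc N (u @ v) = rc N v @ rc N u" "length (rc N w) = length w"
  by (simp_all add: rc_def)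

lemma rc_rc: "set w \<subseteq> {..N} \<Longrightarrow> rc N (rc N w) = w"
  by (auto simp: rc_def rev_map o_def intro!: map_idI)

lemma set_rc: "set (rc N w) = (\<lambda>a. N - a) ` set w"
  by (simp add: rc_def)

lemma rc_knuth: "u \<approx> v \<Longrightarrow> set u \<subseteq> {..N} \<Longrightarrow> rc N u \<approx> rc N v"
  unfolding rc_def by (rule knuth_rev_map) (auto intro!: diff_less_mono2)

lemma rc_concat: "rc N (concat Rs) = concat (map (rc N) (rev Rs))"
  by (induction Rs) (auto simp: rc_simps)

lemma sorted_rc: "sorted R \<Longrightarrow> sorted (rc N R)"
  unfolding rc_def by (auto simp: sorted_wrt_rev sorted_wrt_map elim!: sorted_wrt_mono_rel[rotated])

text \<open>The rows of the tableau stay weakly increasing runs and merely change their order. As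
  \<open>rc\<close> is an involution, the inequality also holds in the opposite direction.\<close>

lemma word_shape_rc_ge:
  assumes "set w \<subseteq> {..N}"
  shows "(\<Sum>i<k. part (word_shape w) i) \<le> (\<Sum>i<k. part (word_shape (rc N w)) i)"
proof -
  define T where "T = tableau_of_word w"
  have T: "wtab T" "row_word T \<approx> w" "word_shape w = shape T"
    using tableau_of_word[of w] by (auto simp: T_def tableau_iff word_shape_def)
  have "rc N (row_word T) \<approx> rc N w" using rc_knuth[OF T(2), of N] knuth_set[OF T(2)] assms by simp
  moreover have "rc N (row_word T) = concat (map (rc N) T)"
    by (simp add: row_word_def rc_concat)
  ultimately have "concat (map (rc N) T) \<approx> rc N w" by simp
  then show ?thesis unfolding T(3)
    by (rule word_shape_dominates[rotated 2])
      (use T(1) in \<open>auto simp: wtab_def sorted_rc shape_def rc_simps\<close>)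
qed

lemma word_shape_rc:
  assumes "set w \<subseteq> {..N}" shows "word_shape (rc N w) = word_shape w"
proof (rule word_shape_eqI, rule antisym)
  fix k
  have "set (rc N w) \<subseteq> {..N}" by (auto simp: set_rc)
  from word_shape_rc_ge[OF this, of k]
  show "(\<Sum>i<k. part (word_shape (rc N w)) i) \<le> (\<Sum>i<k. part (word_shape w) i)"
    using rc_rc[OF assms] by simp
qed (rule word_shape_rc_ge[OF assms])

section \<open>Crystal operators\<close>

text \<open>A letter \<open>i + 1\<close> is bracketed with a letter \<open>i\<close> to its right; \<open>phi\<close> and \<open>eps\<close> count the
  unbracketed letters \<open>i\<close> and \<open>i + 1\<close>. Then \<open>raise\<close> turns the leftmost unbracketed \<open>i + 1\<close> into \<open>i\<close> and
  \<open>lower\<close> turns the rightmost unbracketed \<open>i\<close> into \<open>i + 1\<close>.\<close>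

primrec phi :: "nat \<Rightarrow> nat list \<Rightarrow> nat" where
  "phi i [] = 0"
| "phi i (a # w) = (if a = i then Suc (phi i w) else if a = Suc i then phi i w - 1 else phi i w)"

primrec eps :: "nat \<Rightarrow> nat list \<Rightarrow> nat" where
  "eps i [] = 0"
| "eps i (a # w) = eps i w + (if a = Suc i \<and> phi i w = 0 then 1 else 0)"

primrec raise :: "nat \<Rightarrow> nat list \<Rightarrow> nat list" where
  "raise i [] = []"
| "raise i (a # w) = (if a = Suc i \<and> phi i w = 0 then i # w else a # raise i w)"

primrec lower :: "nat \<Rightarrow> nat list \<Rightarrow> nat list" where
  "lower i [] = []"
| "lower i (a # w) = (if phi i w > (if a = Suc i then 1 else 0) then a # lower i w
     else if a = i then Suc i # w else a # w)"

text \<open>The tensor product rule: the unbracketed letters i + 1 of u are bracketed with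
  unbracketed letters i of v, and the truncated difference is what v has left over.\<close>

lemma phi_append: "phi i (u @ v) = phi i u + (phi i v - eps i u)"
  by (induction u) auto

lemma eps_append: "eps i (u @ v) = eps i v + (eps i u - phi i v)"
  by (induction u) (auto simp: phi_append)

lemma raise_append: "raise i (u @ v) = (if eps i u > phi i v then raise i u @ v else u @ raise i v)"
  by (induction u) (auto simp: phi_append)

lemma lower_id: "phi i w = 0 \<Longrightarrow> lower i w = w"
  by (induction w) (auto split: if_splits)

lemma lower_append: "lower i (u @ v) = (if phi i v > eps i u then u @ lower i v else lower i u @ v)"
  by (induction u) (auto simp: phi_append lower_id)

lemma length_raise [simp]: "length (raise i w) = length w"
  by (induction w) auto

lemma length_lower [simp]: "length (lower i w) = length w"
  by (induction w) auto

lemma raise_id: "eps i w = 0 \<Longrightarrow> raise i w = w"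
  by (induction w) (auto split: if_splits)

lemma phi_raise: "eps i w > 0 \<Longrightarrow> phi i (raise i w) = Suc (phi i w)"
  by (induction w) (auto split: if_splits)

lemma lower_raise: "eps i w > 0 \<Longrightarrow> lower i (raise i w) = w"
  by (induction w) (auto simp: phi_raise split: if_splits)

lemma sum_list_raise: "eps i w > 0 \<Longrightarrow> sum_list (raise i w) < sum_list w"
  by (induction w) (auto split: if_splits)

lemma set_raise: "set (raise i w) \<subseteq> insert i (set w)"
  by (induction w) auto

lemma set_lower: "set (lower i w) \<subseteq> insert (Suc i) (set w)"
  by (induction w) auto

lemma eps_pos: "eps i w > 0 \<Longrightarrow> Suc i \<in> set w"
  by (induction w) (auto split: if_splits)

lemma phi_eps_count: "phi i w + count_list w (Suc i) = eps i w + count_list w i"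
  by (induction w) auto

text \<open>The delicate case is x = y = i and z = i + 1, where \<open>lower\<close> yields
  [i + 1, i, i + 1] and [i + 1, i + 1, i]; these are related by the other Knuth relation. For
  \<open>yxz\<close> the same happens to \<open>raise\<close> when x = i and y = z = i + 1.\<close>

lemma crystal_zxy:
  assumes "x \<le> y" "y < z"
  shows "phi i [z, x, y] = phi i [x, z, y]" "eps i [z, x, y] = eps i [x, z, y]"
    "raise i [z, x, y] \<approx> raise i [x, z, y]" "lower i [z, x, y] \<approx> lower i [x, z, y]"
  using assms knuth_yxz[of i "Suc i" "Suc i"] by (auto intro!: knuth_zxy knuth_equiv.refl)

lemma crystal_yxz:
  assumes "x < y" "y \<le> z"
  shows "phi i [y, x, z] = phi i [y, z, x]" "eps i [y, x, z] = eps i [y, z, x]"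
    "raise i [y, x, z] \<approx> raise i [y, z, x]" "lower i [y, x, z] \<approx> lower i [y, z, x]"
  using assms knuth_zxy[of i i "Suc i"] by (auto simp: le_Suc_eq intro!: knuth_yxz knuth_equiv.refl)

lemma crystal_context:
  assumes "s \<approx> t" "phi i s = phi i t" "eps i s = eps i t" "raise i s \<approx> raise i t" "lower i s \<approx> lower i t"
  shows "phi i (u @ s @ v) = phi i (u @ t @ v)" "eps i (u @ s @ v) = eps i (u @ t @ v)"
    "raise i (u @ s @ v) \<approx> raise i (u @ t @ v)" "lower i (u @ s @ v) \<approx> lower i (u @ t @ v)"
  using assms by (auto simp: phi_append eps_append raise_append lower_append intro!: knuth_cong knuth_equiv.refl)

lemma crystal_knuth:
  assumes "u \<approx> v"
  shows "phi i u = phi i v \<and> eps i u = eps i v \<and> raise i u \<approx> raise i v \<and> lower i u \<approx> lower i v"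
  using assms
proof (induction rule: knuth_equiv.induct)
  case (zxy x y z u v)
  show ?case using crystal_context[OF knuth_zxy[OF zxy] crystal_zxy[OF zxy]] by blast
next
  case (yxz x y z u v)
  show ?case using crystal_context[OF knuth_yxz[OF yxz] crystal_yxz[OF yxz]] by blast
qed (auto intro: knuth_equiv.refl knuth_equiv.sym knuth_equiv.trans)

text \<open>In a weakly increasing word nothing is bracketed, so \<open>raise\<close> changes the
  first letter i + 1, which stands directly behind the letters at most i. Likewise
  \<open>lower\<close> changes the last letter i.\<close>

lemma sorted_raise: "sorted w \<Longrightarrow> sorted (raise i w)"
proof (induction w)
  case (Cons a w)
  show ?case
  proof (cases "a = Suc i")
    case True
    then have "phi i w = 0" using Cons.prems by (induction w) auto
    then show ?thesis using True Cons.prems by auto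
  next
    case False
    have "a \<le> b" if "b \<in> set (raise i w)" for b
    proof (cases "eps i w = 0")
      case True
      then show ?thesis using that Cons.prems by (simp add: raise_id)
    next
      case False
      then have "a \<le> Suc i" using eps_pos[of i w] Cons.prems by simp
      then show ?thesis using that set_raise[of i w] Cons.prems \<open>a \<noteq> Suc i\<close> by auto
    qed
    then show ?thesis using False Cons by simp
  qed
qed simp

lemma sorted_phi_pos: "sorted w \<Longrightarrow> i \<in> set w \<Longrightarrow> phi i w > 0"
  by (induction w) auto

lemma sorted_lower: "sorted w \<Longrightarrow> sorted (lower i w)"
proof (induction w)
  case (Cons a w)
  have ge: "a \<le> b" if "b \<in> set w" for b using Cons.prems that by simp
  have *: "a \<le> b" if "phi i w > 0" "b \<in> set (lower i w)" for b
  proof -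
    have "i \<in> set w" using that(1) by (induction w) (auto split: if_splits)
    then show ?thesis using that(2) set_lower[of i w] ge by fastforce
  qed
  have "Suc i \<le> b" if "phi i w = 0" "a = i" "b \<in> set w" for b
    using that ge[of b] sorted_phi_pos[of w i] Cons.prems by (cases "b = i") auto
  then show ?case using * Cons by auto
qed simp

lemma raise_concat:
  assumes "\<forall>R \<in> set Rs. sorted R"
  shows "\<exists>Rs'. raise i (concat Rs) = concat Rs' \<and> map length Rs' = map length Rs \<and> (\<forall>R \<in> set Rs'. sorted R)"
  using assms
proof (induction Rs)
  case (Cons R Rs)
  then obtain Rs' where Rs': "raise i (concat Rs) = concat Rs'" "map length Rs' = map length Rs"
    "\<forall>R \<in> set Rs'. sorted R" by auto
  show ?case
  proof (cases "eps i R > phi i (concat Rs)")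
    case True
    then show ?thesis using Cons.prems
      by (intro exI[of _ "raise i R # Rs"]) (auto simp: raise_append sorted_raise)
  next
    case False
    then show ?thesis using Cons.prems Rs'
      by (intro exI[of _ "R # Rs'"]) (auto simp: raise_append)
  qed
qed simp

lemma lower_concat:
  assumes "\<forall>R \<in> set Rs. sorted R"
  shows "\<exists>Rs'. lower i (concat Rs) = concat Rs' \<and> map length Rs' = map length Rs \<and> (\<forall>R \<in> set Rs'. sorted R)"
  using assms
proof (induction Rs)
  case (Cons R Rs)
  then obtain Rs' where Rs': "lower i (concat Rs) = concat Rs'" "map length Rs' = map length Rs"
    "\<forall>R \<in> set Rs'. sorted R" by auto
  show ?case
  proof (cases "phi i (concat Rs) > eps i R")
    case False
    then show ?thesis using Cons.prems
      by (intro exI[of _ "lower i R # Rs"]) (auto simp: lower_append sorted_lower)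
  next
    case True
    then show ?thesis using Cons.prems Rs'
      by (intro exI[of _ "R # Rs'"]) (auto simp: lower_append)
  qed
qed simp

text \<open>Both operators preserve weakly increasing runs, so neither can decrease the shape in dominance
  order; as they are mutually inverse, the shape is invariant.\<close>

lemma word_shape_raise: "word_shape (raise i w) = word_shape w"
proof (cases "eps i w = 0")
  case False
  define T T' where "T = tableau_of_word w" and "T' = tableau_of_word (raise i w)"
  have T: "wtab T" "row_word T \<approx> w" "word_shape w = shape T"
    and T': "wtab T'" "row_word T' \<approx> raise i w" "word_shape (raise i w) = shape T'"
    using tableau_of_word[of w] tableau_of_word[of "raise i w"]
    by (auto simp: T_def T'_def tableau_iff word_shape_def)
  show ?thesis
  proof (rule word_shape_eqI, rule antisym)
    fix k
    obtain Rs where "raise i (row_word T) = concat Rs" "map length Rs = map length (rev T)"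
      "\<forall>R \<in> set Rs. sorted R"
      using raise_concat[of "rev T" i] T(1) by (auto simp: row_word_def wtab_def)
    moreover have "raise i (row_word T) \<approx> raise i w" using crystal_knuth[OF T(2)] by blast
    ultimately show "(\<Sum>i<k. part (word_shape w) i) \<le> (\<Sum>j<k. part (word_shape (raise i w)) j)"
      unfolding T(3) by (intro word_shape_dominates[of Rs]) (auto simp: shape_def rev_map)
  next
    fix k
    obtain Rs where "lower i (row_word T') = concat Rs" "map length Rs = map length (rev T')"
      "\<forall>R \<in> set Rs. sorted R"
      using lower_concat[of "rev T'" i] T'(1) by (auto simp: row_word_def wtab_def)
    moreover have "lower i (row_word T') \<approx> w"
      using crystal_knuth[OF T'(2), of i] lower_raise[of i w] False by simp
    ultimately show "(\<Sum>j<k. part (word_shape (raise i w)) j) \<le> (\<Sum>i<k. part (word_shape w) i)"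
      unfolding T'(3) by (intro word_shape_dominates[of Rs]) (auto simp: shape_def rev_map)
  qed
qed (simp add: raise_id)

lemma yam_iff_eps:
  assumes "\<forall>a \<in> set w. 1 \<le> a" "\<forall>i\<ge>1. eps i w = 0"
  shows "yam0 w"
  using assms
proof (induction w)
  case Nil
  then show ?case by (simp add: dominant_def)
next
  case (Cons a w)
  have "count_list (a # w) (Suc i) \<le> count_list (a # w) i" if "1 \<le> i" for i
    using phi_eps_count[of i "a # w"] Cons.prems(2) that by (metis add_0 le_add2 add.commute)
  then show ?case using Cons by (auto simp: dominant_def)
qed

text \<open>Raising decreases the sum of the letters, so it leads from any word to a highest weight
  word, one on which all \<open>eps\<close> vanish; these words are Yamanouchi.\<close>

lemma crystal_induct [consumes 1, case_names yam raise]: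
  assumes "set w \<subseteq> {1..n}"
    and "\<And>w. set w \<subseteq> {1..n} \<Longrightarrow> yam0 w \<Longrightarrow> P w"
    and "\<And>i w. set w \<subseteq> {1..n} \<Longrightarrow> 1 \<le> i \<Longrightarrow> Suc i \<le> n \<Longrightarrow> eps i w > 0 \<Longrightarrow>
      set (raise i w) \<subseteq> {1..n} \<Longrightarrow> P (raise i w) \<Longrightarrow> P w"
  shows "P w"
  using assms(1)
proof (induction "sum_list w" arbitrary: w rule: less_induct)
  case less
  show ?case
  proof (cases "\<forall>i\<ge>1. eps i w = 0")
    case True
    moreover have "\<forall>a \<in> set w. 1 \<le> a" using less.prems by auto
    ultimately show ?thesis using less.prems yam_iff_eps assms(2) by blast
  next
    case False
    then obtain i where i: "1 \<le> i" "eps i w > 0" by auto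
    have "Suc i \<le> n" using eps_pos[OF i(2)] less.prems by auto
    moreover have "set (raise i w) \<subseteq> {1..n}"
      using set_raise[of i w] less.prems i calculation by auto
    ultimately show ?thesis using assms(3) less i sum_list_raise by blast
  qed
qed

section \<open>Factorizations of a tableau\<close>

lemma lower_shift: "phi i w > 0 \<Longrightarrow> phi i (lower i w) = phi i w - 1"
  by (induction w) (auto split: if_splits)

lemma raise_lower: "phi i w > 0 \<Longrightarrow> raise i (lower i w) = w"
  by (induction w) (auto simp: lower_shift split: if_splits)

lemma word_shape_lowered: "word_shape (lower i w) = word_shape w"
proof (cases "phi i w = 0")
  case False
  then show ?thesis using word_shape_raise[of i "lower i w"] raise_lower[of i w] by simp
qed (simp add: lower_id)

lemma tableauxD:
  assumes "T \<in> tableaux n \<nu>"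
  shows "tableau T" "wtab T" "shape T = \<nu>" "set (row_word T) \<subseteq> {1..n}" "word_shape (row_word T) = \<nu>"
  using assms word_shape_row_word by (auto simp: tableaux_def tableau_iff)

lemma tableau_of_word_in_tableaux:
  assumes "set w \<subseteq> {1..n}" shows "tableau_of_word w \<in> tableaux n (word_shape w)"
  using assms tableau_tableau_of_word[of w] knuth_set[OF row_word_tableau_of_word[of w]]
  by (simp add: tableaux_def word_shape_def)

text \<open>The fibre of the tableau product over the class of w. That \<open>sigma\<close> is well
  defined means that exchanging the shapes leads to a fibre with exactly one element.\<close>

definition factors :: "nat \<Rightarrow> nat list \<Rightarrow> nat list \<Rightarrow> nat list \<Rightarrow> (nat list list \<times> nat list list) set" where
  "factors n \<nu> \<nu>' w = {(p, p'). p \<in> tableaux n \<nu> \<and> p' \<in> tableaux n \<nu>' \<and> row_word p @ row_word p' \<approx> w}"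

lemma factorsD:
  assumes "(p, p') \<in> factors n \<nu> \<nu>' w"
  shows "p \<in> tableaux n \<nu>" "p' \<in> tableaux n \<nu>'" "row_word p @ row_word p' \<approx> w" "set w \<subseteq> {1..n}"
proof -
  show *: "p \<in> tableaux n \<nu>" "p' \<in> tableaux n \<nu>'" "row_word p @ row_word p' \<approx> w"
    using assms by (auto simp: factors_def)
  show "set w \<subseteq> {1..n}"
    using knuth_set[OF *(3)] tableauxD(4)[OF *(1)] tableauxD(4)[OF *(2)] by auto
qed

lemma factorsI:
  assumes "set u \<subseteq> {1..n}" "set v \<subseteq> {1..n}" "u @ v \<approx> w"
  shows "(tableau_of_word u, tableau_of_word v) \<in> factors n (word_shape u) (word_shape v) w"
  unfolding factors_def
  using tableau_of_word_in_tableaux assms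
    knuth_equiv.trans[OF knuth_cong[OF row_word_tableau_of_word row_word_tableau_of_word] assms(3)]
  by auto

lemma factors_cong: "w \<approx> w' \<Longrightarrow> factors n \<nu> \<nu>' w = factors n \<nu> \<nu>' w'"
  unfolding factors_def using knuth_equiv.trans knuth_equiv.sym by blast

text \<open>This is \<open>raise_append\<close> with the cut between the two factors remembered,
  which the concatenated word alone would lose.\<close>

fun raise_pair :: "nat \<Rightarrow> nat list \<times> nat list \<Rightarrow> nat list \<times> nat list" where
  "raise_pair i (u, v) = (if eps i u > phi i v then (raise i u, v) else (u, raise i v))"

fun lower_pair :: "nat \<Rightarrow> nat list \<times> nat list \<Rightarrow> nat list \<times> nat list" where
  "lower_pair i (u, v) = (if phi i v > eps i u then (u, lower i v) else (lower i u, v))"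

lemma raise_pair:
  assumes "raise_pair i (u, v) = (u', v')"
  shows "u' @ v' = raise i (u @ v)" "length u' = length u" "word_shape u' = word_shape u"
    "word_shape v' = word_shape v" "set u' \<subseteq> insert i (set u)" "set v' \<subseteq> insert i (set v)"
  using assms set_raise[of i u] set_raise[of i v]
  by (auto simp: raise_append word_shape_raise split: if_splits)

lemma lower_pair:
  assumes "lower_pair i (u, v) = (u', v')"
  shows "u' @ v' = lower i (u @ v)" "length u' = length u" "word_shape u' = word_shape u"
    "word_shape v' = word_shape v" "set u' \<subseteq> insert (Suc i) (set u)" "set v' \<subseteq> insert (Suc i) (set v)"
  using assms set_lower[of i u] set_lower[of i v]
  by (auto simp: lower_append word_shape_lowered split: if_splits)

lemma lower_pair_cong:
  assumes "u1 \<approx> u2" "v1 \<approx> v2" "lower_pair i (u1, v1) = (x1, y1)" "lower_pair i (u2, v2) = (x2, y2)"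
  shows "x1 \<approx> x2 \<and> y1 \<approx> y2"
  using crystal_knuth[OF assms(1), of i] crystal_knuth[OF assms(2), of i] assms
  by (auto split: if_splits)

lemma lower_raise_pair:
  assumes "eps i (u @ v) > 0" shows "lower_pair i (raise_pair i (u, v)) = (u, v)"
proof -
  obtain u' v' x y where 1: "raise_pair i (u, v) = (u', v')" "lower_pair i (u', v') = (x, y)"
    by (metis surj_pair)
  have "x @ y = u @ v" using raise_pair(1)[OF 1(1)] lower_pair(1)[OF 1(2)] lower_raise[OF assms] by simp
  moreover have "length x = length u" using raise_pair(2)[OF 1(1)] lower_pair(2)[OF 1(2)] by simp
  ultimately show ?thesis using 1 by simp
qed

lemma factors_raise:
  assumes "(p, p') \<in> factors n \<nu> \<nu>' w" "1 \<le> i" "Suc i \<le> n"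
    "raise_pair i (row_word p, row_word p') = (u, v)"
  shows "(tableau_of_word u, tableau_of_word v) \<in> factors n \<nu> \<nu>' (raise i w)"
proof -
  note p = factorsD[OF assms(1)] and r = raise_pair[OF assms(4)]
  have "u @ v \<approx> raise i w" using r(1) crystal_knuth[OF p(3)] by simp
  moreover have "set u \<subseteq> {1..n}" "set v \<subseteq> {1..n}"
    using r(5,6) tableauxD(4)[OF p(1)] tableauxD(4)[OF p(2)] assms(2,3) by auto
  moreover have "word_shape u = \<nu>" "word_shape v = \<nu>'"
    using r(3,4) tableauxD(5)[OF p(1)] tableauxD(5)[OF p(2)] by auto
  ultimately show ?thesis using factorsI[of u n v "raise i w"] by simp
qed

lemma factors_lower:
  assumes "factors n \<nu> \<nu>' (raise i w) \<noteq> {}" "eps i w > 0" "Suc i \<le> n"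
  shows "factors n \<nu> \<nu>' w \<noteq> {}"
proof -
  obtain p p' where "(p, p') \<in> factors n \<nu> \<nu>' (raise i w)" using assms(1) by auto
  note p = factorsD[OF this]
  obtain u v where uv: "lower_pair i (row_word p, row_word p') = (u, v)" by (metis surj_pair)
  note r = lower_pair[OF uv]
  have "lower i (row_word p @ row_word p') \<approx> lower i (raise i w)" using crystal_knuth[OF p(3)] by blast
  then have "u @ v \<approx> w" using r(1) lower_raise[OF assms(2)] by simp
  moreover have "set u \<subseteq> {1..n}" "set v \<subseteq> {1..n}"
    using r(5,6) tableauxD(4)[OF p(1)] tableauxD(4)[OF p(2)] assms(3) by auto
  moreover have "word_shape u = \<nu>" "word_shape v = \<nu>'"
    using r(3,4) tableauxD(5)[OF p(1)] tableauxD(5)[OF p(2)] by auto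
  ultimately show ?thesis using factorsI[of u n v w] by auto
qed

lemma factors_yam:
  assumes "factors n \<nu> \<nu>' w \<noteq> {}"
  shows "\<exists>w0. yam0 w0 \<and> word_shape w0 = word_shape w \<and> factors n \<nu> \<nu>' w0 \<noteq> {}"
proof -
  have "set w \<subseteq> {1..n}" using assms factorsD(4) by fastforce
  then show ?thesis using assms
  proof (induction w rule: crystal_induct)
    case (yam w)
    then show ?case by blast
  next
    case (raise i w)
    obtain p p' where "(p, p') \<in> factors n \<nu> \<nu>' w" using raise.prems by auto
    from factors_raise[OF this raise.hyps(2,3)] have "factors n \<nu> \<nu>' (raise i w) \<noteq> {}"
      by (metis empty_iff surj_pair)
    then show ?case using raise.IH word_shape_raise by metis
  qed
qed

text \<open>Yamanouchi words of equal shape are Knuth equivalent. Together with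
  \<open>factors_yam\<close>, this makes the existence of a factorization depend on the shape of w
  alone.\<close>

lemma factors_of_yam:
  assumes "set w \<subseteq> {1..n}" "yam0 w0" "word_shape w0 = word_shape w" "factors n \<nu> \<nu>' w0 \<noteq> {}"
  shows "factors n \<nu> \<nu>' w \<noteq> {}"
  using assms
proof (induction w rule: crystal_induct)
  case (yam w)
  have "w0 \<approx> w" using yam yam_word_shape by (intro yam_knuth_unique) metis+
  then show ?case using yam.prems(3) factors_cong by metis
next
  case (raise i w)
  then show ?case using factors_lower[of n \<nu> \<nu>' i w] by (simp add: word_shape_raise)
qed

text \<open>Reversal with complementation exchanges the two factors but changes the word; the crystal operators
  lead back from the reversed word through the common Yamanouchi word of the same shape.\<close>

lemma factors_commute:
  assumes "factors n \<nu> \<nu>' w \<noteq> {}" shows "factors n \<nu>' \<nu> w \<noteq> {}"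
proof -
  obtain p p' where "(p, p') \<in> factors n \<nu> \<nu>' w" using assms by auto
  note p = factorsD[OF this]
  let ?rc = "rc (Suc n)"
  have le: "set (row_word p) \<subseteq> {..Suc n}" "set (row_word p') \<subseteq> {..Suc n}" "set w \<subseteq> {..Suc n}"
    using tableauxD(4)[OF p(1)] tableauxD(4)[OF p(2)] p(4) by auto
  have letters: "set (?rc u) \<subseteq> {1..n}" if "set u \<subseteq> {1..n}" for u
  proof
    fix c assume "c \<in> set (?rc u)"
    then obtain a where "a \<in> set u" "c = Suc n - a" by (auto simp: set_rc)
    moreover have "1 \<le> a" "a \<le> n" using that calculation(1) by auto
    ultimately show "c \<in> {1..n}" by auto
  qed
  have "?rc (row_word p') @ ?rc (row_word p) \<approx> ?rc w"
    using rc_knuth[OF p(3), of "Suc n"] le by (simp add: rc_simps)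
  moreover have "word_shape (?rc (row_word p')) = \<nu>'" "word_shape (?rc (row_word p)) = \<nu>"
    using word_shape_rc[OF le(1)] word_shape_rc[OF le(2)] tableauxD(5)[OF p(1)] tableauxD(5)[OF p(2)] by auto
  ultimately have "factors n \<nu>' \<nu> (?rc w) \<noteq> {}"
    using factorsI[OF letters letters, of "row_word p'" "row_word p" "?rc w"]
      tableauxD(4)[OF p(1)] tableauxD(4)[OF p(2)] by auto
  from factors_yam[OF this] obtain w0 where
    "yam0 w0" "word_shape w0 = word_shape w" "factors n \<nu>' \<nu> w0 \<noteq> {}"
    using word_shape_rc[OF le(3)] by auto
  then show ?thesis using factors_of_yam[OF p(4)] by blast
qed

text \<open>Raising a factorization of w gives one of \<open>raise i w\<close>, and
  \<open>lower_pair\<close> undoes it up to Knuth equivalence of the factors, so no two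
  factorizations are merged.\<close>

lemma factors_unique_raise:
  assumes "\<And>P Q. P \<in> factors n \<nu> \<nu>' (raise i w) \<Longrightarrow> Q \<in> factors n \<nu> \<nu>' (raise i w) \<Longrightarrow> P = Q"
    and "eps i w > 0" "1 \<le> i" "Suc i \<le> n"
    and "(p, p') \<in> factors n \<nu> \<nu>' w" "(q, q') \<in> factors n \<nu> \<nu>' w"
  shows "(p, p') = (q, q')"
proof -
  obtain u v where uv: "raise_pair i (row_word p, row_word p') = (u, v)" by (metis surj_pair)
  obtain x y where xy: "raise_pair i (row_word q, row_word q') = (x, y)" by (metis surj_pair)
  note p = factorsD[OF assms(5)] and q = factorsD[OF assms(6)]
  have "tableau_of_word u = tableau_of_word x" "tableau_of_word v = tableau_of_word y"
    using assms(1)[OF factors_raise[OF assms(5,3,4) uv] factors_raise[OF assms(6,3,4) xy]] by auto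
  then have eq: "u \<approx> x" "v \<approx> y" by (auto simp: tableau_of_word_eq_iff)
  have "lower_pair i (u, v) = (row_word p, row_word p')" "lower_pair i (x, y) = (row_word q, row_word q')"
    using lower_raise_pair[of i "row_word p" "row_word p'"] lower_raise_pair[of i "row_word q" "row_word q'"]
      crystal_knuth[OF p(3), of i] crystal_knuth[OF q(3), of i] assms(2) uv xy by auto
  then have "row_word p \<approx> row_word q" "row_word p' \<approx> row_word q'"
    using lower_pair_cong[OF eq] by blast+
  then show ?thesis
    using tableau_unique tableauxD(1)[OF p(1)] tableauxD(1)[OF p(2)] tableauxD(1)[OF q(1)] tableauxD(1)[OF q(2)]
    by blast
qed

section \<open>Products of rectangular tableaux\<close>

text \<open>On the first b rows the starting partition is a rectangle, so subtracting its width s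
  from each of these rows leaves a partition.\<close>

lemma yam_filter_small:
  assumes "yam \<beta> x" "\<And>i. 1 \<le> i \<Longrightarrow> i \<le> b \<Longrightarrow> \<beta> i = s"
  shows "yam0 (filter (\<lambda>a. a \<le> b) x)"
  using assms(1)
proof (induction x)
  case Nil
  then show ?case by (simp add: dominant_def)
next
  case (Cons a x)
  have count: "count_list (filter (\<lambda>a. a \<le> b) y) i = (if i \<le> b then count_list y i else 0)" for y i
    by (induction y) auto
  have "dominant ((\<lambda>_. 0) \<oplus> filter (\<lambda>a. a \<le> b) (a # x))"
    unfolding dominant_def count
  proof (intro allI impI)
    fix i :: nat assume i: "1 \<le> i"
    have "(\<beta> \<oplus> (a # x)) (Suc i) \<le> (\<beta> \<oplus> (a # x)) i"
      using Cons.prems i unfolding yam.simps dominant_def by blast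
    then show "0 + (if Suc i \<le> b then count_list (a # x) (Suc i) else 0)
        \<le> 0 + (if i \<le> b then count_list (a # x) i else 0)"
      using assms(2)[of i] assms(2)[of "Suc i"] i by auto
  qed
  then show ?case using Cons by auto
qed

text \<open>Above row b the starting partition is empty, so the part of the diagram above that row
  is filled from scratch.\<close>

lemma yam_filter_large:
  assumes "yam \<beta> x" "\<And>i. b < i \<Longrightarrow> \<beta> i = 0"
  shows "yam0 (map (\<lambda>a. a - b) (filter (\<lambda>a. b < a) x))"
  using assms(1)
proof (induction x)
  case Nil
  then show ?case by (simp add: dominant_def)
next
  case (Cons a x)
  have count: "count_list (map (\<lambda>a. a - b) (filter (\<lambda>a. b < a) y)) i = (if 1 \<le> i then count_list y (b + i) else 0)"
    for y i by (induction y) auto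
  have "dominant ((\<lambda>_. 0) \<oplus> map (\<lambda>a. a - b) (filter (\<lambda>a. b < a) (a # x)))"
    unfolding dominant_def count
  proof (intro allI impI)
    fix i :: nat assume i: "1 \<le> i"
    have "(\<beta> \<oplus> (a # x)) (Suc (b + i)) \<le> (\<beta> \<oplus> (a # x)) (b + i)"
      using Cons.prems i unfolding yam.simps dominant_def by (metis le_add2 le_trans)
    then show "0 + (if 1 \<le> Suc i then count_list (a # x) (b + Suc i) else 0)
        \<le> 0 + (if 1 \<le> i then count_list (a # x) (b + i) else 0)"
      using assms(2)[of "b + i"] assms(2)[of "Suc (b + i)"] i by auto
  qed
  then show ?case using Cons by auto
qed

lemma count_list_map_shift:
  "count_list (map (\<lambda>a. a - b) (filter (\<lambda>a. b < a) y)) (Suc i) = count_list y (b + Suc i)"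
  by (induction y) auto

lemma sorted_filter_split: "sorted r \<Longrightarrow> r = filter (\<lambda>a. a \<le> b) r @ filter (\<lambda>a. b < a) r" for b :: nat
proof (induction r)
  case (Cons x r)
  show ?case
  proof (cases "x \<le> b")
    case False
    then have "filter (\<lambda>a. a \<le> b) (x # r) = []" "filter (\<lambda>a. b < a) (x # r) = x # r"
      using Cons.prems by (auto simp: filter_empty_conv intro!: filter_True)
    then show ?thesis by simp
  qed (use Cons in auto)
qed simp

text \<open>A half-turn maps the rectangle to itself. It turns the large letters, which occupy a
  skew region, into small letters that form an ordinary tableau.\<close>

lemma wtab_rotate:
  assumes "wtab p" "shape p = replicate a r" "set (row_word p) \<subseteq> {..N}"
  shows "wtab (rev (map (rc N) p))" "row_word (rev (map (rc N) p)) = rc N (row_word p)"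
proof -
  show "row_word (rev (map (rc N) p)) = rc N (row_word p)"
    by (simp add: row_word_def rc_concat)
  have len: "length R = r" if "R \<in> set p" for R
    using that assms(2) unfolding shape_def by (metis in_set_replicate length_map nth_mem in_set_conv_nth nth_map)
  have set: "set R \<subseteq> {..N}" if "R \<in> set p" for R
    using that assms(3) by (auto simp: row_word_def)
  have "above (rc N R') (rc N R)" if "above R R'" "R \<in> set p" "R' \<in> set p" for R R'
    unfolding above_def
  proof (intro conjI allI impI)
    fix c assume c: "c < length (rc N R)"
    then have c': "r - Suc c < r" "c < r" using len[OF that(2)] by (auto simp: rc_simps)
    have "R ! (r - Suc c) < R' ! (r - Suc c)" using that len c' by (simp add: above_def)
    moreover have "R' ! (r - Suc c) \<le> N"
      using subsetD[OF set[OF that(3)] nth_mem[of "r - Suc c" R']] len[OF that(3)] c' by simp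
    ultimately show "rc N R' ! c < rc N R ! c"
      using c' len that by (simp add: rc_def rev_nth)
  qed (use len that in \<open>simp add: rc_simps\<close>)
  then have "sorted_wrt above (rev (map (rc N) p))"
    using assms(1) by (auto simp: wtab_def sorted_wrt_rev sorted_wrt_map elim!: sorted_wrt_mono_rel[rotated])
  then show "wtab (rev (map (rc N) p))"
    using assms(1) by (auto simp: wtab_def sorted_rc)
qed

lemma filter_rc:
  assumes "b \<le> n" "set x \<subseteq> {1..n}"
  shows "filter (\<lambda>a. a \<le> n - b) (rc (Suc n) x) = rc (Suc n) (filter (\<lambda>a. b < a) x)"
  using assms(2)
proof (induction x)
  case (Cons a x)
  have "rc (Suc n) (a # y) = rc (Suc n) y @ [Suc n - a]" for y by (simp add: rc_def)
  then show ?case using Cons assms(1) by auto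
qed (simp add: rc_def)

lemma count_le_width:
  assumes "wtab T" shows "count_list (row_word T) c \<le> part (shape T) 0"
proof -
  obtain Cs where Cs: "concat Cs \<approx> row_word T" "\<forall>C \<in> set Cs. sorted_wrt (>) C"
    "map length Cs = conjugate (shape T)"
    using column_word_exists[OF assms] by blast
  have one: "count_list C c \<le> 1" if "sorted_wrt (>) C" for C using that by (induction C) auto
  have "count_list (concat Cs) c \<le> length Cs" using Cs(2)
  proof (induction Cs)
    case (Cons C Cs)
    then show ?case using one[of C] by auto
  qed simp
  also have "length Cs = part (shape T) 0"
    using arg_cong[OF Cs(3), of length] by (simp add: conjugate_def width_def)
  finally show ?thesis using knuth_count[OF Cs(1)] by simp
qed

lemma part_replicate: "part (replicate a r) k = (if k < a then r else 0)"
  by (simp add: part_def)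

lemma yam_factors_right:
  assumes "(p, p') \<in> factors n \<nu> \<nu>' w" "yam0 w"
  shows "p' = map (\<lambda>k. replicate (\<nu>' ! k) (Suc k)) [0..<length \<nu>']"
    "yam ((\<lambda>_. 0) \<oplus> row_word p') (row_word p)"
    "count_list (row_word p') (Suc k) = part \<nu>' k"
proof -
  note p = factorsD[OF assms(1)] and t = tableauxD[OF factorsD(2)[OF assms(1)]]
  have "yam0 (row_word p @ row_word p')" using assms(2) yam_knuth[OF p(3)] by blast
  then have 1: "yam ((\<lambda>_. 0) \<oplus> row_word p') (row_word p)" and y: "yam0 (row_word p')"
    by (auto simp: yam_append)
  from 1 show "yam ((\<lambda>_. 0) \<oplus> row_word p') (row_word p)" .
  show "count_list (row_word p') (Suc k) = part \<nu>' k" using yam_tableau_count[OF t(2) y] t(3) by simp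
  have len: "length p' = length \<nu>'" "\<And>k. k < length p' \<Longrightarrow> length (p' ! k) = \<nu>' ! k"
    using t(3) by (auto simp: shape_def)
  show "p' = map (\<lambda>k. replicate (\<nu>' ! k) (Suc k)) [0..<length \<nu>']"
  proof (rule nth_equalityI)
    fix k assume k: "k < length p'"
    have "p' ! k = replicate (length (p' ! k)) (Suc k)"
      using yam_tableau_rows[OF t(2) y k] by (metis replicate_length_same)
    then show "p' ! k = map (\<lambda>k. replicate (\<nu>' ! k) (Suc k)) [0..<length \<nu>'] ! k"
      using len k by simp
  qed (use len in simp)
qed

text \<open>A Yamanouchi factorization is rigid: the right factor and the small letters of the left factor
  form Yamanouchi tableaux, and so do, after rotation, the large letters of the left factor.\<close>

lemma yam_factors_unique:
  assumes "(p, p') \<in> factors n (replicate a r) (replicate b s) w" "(q, q') \<in> factors n (replicate a r) (replicate b s) w"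
    and "yam0 w" "b \<ge> 1" "s \<ge> 1"
  shows "(p, p') = (q, q')"
proof -
  note p = factorsD[OF assms(1)] and q = factorsD[OF assms(2)]
  note tp = tableauxD[OF p(1)] and tq = tableauxD[OF q(1)]
  note yp = yam_factors_right[OF assms(1,3)] and yq = yam_factors_right[OF assms(2,3)]
  have eq': "p' = q'" using yp(1) yq(1) by simp
  \<comment> \<open>The letter b occurs in the right factor, hence b \<le> n and the difference n -
    b used in the rotation does not truncate.\<close>
  have "count_list (row_word p') b = s" using yp(3)[of "b - 1"] assms(4) by (simp add: part_replicate)
  then have "b \<in> set (row_word p')" using assms(5) count_notin[of b "row_word p'"] by fastforce
  then have bn: "b \<le> n" using tableauxD(4)[OF p(2)] by auto
  have count: "count_list (row_word p) = count_list (row_word q)"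
  proof
    fix c
    have "count_list (row_word p @ row_word p') c = count_list (row_word q @ row_word q') c"
      using knuth_count[OF p(3)] knuth_count[OF q(3)] by metis
    then show "count_list (row_word p) c = count_list (row_word q) c" using eq' by simp
  qed
  define S where "S = filter (\<lambda>a::nat. a \<le> b)"
  define L where "L = filter (\<lambda>a::nat. b < a)"
  have small: "S (x ! k) = replicate (count_list (S (row_word x)) (Suc k)) (Suc k)"
    if "(x, p') \<in> factors n (replicate a r) (replicate b s) w" "k < a" for x k
  proof -
    note t = tableauxD[OF factorsD(1)[OF that(1)]] and y = yam_factors_right[OF that(1) assms(3)]
    have len: "length x = a" using t(3) unfolding shape_def by (metis length_map length_replicate)
    have w: "wtab (map S x)" unfolding S_def by (rule wtab_filter_le[OF t(2)])
    have rw: "row_word (map S x) = S (row_word x)" unfolding S_def by (rule row_word_map_filter)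
    have "count_list (row_word p') i = s" if "1 \<le> i" "i \<le> b" for i
      using y(3)[of "i - 1"] that by (cases i) (simp_all add: part_replicate)
    then have "yam0 (S (row_word x))"
      using yam_filter_small[of "(\<lambda>_. 0) \<oplus> row_word p'" "row_word x" b s] y(2)
      unfolding S_def by simp
    then have yS: "yam0 (row_word (map S x))" unfolding rw .
    have "S (x ! k) = replicate (length (S (x ! k))) (Suc k)"
      using yam_tableau_rows[OF w yS, of k] len that(2) by (metis length_map nth_map replicate_length_same)
    moreover have "length (S (x ! k)) = count_list (S (row_word x)) (Suc k)"
      using yam_tableau_count[OF w yS, of k] len that(2) rw by (simp add: part_shape)
    ultimately show ?thesis by simp
  qed
  have largeY: "yam0 (map (\<lambda>a. a - b) (L (row_word x)))"
    if "(x, p') \<in> factors n (replicate a r) (replicate b s) w" for x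
  proof -
    note y = yam_factors_right[OF that assms(3)]
    have "count_list (row_word p') i = 0" if "b < i" for i
      using y(3)[of "i - 1"] that by (cases i) (simp_all add: part_replicate)
    then show ?thesis
      using yam_filter_large[of "(\<lambda>_. 0) \<oplus> row_word p'" "row_word x" b] y(2)
      unfolding L_def by simp
  qed
  have "map (\<lambda>a. a - b) (L (row_word p)) \<approx> map (\<lambda>a. a - b) (L (row_word q))"
    using largeY[OF assms(1)] largeY[of q] assms(2) eq' count
    by (intro yam_knuth_unique) (auto simp: L_def count_list_map_shift)
  then have "map (\<lambda>a. a + b) (map (\<lambda>a. a - b) (L (row_word p))) \<approx> map (\<lambda>a. a + b) (map (\<lambda>a. a - b) (L (row_word q)))"
    by (rule knuth_map) (simp add: strict_mono_def)
  moreover have "map (\<lambda>a. a + b) (map (\<lambda>a. a - b) (L x)) = L x" for x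
    by (auto simp: L_def intro!: map_idI)
  ultimately have "L (row_word p) \<approx> L (row_word q)" by simp
  then have "rc (Suc n) (L (row_word p)) \<approx> rc (Suc n) (L (row_word q))"
    by (rule rc_knuth) (use tp(4) in \<open>auto simp: L_def\<close>)
  \<comment> \<open>Under the half-turn a letter exceeds b iff its complement
    \<open>Suc n - a\<close> is at most n - b. Cutting at n - b therefore keeps precisely the large
    letters, now in a tableau whose rows are determined by its word.\<close>
  moreover define rot where "rot x = map (filter (\<lambda>a. a \<le> n - b)) (rev (map (rc (Suc n)) x))" for x
  have rot: "wtab (rot x)" "row_word (rot x) = rc (Suc n) (L (row_word x))"
    if "x \<in> tableaux n (replicate a r)" for x
  proof -
    note t = tableauxD[OF that]
    have le: "set (row_word x) \<subseteq> {..Suc n}" using t(4) by auto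
    note w = wtab_rotate[OF t(2,3) le]
    show "wtab (rot x)" unfolding rot_def by (rule wtab_filter_le[OF w(1)])
    show "row_word (rot x) = rc (Suc n) (L (row_word x))"
      unfolding rot_def row_word_map_filter w(2) L_def by (rule filter_rc[OF bn t(4)])
  qed
  ultimately have rw: "row_word (rot p) \<approx> row_word (rot q)" using p(1) q(1) by simp
  have len: "length p = a" "length q = a"
    using tp(3) tq(3) unfolding shape_def by (metis length_map length_replicate)+
  have "p = q"
  proof (rule nth_equalityI)
    show "length p = length q" using len by simp
    fix k assume k: "k < length p"
    \<comment> \<open>The half-turn carries the row with index k to this index.\<close>
    let ?i = "a - Suc k"
    have "rot p ! ?i = rot q ! ?i"
      using wtab_rows_unique[OF rot(1)[OF p(1)] rot(1)[OF q(1)] rw, of ?i] k len by (simp add: rot_def)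
    moreover have "rot x ! ?i = rc (Suc n) (L (x ! k))" if "x \<in> tableaux n (replicate a r)" "length x = a" for x
    proof -
      have "set (x ! k) \<subseteq> {1..n}" using tableauxD(4)[OF that(1)] that(2) k len
        by (fastforce simp: row_word_def)
      then show ?thesis using filter_rc[OF bn, of "x ! k"] that(2) k len by (simp add: rot_def rev_nth L_def)
    qed
    ultimately have "rc (Suc n) (L (p ! k)) = rc (Suc n) (L (q ! k))" using p(1) q(1) len by simp
    moreover have "set (L (x ! k)) \<subseteq> {..Suc n}" if "x \<in> tableaux n (replicate a r)" "length x = a" for x
      using tableauxD(4)[OF that(1)] that(2) k len by (fastforce simp: row_word_def L_def)
    ultimately have "L (p ! k) = L (q ! k)" using rc_rc p(1) q(1) len by metis
    moreover have "S (p ! k) = S (q ! k)"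
    proof -
      have "count_list (S (row_word p)) (Suc k) = count_list (S (row_word q)) (Suc k)"
      proof -
        have "count_list (S y) i = (if i \<le> b then count_list y i else 0)" for y i
          by (induction y) (auto simp: S_def)
        then show ?thesis using count by simp
      qed
      then show ?thesis using small[OF assms(1), of k] small[of q k] assms(2) eq' k len by simp
    qed
    moreover have "sorted (p ! k)" "sorted (q ! k)" using tp(2) tq(2) k len by (auto simp: wtab_def)
    ultimately show "p ! k = q ! k" using sorted_filter_split unfolding S_def L_def by metis
  qed
  then show ?thesis using eq' by simp
qed

lemma factors_unique:
  assumes "P \<in> factors n (replicate a r) (replicate b s) w" "Q \<in> factors n (replicate a r) (replicate b s) w"
    and "b \<ge> 1" "s \<ge> 1"
  shows "P = Q"
proof -
  have "set w \<subseteq> {1..n}" using assms(1) factorsD(4) by (cases P) blast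
  then show ?thesis using assms(1,2)
  proof (induction w arbitrary: P Q rule: crystal_induct)
    case (yam w)
    then show ?case using yam_factors_unique[of _ _ n a r b s w] assms(3,4) by (metis surj_pair)
  next
    case (raise i w)
    then show ?case using factors_unique_raise[OF raise.IH] by (metis surj_pair)
  qed
qed

text \<open>For a Yamanouchi word the shape is the content. The right factor contributes s to each
  of the first b letters and nothing else, and the left one has only r columns, each containing a
  letter at most once.\<close>

lemma factors_shape_bounds:
  assumes "factors n (replicate a r) (replicate b s) w \<noteq> {}" "a \<ge> 1"
  shows "k < b \<Longrightarrow> s \<le> part (word_shape w) k"
    "part (word_shape w) k \<le> r + (if k < b then s else 0)"
proof -
  obtain w0 where w0: "yam0 w0" "word_shape w0 = word_shape w"
    "factors n (replicate a r) (replicate b s) w0 \<noteq> {}"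
    using factors_yam[OF assms(1)] by blast
  then obtain p p' where pp: "(p, p') \<in> factors n (replicate a r) (replicate b s) w0" by auto
  note p = factorsD[OF pp] and t = tableauxD[OF factorsD(1)[OF pp]]
  have "part (word_shape w) k = count_list (row_word p) (Suc k) + count_list (row_word p') (Suc k)"
    using yam_word_shape[OF w0(1), of k] w0(2) knuth_count[OF p(3)] by (metis count_list_append)
  moreover have "count_list (row_word p') (Suc k) = (if k < b then s else 0)"
    using yam_factors_right(3)[OF pp w0(1), of k] by (simp add: part_replicate)
  moreover have "count_list (row_word p) (Suc k) \<le> r"
    using count_le_width[OF t(2), of "Suc k"] t(3) assms(2) by (simp add: part_replicate)
  ultimately show "k < b \<Longrightarrow> s \<le> part (word_shape w) k"
    "part (word_shape w) k \<le> r + (if k < b then s else 0)" by auto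
qed

section \<open>The combinatorial R-matrix\<close>

lemma rectangles_cases:
  assumes "\<nu> \<in> rectangles"
  obtains a r where "\<nu> = replicate a r" "a \<ge> 1" "r \<ge> 1"
  using assms by (auto simp: rectangles_def)

lemma sigma_factors:
  assumes "p \<in> tableaux n \<nu>" "p' \<in> tableaux n \<nu>'" "\<nu> \<in> rectangles" "\<nu>' \<in> rectangles"
  shows "sigma n p p' \<in> factors n \<nu>' \<nu> (row_word p @ row_word p')"
    and "x \<in> factors n \<nu>' \<nu> (row_word p @ row_word p') \<Longrightarrow> sigma n p p' = x"
proof -
  let ?F = "factors n \<nu>' \<nu> (row_word p @ row_word p')"
  obtain a r where \<nu>: "\<nu> = replicate a r" "a \<ge> 1" "r \<ge> 1" using assms(3) by (rule rectangles_cases)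
  obtain b s where \<nu>': "\<nu>' = replicate b s" "b \<ge> 1" "s \<ge> 1" using assms(4) by (rule rectangles_cases)
  have "(p, p') \<in> factors n \<nu> \<nu>' (row_word p @ row_word p')"
    using assms by (simp add: factors_def knuth_equiv.refl)
  then have "?F \<noteq> {}" using factors_commute by blast
  moreover have "x = y" if "x \<in> ?F" "y \<in> ?F" for x y
    using factors_unique[of x n b s a r _ y] that \<nu> \<nu>' by blast
  ultimately have ex1: "\<exists>!x. x \<in> ?F" by blast
  have "(\<lambda>(q', q). q' \<in> tableaux n (shape p') \<and> q \<in> tableaux n (shape p) \<and>
      tableau_prod p p' = tableau_prod q' q) = (\<lambda>x. x \<in> ?F)"
    using tableauxD(3)[OF assms(1)] tableauxD(3)[OF assms(2)] knuth_equiv.sym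
    by (auto simp: fun_eq_iff factors_def tableau_prod_def tableau_of_word_eq_iff)
  then have "sigma n p p' = (THE x. x \<in> ?F)" by (simp add: sigma_def)
  then show "sigma n p p' \<in> ?F" "x \<in> ?F \<Longrightarrow> sigma n p p' = x"
    using theI'[OF ex1] ex1 by auto
qed

section \<open>Energy\<close>

lemma psize_part_inter:
  assumes "min (length \<nu>) (length \<nu>') \<le> K"
  shows "psize (part_inter \<nu> \<nu>') = (\<Sum>i<K. min (part \<nu> i) (part \<nu>' i))"
proof -
  have "psize (part_inter \<nu> \<nu>') = (\<Sum>i<min (length \<nu>) (length \<nu>'). min (part \<nu> i) (part \<nu>' i))"
    by (simp add: psize_def part_inter_def height_def sum_list_sum_nth atLeast0LessThan)
  also have "\<dots> = (\<Sum>i<K. min (part \<nu> i) (part \<nu>' i))"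
    using assms by (intro sum.mono_neutral_left) (auto simp: part_def)
  finally show ?thesis .
qed

lemma part_part_add: "part (part_add \<nu> \<nu>') i = part \<nu> i + part \<nu>' i"
  by (auto simp: part_add_def part_def height_def)

lemma sum_list_word_shape: "sum_list (word_shape w) = length w"
proof -
  have "sum_list (shape T) = length (row_word T)" for T :: "'a list list"
    by (induction T) auto
  then show ?thesis unfolding word_shape_def using knuth_length[OF row_word_tableau_of_word] by metis
qed

text \<open>Up to height \<open>max a b\<close> the product shape lies inside the sum of the two
  rectangles, so the energy is the number of its cells above that height. The bounds on the parts
  come in pairs because the factors can be exchanged. The additive form avoids truncated
  subtraction.\<close>

lemma energy_rectangles:
  assumes "p \<in> tableaux n (replicate a r)" "p' \<in> tableaux n (replicate b s)" "a \<ge> 1" "b \<ge> 1"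
    and "\<rho> = word_shape (row_word p @ row_word p')"
  shows "energy p p' + (\<Sum>i<max a b. part \<rho> i) = a * r + b * s"
    and "sum_list \<rho> = a * r + b * s"
    and "\<And>k. k < b \<Longrightarrow> s \<le> part \<rho> k" "\<And>k. k < a \<Longrightarrow> r \<le> part \<rho> k"
    and "\<And>k. part \<rho> k \<le> r + (if k < b then s else 0)" "\<And>k. part \<rho> k \<le> s + (if k < a then r else 0)"
proof -
  let ?w = "row_word p @ row_word p'" and ?\<kappa> = "part_add (replicate a r) (replicate b s)"
  have "(p, p') \<in> factors n (replicate a r) (replicate b s) ?w"
    using assms by (simp add: factors_def knuth_equiv.refl)
  then have F: "factors n (replicate a r) (replicate b s) ?w \<noteq> {}" by blast
  note F' = factors_commute[OF F]
  show b: "\<And>k. k < b \<Longrightarrow> s \<le> part \<rho> k" "\<And>k. part \<rho> k \<le> r + (if k < b then s else 0)"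
    using factors_shape_bounds[OF F assms(3)] assms(5) by auto
  show a: "\<And>k. k < a \<Longrightarrow> r \<le> part \<rho> k" "\<And>k. part \<rho> k \<le> s + (if k < a then r else 0)"
    using factors_shape_bounds[OF F' assms(4)] assms(5) by auto
  have len: "length (row_word p) = a * r" "length (row_word p') = b * s"
    using sum_list_word_shape[of "row_word p"] sum_list_word_shape[of "row_word p'"]
      tableauxD(5)[OF assms(1)] tableauxD(5)[OF assms(2)] by (simp_all add: sum_list_replicate)
  then show total: "sum_list \<rho> = a * r + b * s" using assms(5) by (simp add: sum_list_word_shape)
  have part\<kappa>: "part ?\<kappa> i = (if i < a then r else 0) + (if i < b then s else 0)" for i
    by (simp add: part_part_add part_replicate)
  have len\<kappa>: "length ?\<kappa> = max a b" by (simp add: part_add_def height_def)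
  have "psize ?\<kappa> = (\<Sum>i<max a b. part ?\<kappa> i)"
    using sum_part[of ?\<kappa> "max a b"] len\<kappa> by (simp add: psize_def)
  also have "\<dots> = a * r + b * s"
  proof -
    have "{..<max a b} \<inter> {i. i < c} = {..<c}" if "c \<le> max a b" for c using that by auto
    then show ?thesis by (simp add: part\<kappa> sum.distrib sum.If_cases)
  qed
  finally have size: "psize ?\<kappa> = a * r + b * s" .
  have "part \<rho> i \<le> part ?\<kappa> i" if "i < max a b" for i
    using a(2)[of i] b(2)[of i] that unfolding part\<kappa> by (auto split: if_splits)
  then have "psize (part_inter \<rho> ?\<kappa>) = (\<Sum>i<max a b. part \<rho> i)"
    using len\<kappa> by (subst psize_part_inter[of _ _ "max a b"]) (auto intro!: sum.cong)
  moreover have "energy p p' = psize ?\<kappa> - psize (part_inter \<rho> ?\<kappa>)"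
    using tableauxD(3)[OF assms(1)] tableauxD(3)[OF assms(2)] assms(5)
    by (simp add: energy_def Let_def tableau_prod_def word_shape_def)
  moreover have "(\<Sum>i<max a b. part \<rho> i) \<le> sum_list \<rho>"
    by (metis sum_part append_take_drop_id sum_list_append le_add1)
  ultimately show "energy p p' + (\<Sum>i<max a b. part \<rho> i) = a * r + b * s"
    using size total by simp
qed

lemma conjugate_replicate: "a \<ge> 1 \<Longrightarrow> conjugate (replicate a r) = replicate r a"
  by (rule nth_equalityI)
    (auto simp: conjugate_def width_def part_replicate intro!: arg_cong[of _ "{..<a}" card, simplified])

text \<open>The energy counts the cells of the product shape in rows above both factors, its transposed
  counterpart those in columns to the right of both factors; all other cells form the union of the two
  rectangles.\<close>

lemma energy_transpose:
  assumes p: "p \<in> tableaux n \<nu>" "p' \<in> tableaux n \<nu>'" "\<nu> \<in> rectangles" "\<nu>' \<in> rectangles"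
    and z: "z \<in> tableaux m (conjugate \<nu>)" "z' \<in> tableaux m (conjugate \<nu>')"
    and shape: "word_shape (row_word z @ row_word z') = conjugate (word_shape (row_word p @ row_word p'))"
  shows "energy p p' + energy z z' = psize (part_inter \<nu> \<nu>')"
proof -
  obtain a r where \<nu>: "\<nu> = replicate a r" "a \<ge> 1" "r \<ge> 1" using p(3) by (rule rectangles_cases)
  obtain b s where \<nu>': "\<nu>' = replicate b s" "b \<ge> 1" "s \<ge> 1" using p(4) by (rule rectangles_cases)
  define \<rho> where "\<rho> = word_shape (row_word p @ row_word p')"
  have sorted: "sorted_wrt (\<ge>) \<rho>" using is_partition_word_shape unfolding \<rho>_def is_partition_def by blast
  note e = energy_rectangles[OF p(1)[unfolded \<nu>(1)] p(2)[unfolded \<nu>'(1)] \<nu>(2) \<nu>'(2) \<rho>_def]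
  have z2: "z \<in> tableaux m (replicate r a)" "z' \<in> tableaux m (replicate s b)"
    using z \<nu> \<nu>' by (simp_all add: conjugate_replicate)
  note d = energy_rectangles[OF z2 \<nu>(3) \<nu>'(3) HOL.refl]
  let ?m = "max a b" and ?M = "max r s" and ?K = "max (length \<rho>) (max a b)"
  have dual: "energy z z' + (\<Sum>x\<leftarrow>\<rho>. min ?M x) = a * r + b * s"
    using d(1) sum_part_conjugate[OF sorted, of ?M] shape by (simp add: \<rho>_def mult.commute)
  have split: "(\<Sum>k<?K. f k) = (\<Sum>k<?m. f k) + (\<Sum>k=?m..<?K. f k)" for f :: "nat \<Rightarrow> nat"
    by (metis atLeast0LessThan max.cobounded2 sum.atLeastLessThan_concat zero_le)
  have "(\<Sum>x\<leftarrow>\<rho>. min ?M x) = (\<Sum>k<length \<rho>. min ?M (part \<rho> k))"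
    by (simp add: sum_list_sum_nth atLeast0LessThan part_def)
  also have "\<dots> = (\<Sum>k<?K. min ?M (part \<rho> k))"
    by (intro sum.mono_neutral_left) (auto simp: part_def)
  also have "\<dots> = (\<Sum>k<?m. min ?M (part \<rho> k)) + (\<Sum>k=?m..<?K. min ?M (part \<rho> k))" by (rule split)
  \<comment> \<open>A row above both rectangles has length at most r, so cutting it at width
    \<open>?M\<close> changes nothing.\<close>
  also have "(\<Sum>k=?m..<?K. min ?M (part \<rho> k)) = (\<Sum>k=?m..<?K. part \<rho> k)"
  proof (rule sum.cong)
    fix k assume "k \<in> {?m..<?K}"
    then show "min ?M (part \<rho> k) = part \<rho> k" using e(5)[of k] by auto
  qed simp
  \<comment> \<open>A row meeting both rectangles is at least \<open>?M\<close> long. A row meeting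
    only the taller one has exactly the width of that rectangle, by the lower bound from one order
    of the factors and the upper bound from the other.\<close>
  also have "(\<Sum>k<?m. min ?M (part \<rho> k)) = (\<Sum>k<?m. if k < min a b then ?M else if a < b then s else r)"
  proof (rule sum.cong)
    fix k assume k: "k \<in> {..<?m}"
    then show "min ?M (part \<rho> k) = (if k < min a b then ?M else if a < b then s else r)"
      using e(3)[of k] e(4)[of k] e(5)[of k] e(6)[of k] by (auto split: if_splits)
  qed simp
  finally have dual2: "(\<Sum>x\<leftarrow>\<rho>. min ?M x) =
    (\<Sum>k<?m. if k < min a b then ?M else if a < b then s else r) + (\<Sum>k=?m..<?K. part \<rho> k)" .
  have "(\<Sum>k<?K. part \<rho> k) = a * r + b * s" using e(2) by (simp add: sum_part)
  then have total: "(\<Sum>k<?m. part \<rho> k) + (\<Sum>k=?m..<?K. part \<rho> k) = a * r + b * s"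
    using split by simp
  have "(\<Sum>k<?m. if k < min a b then ?M else if a < b then s else r) =
      min a b * ?M + (?m - min a b) * (if a < b then s else r)"
  proof -
    have "{..<?m} \<inter> {k. k < min a b} = {..<min a b}" "{..<?m} \<inter> - {k. k < min a b} = {min a b..<?m}"
      by auto
    then show ?thesis by (simp only: sum.If_cases[OF finite_lessThan] sum_constant card_lessThan card_atLeastLessThan) simp
  qed
  then have "energy p p' + energy z z' + (min a b * ?M + (?m - min a b) * (if a < b then s else r)) = a * r + b * s"
    using e(1) dual dual2 total by linarith
  \<comment> \<open>Inclusion-exclusion for two rectangles with a common corner: the first two
    summands count their union, the last one their intersection.\<close>
  moreover have "min a b * ?M + (?m - min a b) * (if a < b then s else r) + min a b * min r s = a * r + b * s"
  proof -
    have M: "x * ?M + x * min r s = x * r + x * s" for x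
      by (metis add.commute max_def min_def distrib_left)
    show ?thesis
    proof (cases "a < b")
      case True
      then have "a * s + (b - a) * s = b * s" by (metis add_mult_distrib le_add_diff_inverse less_imp_le)
      then show ?thesis using M[of a] True by (simp add: min_def max_def del: distrib_left)
    next
      case False
      then have "b * r + (a - b) * r = a * r" by (metis add_mult_distrib le_add_diff_inverse not_less)
      then show ?thesis using M[of b] False by (simp add: min_def max_def)
    qed
  qed
  moreover have "psize (part_inter \<nu> \<nu>') = min a b * min r s"
  proof -
    have "psize (part_inter \<nu> \<nu>') = (\<Sum>i<min a b. min (part \<nu> i) (part \<nu>' i))"
      using \<nu> \<nu>' by (intro psize_part_inter) simp
    also have "\<dots> = (\<Sum>i<min a b. min r s)"
      by (rule sum.cong) (auto simp: \<nu> \<nu>' part_replicate)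
    finally show ?thesis by simp
  qed
  ultimately show ?thesis by linarith
qed

section \<open>The map omega\<close>

definition val :: "path \<Rightarrow> nat \<times> nat \<times> nat \<Rightarrow> nat" where
  "val P = (\<lambda>(j, k, c). P ! j ! k ! c)"

definition pos :: "nat \<times> nat \<times> nat \<Rightarrow> nat \<times> nat" where
  "pos = (\<lambda>(j, k, c). (Suc j, Suc k))"

text \<open>Lists the cells so that their values spell \<open>path_word\<close> backwards, the order
  in which the Yamanouchi condition reads them.\<close>

definition reading :: "path \<Rightarrow> (nat \<times> nat \<times> nat) list" where
  "reading P = concat (map (\<lambda>j. concat (map (\<lambda>k. map (\<lambda>c. (j, k, c)) (rev [0..<length (P ! j ! k)]))
     [0..<length (P ! j)])) [0..<length P])"

definition path_word :: "path \<Rightarrow> nat list" where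
  "path_word P = concat (rev (map row_word P))"

lemma set_reading: "set (reading P) = cells P"
proof
  show "set (reading P) \<subseteq> cells P" by (auto simp: reading_def cells_def)
  show "cells P \<subseteq> set (reading P)"
  proof
    fix x assume "x \<in> cells P"
    then obtain j k c where "x = (j, k, c)" "j < length P" "k < length (P ! j)" "c < length (P ! j ! k)"
      by (auto simp: cells_def)
    then have "\<exists>j' \<in> {0..<length P}. \<exists>k' \<in> {0..<length (P ! j')}.
        x \<in> (\<lambda>c. (j', k', c)) ` {0..<length (P ! j' ! k')}"
      by - (rule bexI[of _ j], rule bexI[of _ k], auto)
    then show "x \<in> set (reading P)" by (simp add: reading_def)
  qed
qed

lemma map_nth_rev: "map (\<lambda>c. r ! c) (rev [0..<length r]) = rev r"
  by (simp only: rev_map[symmetric] map_nth)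

lemma map_concat_nth: "concat (map (\<lambda>k. f (T ! k)) [0..<length T]) = concat (map f T)"
  by (rule arg_cong[of _ _ concat], rule nth_equalityI) auto

lemma val_reading: "map (val P) (reading P) = rev (path_word P)"
proof -
  have row: "map (\<lambda>c. val P (j, k, c)) (rev [0..<length (P ! j ! k)]) = rev (P ! j ! k)" for j k
    using map_nth_rev[of "P ! j ! k"] by (simp add: val_def)
  have "map (val P) (reading P) =
      concat (map (\<lambda>j. concat (map (\<lambda>k. rev (P ! j ! k)) [0..<length (P ! j)])) [0..<length P])"
    by (simp add: reading_def map_concat o_def row)
  also have "\<dots> = concat (map (\<lambda>T. concat (map rev T)) P)"
    by (simp only: map_concat_nth[of rev] map_concat_nth[of "\<lambda>T. concat (map rev T)" P])
  also have "\<dots> = rev (path_word P)"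
    by (simp add: path_word_def row_word_def rev_concat rev_map o_def)
  finally show ?thesis .
qed

lemma sorted_wrt_concat:
  assumes "\<And>xs. xs \<in> set xss \<Longrightarrow> sorted_wrt P xs"
    and "sorted_wrt (\<lambda>xs ys. \<forall>x \<in> set xs. \<forall>y \<in> set ys. P x y) xss"
  shows "sorted_wrt P (concat xss)"
  using assms by (induction xss) (auto simp: sorted_wrt_append)

definition read_before :: "nat \<times> nat \<times> nat \<Rightarrow> nat \<times> nat \<times> nat \<Rightarrow> bool" where
  "read_before = (\<lambda>(j, k, c) (j', k', c'). j < j' \<or> j = j' \<and> (k < k' \<or> k = k' \<and> c' < c))"

lemma sorted_wrt_map_upt:
  assumes "\<And>i j. i < j \<Longrightarrow> P (f i) (f j)" shows "sorted_wrt P (map f [m..<n])"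
  unfolding sorted_wrt_map by (rule sorted_wrt_mono_rel[OF _ sorted_wrt_upt]) (rule assms)

lemma sorted_reading: "sorted_wrt read_before (reading P)"
proof -
  have row: "sorted_wrt read_before (map (\<lambda>c. (j, k, c)) (rev [0..<l]))" for j k l
    unfolding rev_map[symmetric] sorted_wrt_rev by (rule sorted_wrt_map_upt) (simp add: read_before_def)
  have tab: "sorted_wrt read_before (concat (map (\<lambda>k. map (\<lambda>c. (j, k, c)) (rev [0..<f k])) [0..<l]))" for j f l
  proof (rule sorted_wrt_concat)
    show "sorted_wrt (\<lambda>xs ys. \<forall>x\<in>set xs. \<forall>y\<in>set ys. read_before x y)
        (map (\<lambda>k. map (\<lambda>c. (j, k, c)) (rev [0..<f k])) [0..<l])"
      by (rule sorted_wrt_map_upt) (auto simp: read_before_def)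
  qed (use row in auto)
  show ?thesis
    unfolding reading_def
  proof (rule sorted_wrt_concat)
    show "sorted_wrt (\<lambda>xs ys. \<forall>x\<in>set xs. \<forall>y\<in>set ys. read_before x y)
        (map (\<lambda>j. concat (map (\<lambda>k. map (\<lambda>c. (j, k, c)) (rev [0..<length (P ! j ! k)])) [0..<length (P ! j)])) [0..<length P])"
      by (rule sorted_wrt_map_upt) (auto simp: read_before_def)
  qed (use tab in auto)
qed

definition removed_before :: "path \<Rightarrow> nat \<times> nat \<times> nat \<Rightarrow> nat \<times> nat \<times> nat \<Rightarrow> bool" where
  "removed_before P x y \<longleftrightarrow> x \<noteq> y \<and> (val P y < val P x \<or> val P y = val P x \<and>
    (case x of (j, k, c) \<Rightarrow> case y of (j', k', c') \<Rightarrow> j < j' \<or> j = j' \<and> c' \<le> c))"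

lemma column_strict:
  assumes "tableau T" "k < k'" "k' < length T" "c < length (T ! k')"
  shows "c < length (T ! k)" "T ! k ! c < T ! k' ! c"
proof -
  have "above (T ! k) (T ! k')"
    using assms sorted_wrt_nth_less[of above T k k'] by (auto simp: tableau_iff wtab_def)
  then show "c < length (T ! k)" "T ! k ! c < T ! k' ! c" using assms by (auto simp: above_def)
qed

lemma row_mono:
  assumes "tableau T" "k < length T" "c \<le> c'" "c' < length (T ! k)"
  shows "T ! k ! c \<le> T ! k ! c'"
  using assms by (auto simp: tableau_iff wtab_def intro!: sorted_nth_mono)

text \<open>The choice in \<open>next_cell\<close> does not compare rows. It is unique because equal
  entries of one tableau never share a column.\<close>

lemma next_cell_eq:
  assumes "\<forall>p \<in> set P. tableau p" "x \<in> S" "S \<subseteq> cells P" "\<And>y. y \<in> S - {x} \<Longrightarrow> removed_before P x y"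
  shows "next_cell P S = x"
  unfolding next_cell_def
proof (rule the_equality)
  obtain j k c where x: "x = (j, k, c)" by (cases x)
  have *: "P ! j' ! k' ! c' \<le> P ! j ! k ! c \<and>
      (P ! j' ! k' ! c' = P ! j ! k ! c \<longrightarrow> j < j' \<or> j = j' \<and> c' \<le> c)" if "(j', k', c') \<in> S" for j' k' c'
    using assms(4)[of "(j', k', c')"] that x by (cases "(j', k', c') = x") (auto simp: removed_before_def val_def)
  then show 1: "case x of (j, k, c) \<Rightarrow> (j, k, c) \<in> S \<and> (\<forall>(j', k', c') \<in> S. P ! j' ! k' ! c' \<le> P ! j ! k ! c) \<and>
      (\<forall>(j', k', c') \<in> S. P ! j' ! k' ! c' = P ! j ! k ! c \<longrightarrow> j < j' \<or> j = j' \<and> c' \<le> c)"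
    using assms(2) x by auto
  fix y assume y: "case y of (j, k, c) \<Rightarrow> (j, k, c) \<in> S \<and> (\<forall>(j', k', c') \<in> S. P ! j' ! k' ! c' \<le> P ! j ! k ! c) \<and>
      (\<forall>(j', k', c') \<in> S. P ! j' ! k' ! c' = P ! j ! k ! c \<longrightarrow> j < j' \<or> j = j' \<and> c' \<le> c)"
  obtain j' k' c' where yy: "y = (j', k', c')" by (cases y)
  have S: "(j, k, c) \<in> S" "(j', k', c') \<in> S" using y assms(2) x yy by auto
  have le: "P ! j ! k ! c \<le> P ! j' ! k' ! c'" and tie: "P ! j ! k ! c = P ! j' ! k' ! c' \<Longrightarrow> j' < j \<or> j' = j \<and> c \<le> c'"
    using y yy S(1) by fastforce+
  have eq: "P ! j ! k ! c = P ! j' ! k' ! c'" using le *[OF S(2)] by simp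
  have jc: "j' = j" "c' = c" using tie[OF eq] *[OF S(2)] eq by auto
  have cells: "(j, k, c) \<in> cells P" "(j, k', c) \<in> cells P" using S assms(3) jc by auto
  have "tableau (P ! j)" using assms(1) cells by (auto simp: cells_def)
  then have "\<not> k < k'" "\<not> k' < k"
    using column_strict(2)[of "P ! j" k k' c] column_strict(2)[of "P ! j" k' k c] cells eq jc
    by (auto simp: cells_def)
  then have "k = k'" by simp
  then show "y = x" using yy x jc by simp
qed

lemma omega_word_eq:
  assumes "\<forall>p \<in> set P. tableau p" "sorted_wrt (removed_before P) xs" "set xs \<subseteq> cells P"
  shows "omega_word P (length xs) (set xs) = map pos xs"
  using assms(2,3)
proof (induction xs)
  case (Cons x xs)
  have "next_cell P (set (x # xs)) = x"
    by (rule next_cell_eq[OF assms(1)]) (use Cons.prems in auto)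
  moreover have "set (x # xs) - {x} = set xs" using Cons.prems by (auto simp: removed_before_def)
  ultimately show ?case using Cons by (cases x) (simp add: pos_def)
qed simp

definition positions :: "path \<Rightarrow> nat \<Rightarrow> (nat \<times> nat) list" where
  "positions P v = map pos (filter (\<lambda>x. val P x = v) (reading P))"

text \<open>Equal entries of one tableau lie further left in higher rows, so cells of equal value
  are deleted in reading order. Thus \<open>omega\<close> lists, for each value from n down to 1,
  the positions of this value.\<close>

lemma omega_eq:
  assumes "\<forall>p \<in> set P. tableau p" "set (path_word P) \<subseteq> {1..n}"
  shows "omega P = concat (map (positions P) (rev [1..<Suc n]))"
proof -
  let ?xs = "concat (map (\<lambda>v. filter (\<lambda>x. val P x = v) (reading P)) (rev [1..<Suc n]))"
  have tie: "removed_before P x y"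
    if xy: "read_before x y" "val P x = val P y" "x \<in> cells P" "y \<in> cells P" for x y
  proof -
    obtain j k c j' k' c' where x: "x = (j, k, c)" and y: "y = (j', k', c')" by (cases x, cases y)
    have "c' \<le> c" if "j = j'" "k < k'"
    proof (rule ccontr)
      assume "\<not> c' \<le> c"
      then have "c \<le> c'" by simp
      have T: "tableau (P ! j)" using assms(1) xy(3) x by (auto simp: cells_def)
      have l: "k' < length (P ! j)" "c' < length (P ! j ! k')" using xy(4) y that by (auto simp: cells_def)
      have "P ! j ! k ! c < P ! j ! k' ! c" using column_strict(2)[OF T that(2) l(1)] l \<open>c \<le> c'\<close> by simp
      also have "\<dots> \<le> P ! j ! k' ! c'" using row_mono[OF T l(1) \<open>c \<le> c'\<close> l(2)] .
      finally show False using xy(2) x y that by (simp add: val_def)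
    qed
    then show ?thesis using xy x y by (auto simp: removed_before_def read_before_def)
  qed
  have "sorted_wrt (removed_before P) ?xs"
  proof (rule sorted_wrt_concat)
    fix xs assume "xs \<in> set (map (\<lambda>v. filter (\<lambda>x. val P x = v) (reading P)) (rev [1..<Suc n]))"
    then obtain v where xs: "xs = filter (\<lambda>x. val P x = v) (reading P)" by auto
    have "sorted_wrt read_before xs" unfolding xs by (rule sorted_wrt_filter[OF sorted_reading])
    then show "sorted_wrt (removed_before P) xs"
      by (rule sorted_wrt_mono_rel[rotated]) (auto simp: xs set_reading intro!: tie)
  next
    have "sorted_wrt (>) (rev [1..<Suc n])" by (simp add: sorted_wrt_rev del: upt_Suc)
    then show "sorted_wrt (\<lambda>xs ys. \<forall>x\<in>set xs. \<forall>y\<in>set ys. removed_before P x y)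
       (map (\<lambda>v. filter (\<lambda>x. val P x = v) (reading P)) (rev [1..<Suc n]))"
      unfolding sorted_wrt_map
      by (rule sorted_wrt_mono_rel[rotated]) (auto simp: removed_before_def)
  qed
  moreover have set: "set ?xs = cells P"
  proof -
    have "val P x \<in> {1..n}" if "x \<in> cells P" for x
    proof -
      have "val P ` cells P = set (path_word P)"
        using arg_cong[OF val_reading[of P], of set] by (simp add: set_reading)
      then show ?thesis using that assms(2) by blast
    qed
    then show ?thesis by (auto simp: set_reading less_Suc_eq_le simp del: upt_Suc)
  qed
  ultimately have "omega_word P (length ?xs) (set ?xs) = map pos ?xs"
    using omega_word_eq[OF assms(1)] by blast
  moreover have "distinct ?xs"
  proof -
    have "sorted_wrt (\<noteq>) ?xs"
      using \<open>sorted_wrt (removed_before P) ?xs\<close> by (rule sorted_wrt_mono_rel[rotated]) (auto simp: removed_before_def)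
    moreover have "sorted_wrt (\<noteq>) xs \<Longrightarrow> distinct xs" for xs :: "'c list"
      by (induction xs) auto
    ultimately show ?thesis by blast
  qed
  then have "card (cells P) = length ?xs" using set distinct_card by metis
  ultimately have "omega P = map pos ?xs" by (simp only: omega_def set)
  then show ?thesis by (simp add: map_concat positions_def[abs_def] o_def del: upt_Suc)
qed

section \<open>The Yamanouchi condition expressed by the positions of the letters\<close>

definition letter_positions :: "(nat \<times> 'b) list \<Rightarrow> nat \<Rightarrow> 'b list" where
  "letter_positions R v = map snd (filter (\<lambda>x. fst x = v) R)"

lemma letter_positions_snoc:
  "letter_positions (R @ [(a, p)]) v = letter_positions R v @ (if a = v then [p] else [])"
  by (simp add: letter_positions_def)

lemma length_letter_positions: "length (letter_positions R v) = count_list (rev (map fst R)) v"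
  by (induction R) (auto simp: letter_positions_def)

text \<open>The Yamanouchi condition says that the c-th letter i + 1 is read after the c-th letter
  i. Positions can stand for reading times: several letters may share a position, but there the
  larger ones are read first, so i is read before i + 1 iff its position is strictly
  smaller.\<close>

lemma yam_iff_above:
  fixes R :: "(nat \<times> 'b::linorder) list"
  assumes "sorted_wrt (\<lambda>x y. snd x < snd y \<or> snd x = snd y \<and> fst y \<le> fst x) R" "\<forall>a \<in> set (map fst R). 1 \<le> a"
  shows "yam0 (rev (map fst R)) \<longleftrightarrow>
    (\<forall>i\<ge>1. above (letter_positions R i) (letter_positions R (Suc i)))"
  using assms
proof (induction R rule: rev_induct)
  case Nil
  then show ?case by (simp add: dominant_def above_def letter_positions_def)
next
  case (snoc x R)
  obtain a p where x: "x = (a, p)" by (cases x)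
  let ?V = "letter_positions R" and ?V' = "letter_positions (R @ [x])"
  have before: "q < p \<or> q = p \<and> a \<le> v" if "q \<in> set (?V v)" for q v
    using that snoc.prems x by (auto simp: letter_positions_def sorted_wrt_append)
  have IH: "yam0 (rev (map fst R)) \<longleftrightarrow> (\<forall>i\<ge>1. above (?V i) (?V (Suc i)))"
    using snoc by (auto simp: sorted_wrt_append)
  have a: "1 \<le> a" using snoc.prems x by simp
  have count: "((\<lambda>_. 0) \<oplus> (rev (map fst (R @ [x])))) i = length (?V' i)" for i
    by (simp add: length_letter_positions del: rev_append)
  have dom: "dominant ((\<lambda>_. 0) \<oplus> (rev (map fst (R @ [x])))) \<longleftrightarrow> (\<forall>i\<ge>1. length (?V' (Suc i)) \<le> length (?V' i))"
    unfolding dominant_def count ..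
  have "rev (map fst (R @ [x])) = a # rev (map fst R)" using x by simp
  then have "yam0 (rev (map fst (R @ [x]))) \<longleftrightarrow>
      (\<forall>i\<ge>1. above (?V i) (?V (Suc i))) \<and> (\<forall>i\<ge>1. length (?V' (Suc i)) \<le> length (?V' i))"
    using a IH dom by (simp only: yam.simps simp_thms)
  moreover have "above (?V i) (?V (Suc i)) \<and> length (?V' (Suc i)) \<le> length (?V' i) \<longleftrightarrow>
      above (?V' i) (?V' (Suc i))" for i
  proof (intro iffI conjI)
    assume "above (?V i) (?V (Suc i)) \<and> length (?V' (Suc i)) \<le> length (?V' i)"
    then have ab: "above (?V i) (?V (Suc i))" and len: "length (?V' (Suc i)) \<le> length (?V' i)" by auto
    show "above (?V' i) (?V' (Suc i))"
    proof (cases "a = Suc i")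
      case True
      then have V': "?V' i = ?V i" "?V' (Suc i) = ?V (Suc i) @ [p]" using x by (auto simp: letter_positions_snoc)
      let ?c = "length (?V (Suc i))"
      have "?c < length (?V i)" using len V' by simp
      then have "?V i ! ?c < p" using before[OF nth_mem, of ?c i] True by auto
      then show ?thesis using ab len V' by (auto simp: above_def nth_append less_Suc_eq)
    next
      case False
      then show ?thesis using ab x by (auto simp: letter_positions_snoc above_def nth_append)
    qed
  next
    assume ab: "above (?V' i) (?V' (Suc i))"
    then show "length (?V' (Suc i)) \<le> length (?V' i)" by (simp add: above_def)
    show "above (?V i) (?V (Suc i))"
    proof (cases "a = i")
      case True
      then have V': "?V' i = ?V i @ [p]" "?V' (Suc i) = ?V (Suc i)" using x by (auto simp: letter_positions_snoc)
      have "length (?V (Suc i)) \<le> length (?V i)"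
      proof (rule ccontr)
        assume "\<not> length (?V (Suc i)) \<le> length (?V i)"
        then have c: "length (?V i) < length (?V (Suc i))" by simp
        then have "p < ?V (Suc i) ! length (?V i)" using ab V' by (auto simp: above_def nth_append)
        then show False using before[OF nth_mem[OF c]] by auto
      qed
      then show ?thesis using ab V' by (auto simp: above_def nth_append)
    next
      case False
      then have V': "?V' i = ?V i" using x by (simp add: letter_positions_snoc)
      show ?thesis using ab V' x by (auto simp: letter_positions_snoc above_def nth_append split: if_splits)
    qed
  qed
  ultimately show ?case by blast
qed

text \<open>If the runs stack up, they are the rows of the tableau of the word. If stacking fails in
  column c, the first c + 1 letters of \<open>V (Suc i)\<close> followed by \<open>V i\<close> from
  column c on form a sorted run one longer than \<open>V i\<close>; with the lower runs this gives i
  runs of total length exceeding the first i parts.\<close>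

lemma runs_shape_iff_above:
  fixes V :: "nat \<Rightarrow> 'b::linorder list"
  assumes sorted: "\<And>i. sorted (V i)" and len: "\<And>k. length (V (Suc k)) = part lam k"
    and lam: "is_partition lam" "length lam \<le> n"
  shows "word_shape (concat (map V (rev [1..<Suc n]))) = lam \<longleftrightarrow> (\<forall>i\<ge>1. above (V i) (V (Suc i)))"
proof
  assume ab: "\<forall>i\<ge>1. above (V i) (V (Suc i))"
  let ?T = "map V [1..<Suc n]"
  have "sorted_wrt above ?T"
    unfolding sorted_wrt_iff_nth_Suc_transp[OF transp_above] using ab by (auto simp del: upt_Suc)
  then have T: "wtab ?T" using sorted by (auto simp: wtab_def)
  have "row_word ?T = concat (map V (rev [1..<Suc n]))" by (simp only: row_word_def rev_map)
  then have "part (word_shape (concat (map V (rev [1..<Suc n])))) = part (shape ?T)"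
    using part_word_shape[OF T knuth_equiv.refl] by simp
  also have "\<dots> = part lam"
  proof
    fix i
    have "part (shape ?T) i = (if i < n then length (V (Suc i)) else 0)"
      by (simp add: part_shape del: upt_Suc)
    then show "part (shape ?T) i = part lam i" using len[of i] lam(2) by (simp add: part_def)
  qed
  finally show "word_shape (concat (map V (rev [1..<Suc n]))) = lam"
    using is_partition_word_shape lam(1) by (intro partition_eqI) (auto simp: is_partition_def)
next
  assume shape: "word_shape (concat (map V (rev [1..<Suc n]))) = lam"
  have mono: "length (V (Suc i)) \<le> length (V i)" if "1 \<le> i" for i
    using len[of "i - 1"] len[of i] that part_antimono[of lam "i - 1" i] lam(1) by (simp add: is_partition_def)
  show "\<forall>i\<ge>1. above (V i) (V (Suc i))"
  proof (intro allI impI, rule ccontr)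
    fix i :: nat assume i: "1 \<le> i" and "\<not> above (V i) (V (Suc i))"
    then obtain c where c: "c < length (V (Suc i))" "\<not> V i ! c < V (Suc i) ! c"
      using mono[OF i] by (auto simp: above_def)
    have ci: "c < length (V i)" using c(1) mono[OF i] by simp
    have "i < n"
    proof (rule ccontr)
      assume "\<not> i < n"
      then have "part lam i = 0" using lam(2) by (simp add: part_def)
      then show False using len[of i] c(1) by simp
    qed
    let ?R = "take (Suc c) (V (Suc i)) @ drop c (V i)"
    have le1: "x \<le> V (Suc i) ! c" if "x \<in> set (take (Suc c) (V (Suc i)))" for x
      using that sorted_nth_mono[OF sorted[of "Suc i"]] c(1) by (auto simp: in_set_conv_nth)
    have le2: "V i ! c \<le> y" if "y \<in> set (drop c (V i))" for y
      using that sorted_nth_mono[OF sorted[of i]] ci by (auto simp: in_set_conv_nth)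
    have "x \<le> y" if "x \<in> set (take (Suc c) (V (Suc i)))" "y \<in> set (drop c (V i))" for x y
      using le1[OF that(1)] le2[OF that(2)] c(2) by order
    then have R: "sorted ?R" using sorted by (auto simp: sorted_append sorted_wrt_take sorted_wrt_drop)
    let ?Rs = "?R # map V (rev [1..<i])"
    have "[1..<Suc n] = [1..<i] @ [i, Suc i] @ [Suc (Suc i)..<Suc n]"
      using i \<open>i < n\<close> upt_add_eq_append[of 1 i "Suc n - i"] by (simp add: upt_conv_Cons del: upt_Suc)
    then have split: "concat (map V (rev [1..<Suc n])) =
        concat (map V (rev [Suc (Suc i)..<Suc n])) @ (V (Suc i) @ V i) @ concat (map V (rev [1..<i]))"
      by (simp del: upt_Suc)
    have "subseq (take (Suc c) (V (Suc i)) @ drop c (V i)) (V (Suc i) @ V i)"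
      by (intro list_emb_append_mono) (metis append_take_drop_id prefixI prefix_imp_subseq, metis append_take_drop_id suffixI suffix_imp_subseq)
    then have "subseq (?R @ concat (map V (rev [1..<i]))) ((V (Suc i) @ V i) @ concat (map V (rev [1..<i])))"
      by (rule list_emb_append_mono[OF _ subseq_order.refl])
    from list_emb_append2[OF this] have "subseq (concat ?Rs) (concat (map V (rev [1..<Suc n])))"
      unfolding split by (simp only: concat.simps)
    moreover have "length ?Rs \<le> i" using i by simp
    ultimately have "sum_list (map length ?Rs) \<le> (\<Sum>k<i. part lam k)"
      using word_shape_upper[of ?Rs _ i] R sorted shape by auto
    moreover have "sum_list (map length (map V (rev [1..<i]))) = (\<Sum>k<i - 1. part lam k)"
    proof -
      have "sum_list (map length (map V (rev [1..<i]))) = sum_list (map (\<lambda>j. length (V j)) [1..<i])"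
        by (simp add: o_def rev_map[symmetric])
      also have "\<dots> = (\<Sum>j=1..<i. length (V j))" by (simp add: interv_sum_list_conv_sum_set_nat)
      also have "\<dots> = (\<Sum>k<i - 1. part lam k)"
        using sum.shift_bounds_Suc_ivl[of "\<lambda>j. length (V j)" 0 "i - 1"] i len
        by (cases i) (simp_all add: atLeast0LessThan)
      finally show ?thesis .
    qed
    moreover have "length ?R = Suc (length (V i))" using c ci by simp
    moreover have "length (V i) = part lam (i - 1)" using len[of "i - 1"] i by simp
    moreover have "(\<Sum>k<i. part lam k) = (\<Sum>k<i - 1. part lam k) + part lam (i - 1)"
      using i by (cases i) auto
    ultimately show False by simp
  qed
qed

lemma count_path_word: "(\<Sum>p\<leftarrow>P. count_list (row_word p) k) = count_list (path_word P) k"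
  by (induction P) (auto simp: path_word_def)

lemma classical_iff_yam:
  assumes P: "P \<in> paths n lam \<mu>" and lam: "is_partition lam" "height lam \<le> n"
  shows "word_shape (omega P) = lam \<longleftrightarrow> yam0 (path_word P)"
proof -
  have tab: "p \<in> tableaux n (shape p)" if "p \<in> set P" for p
    using P that by (auto simp: paths_def in_set_conv_nth tableaux_def)
  have tabs: "\<forall>p \<in> set P. tableau p" using tab tableauxD(1) by blast
  have letters: "set (path_word P) \<subseteq> {1..n}"
    using tab tableauxD(4) by (fastforce simp: path_word_def)
  define R where "R = map (\<lambda>x. (val P x, pos x)) (reading P)"
  have fst: "map fst R = rev (path_word P)" by (simp add: R_def o_def val_reading[symmetric])
  have V: "positions P = letter_positions R"
    by (auto simp: fun_eq_iff positions_def letter_positions_def R_def filter_map o_def)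
  have srt: "sorted_wrt (\<lambda>x y. snd x < snd y \<or> snd x = snd y \<and> fst y \<le> fst x) R"
    unfolding R_def sorted_wrt_map
  proof (rule sorted_wrt_mono_rel[OF _ sorted_reading])
    fix x y assume xy: "x \<in> set (reading P)" "y \<in> set (reading P)" "read_before x y"
    obtain j k c j' k' c' where x: "x = (j, k, c)" and y: "y = (j', k', c')" by (cases x, cases y)
    have "val P y \<le> val P x" if "j = j'" "k = k'" "c' < c"
      using row_mono[of "P ! j" k c' c] xy(1,2) x y that tabs by (auto simp: set_reading cells_def val_def)
    then show "snd (val P x, pos x) < snd (val P y, pos y) \<or> snd (val P x, pos x) = snd (val P y, pos y) \<and>
        fst (val P y, pos y) \<le> fst (val P x, pos x)"
      using xy(3) x y by (auto simp: read_before_def pos_def)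
  qed
  have sorted: "sorted (letter_positions R i)" for i
  proof -
    have "sorted_wrt (\<lambda>x y. snd x \<le> snd y) R"
      using srt by (rule sorted_wrt_mono_rel[rotated]) auto
    then show ?thesis unfolding letter_positions_def sorted_wrt_map by (rule sorted_wrt_filter)
  qed
  have len: "length (letter_positions R (Suc k)) = part lam k" for k
  proof -
    have l: "length (letter_positions R (Suc k)) = count_list (path_word P) (Suc k)"
      by (simp add: length_letter_positions fst)
    show ?thesis
    proof (cases "k < n")
      case True
      then show ?thesis using P l by (auto simp: paths_def count_path_word)
    next
      case False
      then have "Suc k \<notin> set (path_word P)" using letters by auto
      then show ?thesis using l False lam(2) by (simp add: part_def height_def)
    qed
  qed
  have "omega P = concat (map (letter_positions R) (rev [1..<Suc n]))"
    using omega_eq[OF tabs letters] V by simp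
  then have "word_shape (omega P) = lam \<longleftrightarrow> (\<forall>i\<ge>1. above (letter_positions R i) (letter_positions R (Suc i)))"
    using runs_shape_iff_above[OF sorted len lam(1)] lam(2) by (simp add: height_def)
  also have "\<dots> \<longleftrightarrow> yam0 (rev (map fst R))"
    using letters by (intro yam_iff_above[OF srt, symmetric]) (auto simp: fst)
  finally show ?thesis by (simp add: fst)
qed

section \<open>Transposition of paths\<close>

text \<open>The list begins with the rightmost step, which is read first; \<beta> records the boxes
  added so far. The transposed word of a step need not be a row word, so it is replaced by its
  tableau.\<close>

primrec transpose_path :: "(nat \<Rightarrow> nat) \<Rightarrow> path \<Rightarrow> path" where
  "transpose_path \<beta> [] = []"
| "transpose_path \<beta> (p # P) = tableau_of_word (trw \<beta> (row_word p)) # transpose_path (\<beta> \<oplus> row_word p) P"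

lemma path_word_simps [simp]:
  "path_word [] = []" "path_word (p # P) = path_word P @ row_word p"
  "path_word (P @ Q) = path_word Q @ path_word P"
  by (simp_all add: path_word_def)

lemma add_count_append: "\<beta> \<oplus> (u @ v) = \<beta> \<oplus> v \<oplus> u"
  by auto

lemma length_transpose_path [simp]: "length (transpose_path \<beta> P) = length P"
  by (induction P arbitrary: \<beta>) auto

lemma path_word_transpose: "path_word (transpose_path \<beta> P) \<approx> trw \<beta> (path_word P)"
proof (induction P arbitrary: \<beta>)
  case (Cons p P)
  show ?case
    using knuth_cong[OF Cons row_word_tableau_of_word] by (simp add: trw_append)
qed (simp add: knuth_equiv.refl)

lemma nth_transpose_path:
  "i < length P \<Longrightarrow>
    transpose_path \<beta> P ! i = tableau_of_word (trw (\<beta> \<oplus> path_word (take i P)) (row_word (P ! i)))"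
proof (induction P arbitrary: \<beta> i)
  case (Cons p P)
  show ?case
  proof (cases i)
    case (Suc j)
    have "\<beta> \<oplus> row_word p \<oplus> path_word (take j P) = \<beta> \<oplus> path_word (take i (p # P))"
      using Suc by auto
    then show ?thesis using Cons.IH[of j "\<beta> \<oplus> row_word p"] Cons.prems Suc by simp
  qed simp
qed simp

lemma yam_nth:
  assumes "yam \<beta> (path_word P)" "i < length P"
  shows "yam (\<beta> \<oplus> path_word (take i P)) (row_word (P ! i))"
proof -
  have "P = take i P @ P ! i # drop (Suc i) P" using assms(2) by (simp add: id_take_nth_drop)
  then have "path_word P = path_word (drop (Suc i) P) @ row_word (P ! i) @ path_word (take i P)"
    by (metis append.assoc path_word_simps(2,3))
  then show ?thesis using assms(1) by (simp add: yam_append)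
qed

lemma yam_nth_pair:
  assumes "yam \<beta> (path_word P)" "Suc i < length P"
  shows "yam (\<beta> \<oplus> path_word (take i P)) (row_word (P ! Suc i) @ row_word (P ! i))"
proof -
  have "take (Suc i) P = take i P @ [P ! i]" using assms(2) by (simp add: take_Suc_conv_app_nth)
  then have "path_word (take (Suc i) P) = row_word (P ! i) @ path_word (take i P)" by simp
  then have "\<beta> \<oplus> path_word (take (Suc i) P) = \<beta> \<oplus> path_word (take i P) \<oplus> row_word (P ! i)"
    by (simp only: add_count_append)
  then show ?thesis
    using yam_nth[OF assms] yam_nth[OF assms(1), of i] assms(2) unfolding yam_append by simp
qed

lemma shape_nth_transpose:
  assumes "yam \<beta> (path_word P)" "i < length P" "tableau (P ! i)"
  shows "shape (transpose_path \<beta> P ! i) = conjugate (shape (P ! i))"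
  using nth_transpose_path[OF assms(2), of \<beta>] word_shape_trw[OF yam_nth[OF assms(1,2)]]
    word_shape_row_word[OF assms(3)] by (simp add: word_shape_def)

lemma transpose_pair:
  assumes "Suc i < length P"
  shows "row_word (transpose_path \<beta> P ! Suc i) @ row_word (transpose_path \<beta> P ! i) \<approx>
    trw (\<beta> \<oplus> path_word (take i P)) (row_word (P ! Suc i) @ row_word (P ! i))"
proof -
  have "take (Suc i) P = take i P @ [P ! i]" using assms by (simp add: take_Suc_conv_app_nth)
  then have "path_word (take (Suc i) P) = row_word (P ! i) @ path_word (take i P)" by simp
  then have eq: "\<beta> \<oplus> path_word (take (Suc i) P) = \<beta> \<oplus> path_word (take i P) \<oplus> row_word (P ! i)"
    by (simp only: add_count_append)
  show ?thesis
    unfolding trw_append nth_transpose_path[OF assms] nth_transpose_path[OF Suc_lessD[OF assms]] eq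
    by (rule knuth_cong[OF row_word_tableau_of_word row_word_tableau_of_word])
qed

lemma transpose_transpose_path:
  assumes "fin_supp \<beta>" "yam \<beta> (path_word P)" "\<forall>p \<in> set P. tableau p"
  shows "transpose_path (conjf \<beta>) (transpose_path \<beta> P) = P"
  using assms
proof (induction P arbitrary: \<beta>)
  case (Cons p P)
  let ?x = "row_word p"
  let ?z = "row_word (tableau_of_word (trw \<beta> ?x))"
  have y: "yam \<beta> ?x" "yam (\<beta> \<oplus> ?x) (path_word P)" using Cons.prems(2) by (auto simp: yam_append)
  have letters: "\<forall>a \<in> set ?x. 1 \<le> a" using yam_letters[OF y(1)] by blast
  have z: "?z \<approx> trw \<beta> ?x" by (rule row_word_tableau_of_word)
  have "yam (conjf \<beta>) (trw \<beta> ?x)" using yam_trw[OF Cons.prems(1) letters] .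
  then have "yam (conjf \<beta>) ?z" using yam_knuth[OF z] by blast
  from trw_knuth[OF z this] have "trw (conjf \<beta>) ?z \<approx> ?x"
    using trw_trw[OF Cons.prems(1) y(1)] by simp
  then have "tableau_of_word (trw (conjf \<beta>) ?z) = p"
    using Cons.prems(3) tableau_of_word_cong tableau_of_row_word by fastforce
  moreover have "conjf \<beta> \<oplus> ?z = conjf (\<beta> \<oplus> ?x)"
    using conjf_add[OF Cons.prems(1) letters] knuth_count[OF z] by simp
  moreover have "transpose_path (conjf (\<beta> \<oplus> ?x)) (transpose_path (\<beta> \<oplus> ?x) P) = P"
    using Cons.IH[OF fin_supp_add[OF Cons.prems(1)] y(2)] Cons.prems(3) by simp
  ultimately show ?case by simp
qed simp

section \<open>Orbits\<close>

definition rect_path :: "nat \<Rightarrow> path \<Rightarrow> bool" where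
  "rect_path n P \<longleftrightarrow> (\<forall>p \<in> set P. \<exists>\<nu> \<in> rectangles. p \<in> tableaux n \<nu>)"

lemma rect_pathD:
  assumes "rect_path n P" "i < length P"
  shows "shape (P ! i) \<in> rectangles" "P ! i \<in> tableaux n (shape (P ! i))"
proof -
  obtain \<nu> where "\<nu> \<in> rectangles" "P ! i \<in> tableaux n \<nu>"
    using assms nth_mem unfolding rect_path_def by blast
  then show "shape (P ! i) \<in> rectangles" "P ! i \<in> tableaux n (shape (P ! i))"
    using tableauxD(3) by auto
qed

lemma path_word_pair:
  assumes "Suc i < length P"
  shows "path_word P = path_word (drop (Suc (Suc i)) P) @ (row_word (P ! Suc i) @ row_word (P ! i)) @
    path_word (take i P)"
proof -
  have "P = take i P @ P ! i # P ! Suc i # drop (Suc (Suc i)) P"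
    using assms by (simp add: Cons_nth_drop_Suc)
  then have "path_word P = path_word (take i P @ P ! i # P ! Suc i # drop (Suc (Suc i)) P)" by simp
  then show ?thesis by (simp only: path_word_simps append.assoc)
qed

lemma path_word_update:
  assumes "Suc i < length P" "row_word q' @ row_word q \<approx> row_word (P ! Suc i) @ row_word (P ! i)"
  shows "path_word (P[Suc i := q', i := q]) \<approx> path_word P"
  using knuth_append[OF assms(2)] assms(1)
  by (simp add: path_word_pair[of i P] path_word_pair[of i "P[Suc i := q', i := q]"])

lemma sigma_at:
  assumes "rect_path n P" "Suc i < length P"
  obtains q' q where "sigma_at n i P = P[Suc i := q', i := q]" "q' \<in> tableaux n (shape (P ! i))"
    "q \<in> tableaux n (shape (P ! Suc i))" "row_word q' @ row_word q \<approx> row_word (P ! Suc i) @ row_word (P ! i)"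
proof -
  have i: "i < length P" using assms(2) by simp
  note s = sigma_factors(1)[OF rect_pathD(2)[OF assms] rect_pathD(2)[OF assms(1) i]
      rect_pathD(1)[OF assms] rect_pathD(1)[OF assms(1) i]]
  obtain q' q where q: "sigma n (P ! Suc i) (P ! i) = (q', q)" by (metis surj_pair)
  then show thesis using that[of q' q] factorsD[OF s[unfolded q]] by (simp add: sigma_at_def)
qed

lemma sigma_at_rect_path:
  assumes "rect_path n P" "Suc i < length P"
  shows "rect_path n (sigma_at n i P)" "path_word (sigma_at n i P) \<approx> path_word P"
    "length (sigma_at n i P) = length P"
    "shape (sigma_at n i P ! i) = shape (P ! Suc i)" "shape (sigma_at n i P ! Suc i) = shape (P ! i)"
    "\<And>j. j \<noteq> i \<Longrightarrow> j \<noteq> Suc i \<Longrightarrow> sigma_at n i P ! j = P ! j"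
    "sigma_at n i (sigma_at n i P) = P"
proof -
  have i: "i < length P" using assms(2) by simp
  obtain q' q where q: "sigma_at n i P = P[Suc i := q', i := q]" "q' \<in> tableaux n (shape (P ! i))"
    "q \<in> tableaux n (shape (P ! Suc i))" "row_word q' @ row_word q \<approx> row_word (P ! Suc i) @ row_word (P ! i)"
    using sigma_at[OF assms] by blast
  let ?Q = "P[Suc i := q', i := q]"
  have "set ?Q \<subseteq> insert q (insert q' (set P))"
    using set_update_subset_insert[of "P[Suc i := q']" i q] set_update_subset_insert[of P "Suc i" q'] by blast
  then show 1: "rect_path n (sigma_at n i P)"
    using assms(1) q rect_pathD(1)[OF assms] rect_pathD(1)[OF assms(1) i] by (auto simp: rect_path_def)
  show "path_word (sigma_at n i P) \<approx> path_word P"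
    unfolding q(1) by (rule path_word_update[OF assms(2) q(4)])
  show len: "length (sigma_at n i P) = length P" by (simp add: q(1))
  show "shape (sigma_at n i P ! i) = shape (P ! Suc i)" "shape (sigma_at n i P ! Suc i) = shape (P ! i)"
    using q i assms(2) tableauxD(3) by auto
  show "\<And>j. j \<noteq> i \<Longrightarrow> j \<noteq> Suc i \<Longrightarrow> sigma_at n i P ! j = P ! j" by (simp add: q(1))
  have "(P ! Suc i, P ! i) \<in> factors n (shape q) (shape q') (row_word q' @ row_word q)"
    using rect_pathD(2)[OF assms] rect_pathD(2)[OF assms(1) i] q(4) tableauxD(3)[OF q(2)] tableauxD(3)[OF q(3)]
      knuth_equiv.sym by (simp add: factors_def)
  moreover have "q' \<in> tableaux n (shape q')" "q \<in> tableaux n (shape q)"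
    "shape q' \<in> rectangles" "shape q \<in> rectangles"
    using q(2,3) rect_pathD(1)[OF assms] rect_pathD(1)[OF assms(1) i] tableauxD(3)[OF q(2)] tableauxD(3)[OF q(3)]
    by auto
  ultimately have "sigma n q' q = (P ! Suc i, P ! i)" using sigma_factors(2) by blast
  moreover have "?Q ! Suc i = q'" "?Q ! i = q" using assms(2) by simp_all
  ultimately have "sigma_at n i ?Q = ?Q[Suc i := P ! Suc i, i := P ! i]" by (simp add: sigma_at_def)
  also have "\<dots> = P" by (simp add: list_update_swap[of i "Suc i"] list_eq_iff_nth_eq nth_list_update)
  finally show "sigma_at n i (sigma_at n i P) = P" by (simp only: q(1))
qed

lemma sigma_step_iff:
  "(P, Q) \<in> sigma_step n \<longleftrightarrow> rect_path n P \<and> (\<exists>i. Suc i < length P \<and> Q = sigma_at n i P)"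
  by (auto simp: sigma_step_def rect_path_def)

lemma sigma_step_sym: "(P, Q) \<in> sigma_step n \<Longrightarrow> (Q, P) \<in> sigma_step n"
  unfolding sigma_step_iff by (metis sigma_at_rect_path(1,3,7))

lemma orbit_eq: "orbit n P = {Q. (P, Q) \<in> (sigma_step n)\<^sup>*}"
proof -
  have "(sigma_step n)\<inverse> = sigma_step n" using sigma_step_sym by auto
  then show ?thesis by (simp add: orbit_def)
qed

lemma orbit_induct [consumes 2, case_names refl step]:
  assumes "Q \<in> orbit n P" "rect_path n P" "R P"
    and "\<And>Q i. Q \<in> orbit n P \<Longrightarrow> rect_path n Q \<Longrightarrow> R Q \<Longrightarrow> Suc i < length Q \<Longrightarrow> R (sigma_at n i Q)"
  shows "R Q"
proof -
  have "(P, Q) \<in> (sigma_step n)\<^sup>*" using assms(1) by (simp add: orbit_eq)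
  then have "rect_path n Q \<and> R Q"
  proof (induction rule: rtrancl_induct)
    case (step Q Q')
    then show ?case using assms(4)[of Q] sigma_at_rect_path(1)[of n Q]
      by (auto simp: sigma_step_iff orbit_eq)
  qed (use assms in auto)
  then show ?thesis by blast
qed

lemma orbit_sigma_at:
  assumes "Q \<in> orbit n P" "rect_path n Q" "Suc i < length Q"
  shows "sigma_at n i Q \<in> orbit n P"
proof -
  have "(Q, sigma_at n i Q) \<in> sigma_step n" using assms(2,3) by (auto simp: sigma_step_iff)
  then show ?thesis using assms(1) unfolding orbit_eq by (auto intro: rtrancl_into_rtrancl)
qed

lemma orbit_refl: "P \<in> orbit n P"
  by (simp add: orbit_eq)

lemma orbit_path:
  assumes "Q \<in> orbit n P" "rect_path n P"
  shows "rect_path n Q" "length Q = length P" "path_word Q \<approx> path_word P"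
proof -
  have "rect_path n Q \<and> length Q = length P \<and> path_word Q \<approx> path_word P"
    using assms
  proof (induction rule: orbit_induct)
    case (step Q i)
    then show ?case using sigma_at_rect_path(1-3)[of n Q i] knuth_equiv.trans by metis
  qed (use assms in \<open>auto intro: knuth_equiv.refl\<close>)
  then show "rect_path n Q" "length Q = length P" "path_word Q \<approx> path_word P" by auto
qed

lemma length_le_path_word: "p \<in> set P \<Longrightarrow> length (row_word p) \<le> length (path_word P)"
  by (induction P) auto

lemma length_le_row_word: "r \<in> set T \<Longrightarrow> length r \<le> length (row_word T)"
  by (induction T) auto

lemma length_le_row_word': "[] \<notin> set T \<Longrightarrow> length T \<le> length (row_word T)"
proof (induction T)
  case (Cons r T)
  then show ?case by (cases r) auto
qed simp

text \<open>The length of the path word and the range of its letters are constant on an orbit, and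
  rows are nonempty. Finiteness is essential for \<open>path_weight\<close>, where
  \<open>card\<close> and sums over an infinite set would be 0.\<close>

lemma finite_orbit:
  assumes "rect_path n P" shows "finite (orbit n P)"
proof -
  let ?N = "length (path_word P)"
  let ?rows = "{r. set r \<subseteq> {1..n} \<and> length r \<le> ?N}"
  let ?tabs = "{T. set T \<subseteq> ?rows \<and> length T \<le> ?N}"
  have "finite {Q. set Q \<subseteq> ?tabs \<and> length Q = length P}"
    by (intro finite_lists_length_eq finite_lists_length_le finite_atLeastAtMost)
  moreover have "orbit n P \<subseteq> {Q. set Q \<subseteq> ?tabs \<and> length Q = length P}"
  proof
    fix Q assume "Q \<in> orbit n P"
    note Q = orbit_path[OF this assms]
    have "p \<in> ?tabs" if "p \<in> set Q" for p
    proof -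
      obtain \<nu> where "p \<in> tableaux n \<nu>" using Q(1) \<open>p \<in> set Q\<close> by (auto simp: rect_path_def)
      note t = tableauxD[OF this]
      have N: "length (row_word p) \<le> ?N" using length_le_path_word[OF that] knuth_length[OF Q(3)] by simp
      have "length r \<le> ?N" if "r \<in> set p" for r using length_le_row_word[OF that] N by simp
      moreover have "set r \<subseteq> {1..n}" if "r \<in> set p" for r using t(4) that by (auto simp: row_word_def)
      moreover have "length p \<le> ?N" using length_le_row_word'[of p] t(1) N by (simp add: tableau_iff)
      ultimately show ?thesis by blast
    qed
    then show "Q \<in> {Q. set Q \<subseteq> ?tabs \<and> length Q = length P}" using Q(2) by blast
  qed
  ultimately show ?thesis by (rule finite_subset[rotated])
qed

section \<open>Averaging over an orbit\<close>

definition overlap :: "path \<Rightarrow> nat \<Rightarrow> nat \<Rightarrow> nat" where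
  "overlap Q i j = psize (part_inter (shape (Q ! i)) (shape (Q ! j)))"

lemma part_inter_commute: "part_inter \<nu> \<nu>' = part_inter \<nu>' \<nu>"
  by (simp add: part_inter_def min.commute)

lemma overlap_commute: "overlap Q i j = overlap Q j i"
  by (simp add: overlap_def part_inter_commute)

lemma sum_pairs_symmetric:
  fixes f :: "nat \<Rightarrow> nat \<Rightarrow> nat"
  assumes "\<And>i j. f i j = f j i"
  shows "2 * (\<Sum>j<l. \<Sum>i<j. f i j) + (\<Sum>i<l. f i i) = (\<Sum>i<l. \<Sum>j<l. f i j)"
proof (induction l)
  case (Suc l)
  have "(\<Sum>i<l. f i l) = (\<Sum>i<l. f l i)" by (rule sum.cong) (use assms in auto)
  then show ?case using Suc by (simp add: sum.distrib)
qed simp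

lemma sum_pairs_permute:
  fixes f :: "nat \<Rightarrow> nat \<Rightarrow> nat"
  assumes sym: "\<And>i j. f i j = f j i" and "bij_betw t {..<l} {..<l}"
  shows "(\<Sum>j<l. \<Sum>i<j. f (t i) (t j)) = (\<Sum>j<l. \<Sum>i<j. f i j)"
proof -
  have r: "(\<Sum>i<l. g (t i)) = (\<Sum>i<l. g i)" for g :: "nat \<Rightarrow> nat"
    using sum.reindex_bij_betw[OF assms(2)] by simp
  have "(\<Sum>i<l. \<Sum>j<l. f (t i) (t j)) = (\<Sum>i<l. \<Sum>j<l. f i j)"
    using r[of "\<lambda>i. \<Sum>j<l. f i j"] r[of "f (t _)"] by (simp add: r)
  moreover have "(\<Sum>i<l. f (t i) (t i)) = (\<Sum>i<l. f i i)" using r[of "\<lambda>i. f i i"] .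
  ultimately show ?thesis
    using sum_pairs_symmetric[of f l, OF sym] sum_pairs_symmetric[of "\<lambda>i j. f (t i) (t j)" l, OF sym] by simp
qed

definition adjswap :: "nat \<Rightarrow> nat \<Rightarrow> nat" where
  "adjswap k i = (if i = k then Suc k else if i = Suc k then k else i)"

lemma bij_adjswap: "Suc k < l \<Longrightarrow> bij_betw (adjswap k) {..<l} {..<l}"
  by (rule bij_betw_byWitness[of _ "adjswap k"]) (auto simp: adjswap_def)

lemma overlap_sigma_at:
  assumes "rect_path n Q" "Suc k < length Q"
  shows "overlap (sigma_at n k Q) i j = overlap Q (adjswap k i) (adjswap k j)"
proof -
  have "shape (sigma_at n k Q ! i) = shape (Q ! adjswap k i)" for i
    using sigma_at_rect_path(4-6)[OF assms] by (auto simp: adjswap_def)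
  then show ?thesis by (simp add: overlap_def)
qed

lemma rect_norm_orbit:
  assumes "Q \<in> orbit n P" "rect_path n P"
  shows "(\<Sum>j<length P. \<Sum>i<j. overlap Q i j) = rect_norm (map shape P)"
  using assms
proof (induction rule: orbit_induct)
  case refl
  then show ?case by (auto simp: rect_norm_def overlap_def intro!: sum.cong)
next
  case (step Q k)
  have "Suc k < length P" using orbit_path(2)[OF step(1) assms(2)] step by simp
  then show ?case
    using sum_pairs_permute[of "overlap Q", OF overlap_commute bij_adjswap] step
    by (simp add: overlap_sigma_at)
qed

lemma bij_sigma_at_orbit:
  assumes "rect_path n P" "Suc k < length P"
  shows "bij_betw (sigma_at n k) (orbit n P) (orbit n P)"
proof (rule bij_betw_byWitness[of _ "sigma_at n k"])
  have Q: "rect_path n Q \<and> Suc k < length Q" if "Q \<in> orbit n P" for Q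
    using orbit_path(1,2)[OF that assms(1)] assms(2) by simp
  show "\<forall>Q\<in>orbit n P. sigma_at n k (sigma_at n k Q) = Q"
    "\<forall>Q\<in>orbit n P. sigma_at n k (sigma_at n k Q) = Q"
    using Q sigma_at_rect_path(7) by auto
  show "sigma_at n k ` orbit n P \<subseteq> orbit n P" "sigma_at n k ` orbit n P \<subseteq> orbit n P"
    using Q orbit_sigma_at by auto
qed

text \<open>Each \<open>\<sigma>\<^sub>k\<close> permutes the orbit and swaps the shapes of two adjacent steps, and adjacent swaps act
  transitively on pairs of positions. In particular no braid relations are needed.\<close>

lemma overlap_sum_const:
  assumes "rect_path n P" "i < j" "j < length P"
  shows "(\<Sum>Q\<in>orbit n P. overlap Q i j) = (\<Sum>Q\<in>orbit n P. overlap Q 0 1)"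
proof -
  have swap: "(\<Sum>Q\<in>orbit n P. overlap Q i j) = (\<Sum>Q\<in>orbit n P. overlap Q (adjswap k i) (adjswap k j))"
    if "Suc k < length P" for i j k
  proof -
    have "(\<Sum>Q\<in>orbit n P. overlap Q i j) = (\<Sum>Q\<in>orbit n P. overlap (sigma_at n k Q) i j)"
      using sum.reindex_bij_betw[OF bij_sigma_at_orbit[OF assms(1) that], of "\<lambda>Q. overlap Q i j"] by simp
    also have "\<dots> = (\<Sum>Q\<in>orbit n P. overlap Q (adjswap k i) (adjswap k j))"
      using orbit_path(1,2)[OF _ assms(1)] that by (intro sum.cong) (auto simp: overlap_sigma_at)
    finally show ?thesis .
  qed
  have first: "(\<Sum>Q\<in>orbit n P. overlap Q i j) = (\<Sum>Q\<in>orbit n P. overlap Q 0 j)" if "i < j" for i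
    using that
  proof (induction i)
    case (Suc i)
    then have "adjswap i (Suc i) = i" "adjswap i j = j" by (auto simp: adjswap_def)
    then show ?case using swap[of i "Suc i" j] Suc assms(3) by simp
  qed simp
  have second: "j < length P \<Longrightarrow> (\<Sum>Q\<in>orbit n P. overlap Q 0 (Suc j)) = (\<Sum>Q\<in>orbit n P. overlap Q 0 1)"
    if "Suc j < length P" for j
    using that
  proof (induction j)
    case (Suc j)
    have "adjswap (Suc j) 0 = 0" "adjswap (Suc j) (Suc (Suc j)) = Suc j" by (auto simp: adjswap_def)
    then show ?case using swap[of "Suc j" 0 "Suc (Suc j)"] Suc by simp
  qed simp
  show ?thesis using first[OF assms(2)] second[of "j - 1"] assms(2,3) by simp
qed

text \<open>This is where the weights i in the path energy matter. Summed over the orbit, all pairs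
  of positions have the same overlap, so the weight i on the adjacent pair at i can be spread over
  the i pairs formed by i and a smaller index; the total then runs over every pair once.\<close>

lemma overlap_average:
  assumes "rect_path n P"
  shows "(\<Sum>Q\<in>orbit n P. \<Sum>i=1..<length P. i * overlap Q i (i - 1)) = card (orbit n P) * rect_norm (map shape P)"
proof -
  let ?O = "orbit n P" and ?L = "length P"
  let ?E = "\<Sum>Q\<in>?O. overlap Q 0 1"
  have "(\<Sum>Q\<in>?O. \<Sum>i=1..<?L. i * overlap Q i (i - 1)) = (\<Sum>i=1..<?L. i * (\<Sum>Q\<in>?O. overlap Q (i - 1) i))"
    by (subst sum.swap) (simp add: sum_distrib_left overlap_commute)
  also have "\<dots> = (\<Sum>i=1..<?L. i * ?E)"
  proof (rule sum.cong)
    fix i assume "i \<in> {1..<?L}"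
    then show "i * (\<Sum>Q\<in>?O. overlap Q (i - 1) i) = i * ?E"
      by (subst overlap_sum_const[OF assms, of "i - 1" i]) auto
  qed simp
  also have "\<dots> = (\<Sum>j<?L. j * ?E)"
    by (rule sum.mono_neutral_left) auto
  also have "\<dots> = (\<Sum>j<?L. \<Sum>i<j. \<Sum>Q\<in>?O. overlap Q i j)"
  proof (rule sum.cong)
    fix j assume "j \<in> {..<?L}"
    then have "(\<Sum>i<j. \<Sum>Q\<in>?O. overlap Q i j) = (\<Sum>i<j. ?E)"
      by (intro sum.cong overlap_sum_const[OF assms]) auto
    then show "j * ?E = (\<Sum>i<j. \<Sum>Q\<in>?O. overlap Q i j)" by simp
  qed simp
  also have "\<dots> = (\<Sum>Q\<in>?O. \<Sum>j<?L. \<Sum>i<j. overlap Q i j)"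
  proof -
    have "(\<Sum>j<?L. \<Sum>i<j. \<Sum>Q\<in>?O. overlap Q i j) = (\<Sum>j<?L. \<Sum>Q\<in>?O. \<Sum>i<j. overlap Q i j)"
      by (intro sum.cong sum.swap) simp
    also have "\<dots> = (\<Sum>Q\<in>?O. \<Sum>j<?L. \<Sum>i<j. overlap Q i j)" by (rule sum.swap)
    finally show ?thesis .
  qed
  also have "\<dots> = (\<Sum>Q\<in>?O. rect_norm (map shape P))"
    by (rule sum.cong) (use rect_norm_orbit[OF _ assms] in auto)
  finally show ?thesis by simp
qed

section \<open>Duality\<close>

abbreviation transpose0 :: "path \<Rightarrow> path" where
  "transpose0 \<equiv> transpose_path (\<lambda>_. 0)"

lemma conjf_zero: "conjf (\<lambda>_. 0) = (\<lambda>_. 0)"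
proof
  fix j show "conjf (\<lambda>_. 0) j = 0" using conjf_0[of "\<lambda>_. 0"] by (cases j) (simp_all add: conjf_def)
qed

lemma fin_supp_zero: "fin_supp (\<lambda>_. 0)"
  by (simp add: fin_supp_def)

text \<open>The properties of a classical path that the duality uses, in a form where transposition
  merely exchanges n and m.\<close>

definition dualizable :: "nat \<Rightarrow> nat \<Rightarrow> path \<Rightarrow> bool" where
  "dualizable n m P \<longleftrightarrow> rect_path n P \<and> yam0 (path_word P) \<and>
    set (path_word P) \<subseteq> {1..n} \<and> set (trw0 (path_word P)) \<subseteq> {1..m}"

lemma conjugate_rectangles: "\<nu> \<in> rectangles \<Longrightarrow> conjugate \<nu> \<in> rectangles"
  by (auto simp: rectangles_def conjugate_replicate)

lemma dualizable_transpose: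
  assumes "dualizable n m P"
  shows "dualizable m n (transpose0 P)" "transpose0 (transpose0 P) = P"
    "\<And>i. i < length P \<Longrightarrow> transpose0 P ! i \<in> tableaux m (conjugate (shape (P ! i)))"
proof -
  have P: "rect_path n P" "yam0 (path_word P)" "set (path_word P) \<subseteq> {1..n}"
    "set (trw0 (path_word P)) \<subseteq> {1..m}"
    using assms by (auto simp: dualizable_def)
  have tab: "tableau (P ! i)" if "i < length P" for i using rect_pathD(2)[OF P(1) that] tableauxD(1) by blast
  note pw = path_word_transpose[of "\<lambda>_. 0" P]
  show tp: "transpose0 P ! i \<in> tableaux m (conjugate (shape (P ! i)))" if i: "i < length P" for i
  proof -
    have "set (row_word (transpose0 P ! i)) \<subseteq> set (path_word (transpose0 P))"
    proof -
      have "transpose0 P ! i \<in> set (transpose0 P)" using i by (intro nth_mem) simp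
      then show ?thesis by (auto simp: path_word_def)
    qed
    then have "set (row_word (transpose0 P ! i)) \<subseteq> {1..m}" using knuth_set[OF pw] P(4) by blast
    moreover have "tableau (transpose0 P ! i)" using nth_transpose_path[OF i] tableau_tableau_of_word by metis
    ultimately show ?thesis using shape_nth_transpose[OF P(2) i tab[OF i]] by (simp add: tableaux_def)
  qed
  have "rect_path m (transpose0 P)"
    unfolding rect_path_def
    using tp rect_pathD(1)[OF P(1)] conjugate_rectangles by (metis in_set_conv_nth length_transpose_path)
  moreover have letters: "\<forall>a \<in> set (path_word P). 1 \<le> a" using P(3) by auto
  have y: "yam0 (path_word (transpose0 P))"
    using yam_trw[OF fin_supp_zero letters] yam_knuth[OF pw] conjf_zero by simp
  moreover have "trw0 (path_word (transpose0 P)) \<approx> path_word P"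
    using trw_knuth[OF pw y] trw_trw[OF fin_supp_zero P(2)] conjf_zero by simp
  then have "set (trw0 (path_word (transpose0 P))) \<subseteq> {1..n}" using knuth_set P(3) by blast
  moreover have "set (path_word (transpose0 P)) \<subseteq> {1..m}" using knuth_set[OF pw] P(4) by blast
  ultimately show "dualizable m n (transpose0 P)" by (simp add: dualizable_def)
  have "\<forall>p\<in>set P. tableau p" using tab by (metis in_set_conv_nth)
  then show "transpose0 (transpose0 P) = P"
    using transpose_transpose_path[OF fin_supp_zero P(2)] conjf_zero by simp
qed

lemma dualizable_orbit:
  assumes "dualizable n m P" "Q \<in> orbit n P" shows "dualizable n m Q"
proof -
  have P: "rect_path n P" "yam0 (path_word P)" using assms by (auto simp: dualizable_def)
  note Q = orbit_path[OF assms(2) P(1)]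
  have "yam0 (path_word Q)" using yam_knuth[OF Q(3)] P(2) by blast
  then show ?thesis using assms(1) Q knuth_set[OF Q(3)] knuth_set[OF trw_knuth[OF Q(3)]]
    by (simp add: dualizable_def)
qed

lemma energy_dual:
  assumes "dualizable n m P" "Suc i < length P"
  shows "energy (P ! Suc i) (P ! i) + energy (transpose0 P ! Suc i) (transpose0 P ! i) = overlap P (Suc i) i"
  unfolding overlap_def
proof (rule energy_transpose)
  have P: "rect_path n P" "yam0 (path_word P)" using assms by (auto simp: dualizable_def)
  have i: "i < length P" using assms(2) by simp
  show "P ! Suc i \<in> tableaux n (shape (P ! Suc i))" "P ! i \<in> tableaux n (shape (P ! i))"
    "shape (P ! Suc i) \<in> rectangles" "shape (P ! i) \<in> rectangles"
    using rect_pathD[OF P(1)] assms(2) i by auto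
  show "transpose0 P ! Suc i \<in> tableaux m (conjugate (shape (P ! Suc i)))"
    "transpose0 P ! i \<in> tableaux m (conjugate (shape (P ! i)))"
    using dualizable_transpose(3)[OF assms(1)] assms(2) i by auto
  show "word_shape (row_word (transpose0 P ! Suc i) @ row_word (transpose0 P ! i)) =
      conjugate (word_shape (row_word (P ! Suc i) @ row_word (P ! i)))"
    using word_shape_cong[OF transpose_pair[OF assms(2)]] word_shape_trw[OF yam_nth_pair[OF P(2) assms(2)]]
    by simp
qed

lemma path_energy_dual:
  assumes "dualizable n m P"
  shows "path_energy P + path_energy (transpose0 P) = (\<Sum>i=1..<length P. i * overlap P i (i - 1))"
proof -
  have "energy (P ! i) (P ! (i - 1)) + energy (transpose0 P ! i) (transpose0 P ! (i - 1)) = overlap P i (i - 1)"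
    if "i \<in> {1..<length P}" for i
    using energy_dual[OF assms, of "i - 1"] that by simp
  then show ?thesis
    unfolding path_energy_def by (simp add: sum.distrib[symmetric] add_mult_distrib2[symmetric])
qed

text \<open>The transposed image pair factors the same plactic class as the transposed pair, with
  the shapes exchanged, so uniqueness identifies it with the value of \<open>sigma\<close>. The
  other steps are unaffected: their starting partitions depend only on the content to their right,
  which \<open>sigma_at\<close> preserves.\<close>

lemma sigma_at_transpose:
  assumes "dualizable n m P" "Suc i < length P"
  shows "sigma_at m i (transpose0 P) = transpose0 (sigma_at n i P)"
proof -
  have P: "rect_path n P" "yam0 (path_word P)" using assms by (auto simp: dualizable_def)
  have i: "i < length P" using assms(2) by simp
  let ?Q = "sigma_at n i P"
  have "?Q \<in> orbit n P" using orbit_sigma_at[OF orbit_refl P(1) assms(2)] .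
  note Q = dualizable_orbit[OF assms(1) this] sigma_at_rect_path[OF P(1) assms(2)]
  have Qi: "Suc i < length ?Q" "i < length ?Q" using Q(4) assms(2) i by simp_all
  have take_i: "take i ?Q = take i P"
    by (rule nth_equalityI) (use Q(4,7) in auto)
  obtain q' q where q: "?Q = P[Suc i := q', i := q]"
    "row_word q' @ row_word q \<approx> row_word (P ! Suc i) @ row_word (P ! i)"
    using sigma_at[OF P(1) assms(2)] by blast
  have pair: "row_word (?Q ! Suc i) @ row_word (?Q ! i) \<approx> row_word (P ! Suc i) @ row_word (P ! i)"
    using q assms(2) i by simp
  let ?\<gamma> = "(\<lambda>_. 0) \<oplus> path_word (take i P)"
  have yQ: "yam ?\<gamma> (row_word (?Q ! Suc i) @ row_word (?Q ! i))"
    using yam_knuth[OF pair] yam_nth_pair[OF P(2) assms(2)] by blast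
  have "row_word (transpose0 ?Q ! Suc i) @ row_word (transpose0 ?Q ! i) \<approx>
      trw ?\<gamma> (row_word (?Q ! Suc i) @ row_word (?Q ! i))"
    using transpose_pair[OF Qi(1), of "\<lambda>_. 0"] take_i by simp
  also have "\<dots> \<approx> trw ?\<gamma> (row_word (P ! Suc i) @ row_word (P ! i))" by (rule trw_knuth[OF pair yQ])
  also have "\<dots> \<approx> row_word (transpose0 P ! Suc i) @ row_word (transpose0 P ! i)"
    by (rule knuth_equiv.sym[OF transpose_pair[OF assms(2)]])
  finally have "(transpose0 ?Q ! Suc i, transpose0 ?Q ! i) \<in>
      factors m (conjugate (shape (P ! i))) (conjugate (shape (P ! Suc i)))
        (row_word (transpose0 P ! Suc i) @ row_word (transpose0 P ! i))"
    using dualizable_transpose(3)[OF Q(1) Qi(1)] dualizable_transpose(3)[OF Q(1) Qi(2)] Q(5,6)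
    by (simp add: factors_def)
  then have sig: "sigma m (transpose0 P ! Suc i) (transpose0 P ! i) = (transpose0 ?Q ! Suc i, transpose0 ?Q ! i)"
    using dualizable_transpose(3)[OF assms] dualizable_transpose(3)[OF assms(1) i]
      conjugate_rectangles rect_pathD(1)[OF P(1) assms(2)] rect_pathD(1)[OF P(1) i]
    by (intro sigma_factors(2))
  have count: "count_list (path_word (take j ?Q)) = count_list (path_word (take j P))" if "j > Suc i" for j
  proof (cases "j \<le> length P")
    case True
    have "take j ?Q = (take j P)[Suc i := q', i := q]" by (simp add: q(1) take_update_swap)
    then show ?thesis
      using path_word_update[of i "take j P" q' q] q(2) that True assms(2) knuth_count by simp
  next
    case False
    then show ?thesis using knuth_count[OF Q(3)] Q(4) by simp
  qed
  have other: "transpose0 ?Q ! j = transpose0 P ! j" if j: "j < length P" "j \<noteq> i" "j \<noteq> Suc i" for j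
  proof -
    have "count_list (path_word (take j ?Q)) = count_list (path_word (take j P))"
    proof (cases "j < i")
      case True
      have "take j ?Q = take j P" by (metis True less_imp_le min.absorb1 take_i take_take)
      then show ?thesis by simp
    next
      case False
      then show ?thesis using count j by simp
    qed
    then show ?thesis
      using nth_transpose_path[of j P] nth_transpose_path[of j ?Q] j Q(4,7) by simp
  qed
  show ?thesis
  proof (rule nth_equalityI)
    fix j assume "j < length (sigma_at m i (transpose0 P))"
    then show "sigma_at m i (transpose0 P) ! j = transpose0 ?Q ! j"
      using other[of j] assms(2) by (auto simp: sigma_at_def sig nth_list_update)
  qed (use Q(4) in \<open>simp add: sigma_at_def sig\<close>)
qed

lemma transpose_orbit_subset:
  assumes "dualizable n m P" shows "transpose0 ` orbit n P \<subseteq> orbit m (transpose0 P)"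
proof
  fix R assume "R \<in> transpose0 ` orbit n P"
  then obtain Q where Q: "Q \<in> orbit n P" "R = transpose0 Q" by blast
  have "rect_path n P" using assms by (simp add: dualizable_def)
  with Q(1) have "transpose0 Q \<in> orbit m (transpose0 P)"
  proof (induction rule: orbit_induct)
    case (step Q i)
    have d: "dualizable n m Q" by (rule dualizable_orbit[OF assms step(1)])
    then have "rect_path m (transpose0 Q)" using dualizable_transpose(1) by (auto simp: dualizable_def)
    then show ?case
      using orbit_sigma_at[OF step(4), of i] step(3) sigma_at_transpose[OF d step(3)] by simp
  qed (rule orbit_refl)
  then show "R \<in> orbit m (transpose0 P)" using Q by simp
qed

lemma transpose_orbit:
  assumes "dualizable n m P" shows "orbit m (transpose0 P) = transpose0 ` orbit n P"
proof
  show "transpose0 ` orbit n P \<subseteq> orbit m (transpose0 P)" by (rule transpose_orbit_subset[OF assms])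
  show "orbit m (transpose0 P) \<subseteq> transpose0 ` orbit n P"
  proof
    fix R assume R: "R \<in> orbit m (transpose0 P)"
    note d = dualizable_transpose[OF assms]
    have "transpose0 R \<in> orbit n P" using transpose_orbit_subset[OF d(1)] R d(2) by auto
    moreover have "transpose0 (transpose0 R) = R"
      using dualizable_transpose(2)[OF dualizable_orbit[OF d(1) R]] .
    ultimately show "R \<in> transpose0 ` orbit n P" by (metis imageI)
  qed
qed

lemma path_weight_dual:
  assumes "dualizable n m P"
  shows "path_weight n P + path_weight m (transpose0 P) = of_nat (rect_norm (map shape P))"
proof -
  have P: "rect_path n P" using assms by (simp add: dualizable_def)
  let ?O = "orbit n P"
  have inj: "inj_on transpose0 ?O"
    using dualizable_transpose(2)[OF dualizable_orbit[OF assms]] by (metis inj_onI)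
  have "(\<Sum>Q\<in>?O. path_energy Q) + (\<Sum>Q\<in>transpose0 ` ?O. path_energy Q) =
      (\<Sum>Q\<in>?O. path_energy Q + path_energy (transpose0 Q))"
    by (simp add: sum.reindex[OF inj] sum.distrib)
  also have "\<dots> = (\<Sum>Q\<in>?O. \<Sum>i=1..<length P. i * overlap Q i (i - 1))"
    using path_energy_dual[OF dualizable_orbit[OF assms]] orbit_path(2)[OF _ P] by (intro sum.cong) auto
  also have "\<dots> = card ?O * rect_norm (map shape P)" by (rule overlap_average[OF P])
  finally have "(\<Sum>Q\<in>?O. path_energy Q) + (\<Sum>Q\<in>transpose0 ` ?O. path_energy Q) = card ?O * rect_norm (map shape P)" .
  then have eq: "of_nat (\<Sum>Q\<in>?O. path_energy Q) + of_nat (\<Sum>Q\<in>transpose0 ` ?O. path_energy Q) =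
      (of_nat (card ?O) * of_nat (rect_norm (map shape P)) :: rat)"
    by (metis of_nat_add of_nat_mult)
  have "card ?O \<noteq> 0" using finite_orbit[OF P] orbit_refl by (metis card_0_eq empty_iff)
  moreover have "card (orbit m (transpose0 P)) = card ?O"
    using transpose_orbit[OF assms] card_image[OF inj] by simp
  ultimately show ?thesis
    unfolding path_weight_def transpose_orbit[OF assms]
    using eq card_image[OF inj] by (simp add: add_divide_distrib[symmetric] del: of_nat_sum)
qed

section \<open>Transposition as a bijection of classical paths\<close>

lemma conjugate_conjugate:
  assumes "is_partition \<nu>" shows "conjugate (conjugate \<nu>) = \<nu>"
proof (rule partition_eqI)
  have s: "sorted_wrt (\<ge>) \<nu>" using assms by (simp add: is_partition_def)
  have s': "sorted_wrt (\<ge>) (conjugate \<nu>)" using is_partition_conjugate[OF s] by (simp add: is_partition_def)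
  show "part (conjugate (conjugate \<nu>)) = part \<nu>"
  proof
    fix j
    have "j < card {k. i < part \<nu> k} \<longleftrightarrow> i < part \<nu> j" for i
    proof -
      have "\<forall>k \<in> {k. i < part \<nu> k}. \<forall>k' \<le> k. k' \<in> {k. i < part \<nu> k}"
        using part_antimono[OF s] by (auto intro: less_le_trans)
      from finite_down_closed[OF finite_part this] show ?thesis by blast
    qed
    then show "part (conjugate (conjugate \<nu>)) j = part \<nu> j"
      by (simp add: part_conjugate[OF s] part_conjugate[OF s'])
  qed
qed (use assms conjugate_pos in \<open>auto simp: is_partition_def\<close>)

lemma rectangle_partition: "\<nu> \<in> rectangles \<Longrightarrow> is_partition \<nu>"
  by (auto simp: rectangles_def is_partition_def sorted_wrt_iff_nth_less)

lemma rect_star: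
  assumes "\<forall>\<nu> \<in> set \<mu>. \<nu> \<in> rectangles"
  shows "\<forall>\<nu> \<in> set (rect_star \<mu>). \<nu> \<in> rectangles" "rect_star (rect_star \<mu>) = \<mu>"
    "rect_norm (rect_star \<mu>) = rect_norm \<mu>"
proof -
  show "\<forall>\<nu> \<in> set (rect_star \<mu>). \<nu> \<in> rectangles" using assms conjugate_rectangles by (auto simp: rect_star_def)
  show "rect_star (rect_star \<mu>) = \<mu>"
    using assms conjugate_conjugate rectangle_partition by (auto simp: rect_star_def intro!: map_idI)
  have rect: "psize (part_inter (replicate a r) (replicate b s)) = min a b * min r s" for a r b s
    by (subst psize_part_inter[of _ _ "min a b"]) (auto simp: part_replicate)
  have "psize (part_inter (conjugate \<nu>) (conjugate \<nu>')) = psize (part_inter \<nu> \<nu>')"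
    if "\<nu> \<in> rectangles" "\<nu>' \<in> rectangles" for \<nu> \<nu>'
    using that by (auto simp: rectangles_def conjugate_replicate rect mult.commute)
  then show "rect_norm (rect_star \<mu>) = rect_norm \<mu>"
    unfolding rect_norm_def rect_star_def using assms by (auto intro!: sum.cong)
qed

lemma paths_rect_path:
  assumes "P \<in> paths n lam \<mu>" "\<forall>\<nu> \<in> set \<mu>. \<nu> \<in> rectangles"
  shows "rect_path n P" "map shape P = \<mu>" "set (path_word P) \<subseteq> {1..n}"
proof -
  have P: "length P = length \<mu>" "\<And>i. i < length \<mu> \<Longrightarrow> P ! i \<in> tableaux n (\<mu> ! i)"
    using assms(1) by (auto simp: paths_def)
  show "rect_path n P" using P assms(2) unfolding rect_path_def by (metis in_set_conv_nth)
  show "map shape P = \<mu>"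
    by (rule nth_equalityI) (use P(1) tableauxD(3)[OF P(2)] in auto)
  show "set (path_word P) \<subseteq> {1..n}"
    using P tableauxD(4) by (fastforce simp: path_word_def in_set_conv_nth)
qed

lemma classical_transpose:
  assumes lam: "is_partition lam" "height lam \<le> n" "height (conjugate lam) \<le> m"
    and \<mu>: "\<forall>\<nu> \<in> set \<mu>. \<nu> \<in> rectangles"
    and P: "P \<in> classical_paths n lam \<mu>"
  shows "dualizable n m P" "transpose0 P \<in> classical_paths m (conjugate lam) (rect_star \<mu>)"
proof -
  have paths: "P \<in> paths n lam \<mu>" using P by (simp add: classical_paths_def)
  note r = paths_rect_path[OF paths \<mu>]
  have y: "yam0 (path_word P)"
    using P classical_iff_yam[OF paths lam(1,2)] by (simp add: classical_paths_def)
  have s: "sorted_wrt (\<ge>) lam" using lam(1) by (simp add: is_partition_def)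
  have len: "length P = length \<mu>" using paths by (simp add: paths_def)
  have content: "count_list (path_word P) (Suc i) = part lam i" for i
  proof (cases "i < n")
    case True
    then have "Suc i \<in> {1..n}" by auto
    then have "(\<Sum>p\<leftarrow>P. count_list (row_word p) (Suc i)) = part lam (Suc i - 1)"
      using paths unfolding paths_def by blast
    then show ?thesis by (simp add: count_path_word)
  next
    case False
    then have "Suc i \<notin> set (path_word P)" using r(3) by auto
    then show ?thesis using False lam(2) by (simp add: part_def height_def)
  qed
  have letters: "\<forall>a \<in> set (path_word P). 1 \<le> a" using r(3) by auto
  have dual_content: "count_list (trw0 (path_word P)) (Suc k) = part (conjugate lam) k" for k
  proof -
    have "{i. 1 \<le> i \<and> Suc k \<le> count_list (path_word P) i} = Suc ` {i. k < part lam i}"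
    proof (intro set_eqI iffI)
      fix i assume "i \<in> {i. 1 \<le> i \<and> Suc k \<le> count_list (path_word P) i}"
      then show "i \<in> Suc ` {i. k < part lam i}" using content[of "i - 1"] by (intro image_eqI[of _ _ "i - 1"]) auto
    qed (use content in auto)
    then have "conjf (count_list (path_word P)) (Suc k) = card {i. k < part lam i}"
      by (simp add: conjf_def card_image)
    then show ?thesis
      using fun_cong[OF conjf_add[OF fin_supp_zero letters], of "Suc k"] conjf_zero
      by (simp add: part_conjugate[OF s])
  qed
  have "set (trw0 (path_word P)) \<subseteq> {1..m}"
  proof
    fix c assume c: "c \<in> set (trw0 (path_word P))"
    then have "1 \<le> c" using trw_letters[OF c] by auto
    moreover have "part (conjugate lam) (c - 1) \<noteq> 0"
    proof -
      have "count_list (trw0 (path_word P)) c \<noteq> 0" using c by (simp add: count_list_0_iff)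
      then show ?thesis using dual_content[of "c - 1"] calculation by simp
    qed
    then have "c - 1 < m" using lam(3) by (auto simp: part_def height_def split: if_splits)
    ultimately show "c \<in> {1..m}" by auto
  qed
  then show d: "dualizable n m P" using r y by (simp add: dualizable_def)
  note t = dualizable_transpose[OF d]
  have "transpose0 P ! i \<in> tableaux m (rect_star \<mu> ! i)" if "i < length \<mu>" for i
    using t(3)[of i] that len r(2) by (metis length_map nth_map rect_star_def)
  moreover have "(\<Sum>p\<leftarrow>transpose0 P. count_list (row_word p) k) = part (conjugate lam) (k - 1)" if "k \<in> {1..m}" for k
    using that dual_content[of "k - 1"] knuth_count[OF path_word_transpose[of "\<lambda>_. 0" P]]
    by (simp add: count_path_word)
  ultimately have paths': "transpose0 P \<in> paths m (conjugate lam) (rect_star \<mu>)"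
    using len by (simp add: paths_def rect_star_def)
  have "yam0 (path_word (transpose0 P))" using t(1) by (simp add: dualizable_def)
  then show "transpose0 P \<in> classical_paths m (conjugate lam) (rect_star \<mu>)"
    using classical_iff_yam[OF paths' is_partition_conjugate[OF s] lam(3)] paths' by (simp add: classical_paths_def)
qed

section \<open>Substitution of 1/q and products of powers of q\<close>

lemma inj_uminus_rat: "inj (uminus :: rat \<Rightarrow> rat)"
  by (simp add: inj_def)

lemma q_inv_add: "q_inv (f + g) = q_inv f + q_inv g"
  by (rule poly_mapping_eqI) (simp add: q_inv_def map_key.rep_eq inj_uminus_rat lookup_add)

lemma q_inv_zero: "q_inv 0 = 0"
  by (rule poly_mapping_eqI) (simp add: q_inv_def map_key.rep_eq inj_uminus_rat)

lemma q_inv_sum: "q_inv (sum f A) = (\<Sum>x\<in>A. q_inv (f x))"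
  by (induction A rule: infinite_finite_induct) (simp_all add: q_inv_zero q_inv_add)

lemma q_pow_mult: "q_pow r * q_pow s = q_pow (r + s)"
  by (simp add: q_pow_def mult_single)

lemma kostka_eq: "kostka n lam \<mu> = (\<Sum>P\<in>classical_paths n lam \<mu>. q_pow (of_nat (rect_norm \<mu>) - path_weight n P))"
  by (simp add: kostka_def cokostka_def q_inv_sum q_inv_q_pow sum_distrib_left q_pow_mult)

theorem theorem7p1:
  fixes lam :: "nat list" and \<mu> :: "nat list list" and n m :: nat
  assumes "is_partition lam"
    and "\<forall>\<nu> \<in> set \<mu>. \<nu> \<in> rectangles"
    and "n \<ge> 2" and "n \<ge> height lam"
    and "m \<ge> 2" and "m \<ge> height (conjugate lam)"
  shows "kostka n lam \<mu> =
    q_pow (of_nat (rect_norm \<mu>)) * q_inv (kostka m (conjugate lam) (rect_star \<mu>))"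
proof -
  let ?C = "classical_paths n lam \<mu>" and ?D = "classical_paths m (conjugate lam) (rect_star \<mu>)"
  note star = rect_star[OF assms(2)]
  have s: "sorted_wrt (\<ge>) lam" using assms(1) by (simp add: is_partition_def)
  have c: "dualizable n m P" "transpose0 P \<in> ?D" if "P \<in> ?C" for P
    using classical_transpose[OF assms(1) assms(4) assms(6) assms(2) that] by auto
  have d: "dualizable m n P" "transpose0 P \<in> ?C" if "P \<in> ?D" for P
    using classical_transpose[OF is_partition_conjugate[OF s] assms(6) _ star(1) that, of n]
      conjugate_conjugate[OF assms(1)] star(2) assms(4) by auto
  have bij: "bij_betw transpose0 ?C ?D"
    by (rule bij_betw_byWitness[of _ transpose0])
      (use c(2) d(2) dualizable_transpose(2)[OF c(1)] dualizable_transpose(2)[OF d(1)] in auto)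
  have weight: "path_weight m (transpose0 P) = of_nat (rect_norm \<mu>) - path_weight n P" if "P \<in> ?C" for P
    using path_weight_dual[OF c(1)[OF that]] paths_rect_path(2)[OF _ assms(2), of P n lam] that
    by (simp add: classical_paths_def algebra_simps)
  \<comment> \<open>The inner polynomial carries the exponent \<open>rect_norm\<close> of
    \<open>rect_star \<mu>\<close>, which equals that of \<mu>. Under 1/q it cancels against the
    outer factor and leaves the bare weights.\<close>
  have "q_pow (of_nat (rect_norm \<mu>)) * q_inv (kostka m (conjugate lam) (rect_star \<mu>)) =
      (\<Sum>P\<in>?D. q_pow (path_weight m P))"
    by (simp add: kostka_eq q_inv_sum q_inv_q_pow sum_distrib_left q_pow_mult star(3))
  also have "\<dots> = (\<Sum>P\<in>?C. q_pow (path_weight m (transpose0 P)))"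
    using sum.reindex_bij_betw[OF bij, of "\<lambda>P. q_pow (path_weight m P)"] by simp
  also have "\<dots> = kostka n lam \<mu>" by (simp add: kostka_eq weight)
  finally show ?thesis by simp
qed

end
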